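(* Let $N$ be a smooth manifold and let $\big((\Lambda_\mu)_{\mu\in I},(\Gamma_\mu)_{\mu\in I},(\mu^\ast,z^\ast)\big)$ be a local Lagrangian intersection problem in $T^\ast N$. Let $m=\dim\big(T_{z^\ast}\Lambda_{\mu^\ast}\cap T_{z^\ast}\Gamma_{\mu^\ast}\big)$. Then only those singularities can occur at $(\mu^\ast,z^\ast)$ which can be obtained in the gradient-zero-problem $\nabla g_\mu=0$ for a family of smooth maps $g_\mu\colon\mathbb R^k\to\mathbb R$ with $k\le m$.
   Context: Local Lagrangian intersection problem: $T^\ast N$ carries its canonical symplectic form; $\mu^\ast\in\mathbb R^p$, $I$ is an open neighbourhood of $\mu^\ast$; $(\Lambda_\mu)_{\mu\in I}$, $(\Gamma_\mu)_{\mu\in I}$ are smooth families of Lagrangian submanifolds of $T^\ast N$; and $z^\ast\in\Lambda_{\mu^\ast}\cap\Gamma_{\mu^\ast}$. Singularity of the problem at $(\mu^\ast,z^\ast)$: after shrinking $I$ and the submanifolds around $(\mu^\ast,z^\ast)$ and applying a local symplectomorphism of $T^\ast N$ fixing $z^\ast$, both families become images of exact 1-forms, $\Gamma_\mu=\mathrm df_\mu(U)$ and $\Lambda_\mu=\mathrm dg_\mu(U)$, on an open neighbourhood $U$ of $\pi(z^\ast)$ (such a symplectomorphism always exists). Setting $h_\mu=f_\mu-g_\mu$, points of $\Lambda_\mu\cap\Gamma_\mu$ correspond to critical points of $h_\mu$. The singularity occurring at $(\mu^\ast,z^\ast)$ is the germ of $h_{\mu^\ast}$ at the critical point $\pi(z^\ast)$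 together with its unfolding $(h_\mu)_\mu$. Singularities are considered up to stable equivalence: the singularity can be obtained in a gradient-zero-problem with $k$ variables if, after a smooth $\mu$-dependent family of local diffeomorphisms of the domain and up to adding a function of $\mu$ only, $h_\mu(t_1,\dots,t_{d})=g_\mu(t_1,\dots,t_k)+Q(t_{k+1},\dots,t_{d})$ near $(\mu^\ast,\pi(z^\ast))$, with $d=\dim N$, a smooth family $(g_\mu)$ and a nondegenerate quadratic form $Q$. For $k=0$ this means that there is no singularity (nondegenerate critical point). *)

theory Defs
  imports "HOL-Analysis.Analysis"
begin

section \<open>Smooth maps between open subsets of Euclidean spaces\<close>

text \<open>These notions are only meant for open sets.\<close>

primrec times_differentiable_on ::
    "nat \<Rightarrow> ('a::euclidean_space \<Rightarrow> 'b::euclidean_space) \<Rightarrow> 'a set \<Rightarrow> bool" where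
  "times_differentiable_on 0 f S \<longleftrightarrow> continuous_on S f"
| "times_differentiable_on (Suc r) f S \<longleftrightarrow>
     (\<forall>x\<in>S. f differentiable (at x)) \<and>
     (\<forall>v. times_differentiable_on r (\<lambda>x. frechet_derivative f (at x) v) S)"

definition smooth_on :: "('a::euclidean_space \<Rightarrow> 'b::euclidean_space) \<Rightarrow> 'a set \<Rightarrow> bool" where
  "smooth_on f S \<longleftrightarrow> (\<forall>r. times_differentiable_on r f S)"


section \<open>Smooth manifolds\<close>

text \<open>A manifold is given by its atlas; the underlying set is the union of the chart domains, and
  it carries the topology induced by the charts.  The dimension is that of the model space.\<close>

type_synonym ('m, 'a) chart = "'m set \<times> ('m \<Rightarrow> 'a)"
type_synonym ('m, 'a) atlas = "('m, 'a) chart set"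

definition chart_inv :: "('m, 'a) chart \<Rightarrow> 'a \<Rightarrow> 'm" where
  "chart_inv c = inv_into (fst c) (snd c)"

definition carrier :: "('m, 'a) atlas \<Rightarrow> 'm set" where
  "carrier A = \<Union> (fst ` A)"

definition manifold_topology :: "('m, 'a::euclidean_space) atlas \<Rightarrow> 'm topology" where
  "manifold_topology A = topology_generated_by {U \<inter> \<phi> -` X | U \<phi> X. (U, \<phi>) \<in> A \<and> open X}"

definition smooth_manifold :: "('m, 'a::euclidean_space) atlas \<Rightarrow> bool" where
  "smooth_manifold A \<longleftrightarrow>
     (\<forall>(U, \<phi>)\<in>A. inj_on \<phi> U \<and> open (\<phi> ` U)) \<and>
     (\<forall>(U, \<phi>)\<in>A. \<forall>(V, \<psi>)\<in>A. open (\<phi> ` (U \<inter> V)) \<and>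
        smooth_on (\<psi> \<circ> inv_into U \<phi>) (\<phi> ` (U \<inter> V))) \<and>
     Hausdorff_space (manifold_topology A) \<and> second_countable (manifold_topology A)"

definition euclidean_atlas :: "('a, 'a::euclidean_space) atlas" where
  "euclidean_atlas = {(UNIV, \<lambda>x. x)}"

definition product_atlas ::
    "('m, 'a) atlas \<Rightarrow> ('n, 'b) atlas \<Rightarrow> ('m \<times> 'n, 'a \<times> 'b) atlas" where
  "product_atlas A B = {(U \<times> V, map_prod \<phi> \<psi>) | U \<phi> V \<psi>. (U, \<phi>) \<in> A \<and> (V, \<psi>) \<in> B}"

text \<open>Requiring the sets \<open>S \<inter> U \<inter> f -` V\<close> to be open in the chart makes \<open>S\<close> open and
  \<open>f\<close> continuous on \<open>S\<close>.\<close>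

definition smooth_map ::
    "('m, 'a::euclidean_space) atlas \<Rightarrow> ('n, 'b::euclidean_space) atlas \<Rightarrow>
     'm set \<Rightarrow> ('m \<Rightarrow> 'n) \<Rightarrow> bool" where
  "smooth_map A B S f \<longleftrightarrow> S \<subseteq> carrier A \<and> f ` S \<subseteq> carrier B \<and>
     (\<forall>(U, \<phi>)\<in>A. \<forall>(V, \<psi>)\<in>B.
        open (\<phi> ` (S \<inter> U \<inter> f -` V)) \<and>
        smooth_on (\<psi> \<circ> f \<circ> inv_into U \<phi>) (\<phi> ` (S \<inter> U \<inter> f -` V)))"

definition diffeomorphism ::
    "('m, 'a::euclidean_space) atlas \<Rightarrow> ('n, 'b::euclidean_space) atlas \<Rightarrow>
     'm set \<Rightarrow> 'n set \<Rightarrow> ('m \<Rightarrow> 'n) \<Rightarrow> bool" where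
  "diffeomorphism A B S T f \<longleftrightarrow>
     bij_betw f S T \<and> smooth_map A B S f \<and> smooth_map B A T (inv_into S f)"


section \<open>Tangent vectors\<close>

text \<open>At every point \<open>x\<close> one chart \<open>chart_at A x\<close> is selected, and the tangent space at \<open>x\<close> is
  identified with the model space through this chart.  The selected chart may jump from point to
  point; smoothness is never expressed through it.\<close>

definition chart_at :: "('m, 'a) atlas \<Rightarrow> 'm \<Rightarrow> ('m, 'a) chart" where
  "chart_at A x = (SOME c. c \<in> A \<and> x \<in> fst c)"

definition tangent_map ::
    "('m, 'a::euclidean_space) atlas \<Rightarrow> ('n, 'b::euclidean_space) atlas \<Rightarrow>
     ('m \<Rightarrow> 'n) \<Rightarrow> 'm \<Rightarrow> 'a \<Rightarrow> 'b" where
  "tangent_map A B f x =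
     frechet_derivative (snd (chart_at B (f x)) \<circ> f \<circ> chart_inv (chart_at A x))
       (at (snd (chart_at A x) x))"

text \<open>Tangent space \<open>T\<^sub>z L\<close> of a submanifold \<open>L\<close>: velocities at \<open>z\<close> of smooth curves in \<open>L\<close>.\<close>

definition tangent_space ::
    "('m, 'a::euclidean_space) atlas \<Rightarrow> 'm set \<Rightarrow> 'm \<Rightarrow> 'a set" where
  "tangent_space A L z =
     {tangent_map euclidean_atlas A \<gamma> (0::real) 1 | \<gamma>.
        \<exists>\<epsilon>>0. smooth_map euclidean_atlas A {-\<epsilon><..<\<epsilon>} \<gamma> \<and> \<gamma> ` {-\<epsilon><..<\<epsilon>} \<subseteq> L \<and> \<gamma> 0 = z}"


section \<open>The cotangent bundle\<close>

text \<open>A covector at \<open>x\<close> is represented by the vector \<open>\<xi>\<close> such that it maps the tangent vector \<open>v\<close>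
  (both read in \<open>chart_at A x\<close>) to \<open>\<xi> \<bullet> v\<close>.  In the cotangent chart induced by a chart \<open>(U, \<phi>)\<close>,
  the momentum coordinates of \<open>(x, \<xi>)\<close> are the components of the covector in \<open>\<phi>\<close>, that is \<open>\<xi>\<close>
  pulled back along the change of coordinates from \<open>\<phi>\<close> to \<open>chart_at A x\<close>.\<close>

definition cotangent_atlas ::
    "('n, 'a::euclidean_space) atlas \<Rightarrow> ('n \<times> 'a, 'a \<times> 'a) atlas" where
  "cotangent_atlas A =
     {(U \<times> UNIV,
       \<lambda>(x, \<xi>). (\<phi> x, adjoint (frechet_derivative (snd (chart_at A x) \<circ> inv_into U \<phi>) (at (\<phi> x))) \<xi>))
      | U \<phi>. (U, \<phi>) \<in> A}"

text \<open>The canonical symplectic form \<open>\<Sum>\<^sub>i dq\<^sub>i \<and> dp\<^sub>i\<close>; it has this form in every cotangent chart, in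
  particular in the one through which the tangent space at a given point is identified.\<close>

definition canonical_form :: "'a::euclidean_space \<times> 'a \<Rightarrow> 'a \<times> 'a \<Rightarrow> real" where
  "canonical_form u v = fst u \<bullet> snd v - snd u \<bullet> fst v"

definition symplectomorphism ::
    "('n, 'a::euclidean_space) atlas \<Rightarrow> ('n \<times> 'a) set \<Rightarrow> ('n \<times> 'a) set \<Rightarrow>
     ('n \<times> 'a \<Rightarrow> 'n \<times> 'a) \<Rightarrow> bool" where
  "symplectomorphism A W W' \<Psi> \<longleftrightarrow>
     diffeomorphism (cotangent_atlas A) (cotangent_atlas A) W W' \<Psi> \<and>
     (\<forall>z\<in>W. \<forall>u v.
        canonical_form (tangent_map (cotangent_atlas A) (cotangent_atlas A) \<Psi> z u)
                       (tangent_map (cotangent_atlas A) (cotangent_atlas A) \<Psi> z v)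
        = canonical_form u v)"

definition exact_one_form ::
    "('n, 'a::euclidean_space) atlas \<Rightarrow> ('n \<Rightarrow> real) \<Rightarrow> 'n \<Rightarrow> 'n \<times> 'a" where
  "exact_one_form A f x = (x, \<Sum>b\<in>Basis. tangent_map A euclidean_atlas f x b *\<^sub>R b)"


section \<open>Local Lagrangian intersection problems\<close>

definition smooth_family_of_functions ::
    "('n, 'a::euclidean_space) atlas \<Rightarrow> 'p::euclidean_space set \<Rightarrow> 'n set \<Rightarrow>
     ('p \<Rightarrow> 'n \<Rightarrow> real) \<Rightarrow> bool" where
  "smooth_family_of_functions A J U f \<longleftrightarrow>
     smooth_map (product_atlas euclidean_atlas A) euclidean_atlas (J \<times> U) (\<lambda>(\<mu>, x). f \<mu> x)"

definition smooth_embedding ::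
    "('m, 'b::euclidean_space) atlas \<Rightarrow> 'a::euclidean_space set \<Rightarrow> ('a \<Rightarrow> 'm) \<Rightarrow> bool" where
  "smooth_embedding B V e \<longleftrightarrow>
     smooth_map euclidean_atlas B V e \<and>
     (\<forall>t\<in>V. inj (tangent_map euclidean_atlas B e t)) \<and>
     embedding_map (top_of_set V) (manifold_topology B) e"

text \<open>Embedded submanifolds of half the dimension, locally parametrised by embeddings that depend
  smoothly on \<open>\<mu>\<close>, and on whose tangent spaces the symplectic form vanishes.\<close>

definition smooth_family_of_Lagrangian_submanifolds ::
    "('n, 'a::euclidean_space) atlas \<Rightarrow> 'p::euclidean_space set \<Rightarrow> ('p \<Rightarrow> ('n \<times> 'a) set) \<Rightarrow> bool" where
  "smooth_family_of_Lagrangian_submanifolds A I \<Lambda> \<longleftrightarrow>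
     (\<forall>\<mu>\<in>I. \<Lambda> \<mu> \<subseteq> carrier (cotangent_atlas A)) \<and>
     (\<forall>\<mu>\<in>I. \<forall>z\<in>\<Lambda> \<mu>. \<exists>J W V (e :: 'p \<Rightarrow> 'a \<Rightarrow> 'n \<times> 'a).
        open J \<and> \<mu> \<in> J \<and> J \<subseteq> I \<and> open V \<and>
        openin (manifold_topology (cotangent_atlas A)) W \<and> z \<in> W \<and>
        smooth_map euclidean_atlas (cotangent_atlas A) (J \<times> V) (\<lambda>(\<nu>, t). e \<nu> t) \<and>
        (\<forall>\<nu>\<in>J. smooth_embedding (cotangent_atlas A) V (e \<nu>) \<and> e \<nu> ` V = \<Lambda> \<nu> \<inter> W)) \<and>
     (\<forall>\<mu>\<in>I. \<forall>z\<in>\<Lambda> \<mu>.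
        \<forall>u \<in> tangent_space (cotangent_atlas A) (\<Lambda> \<mu>) z.
        \<forall>v \<in> tangent_space (cotangent_atlas A) (\<Lambda> \<mu>) z. canonical_form u v = 0)"

definition local_Lagrangian_intersection_problem ::
    "('n, 'a::euclidean_space) atlas \<Rightarrow> 'p::euclidean_space set \<Rightarrow>
     ('p \<Rightarrow> ('n \<times> 'a) set) \<Rightarrow> ('p \<Rightarrow> ('n \<times> 'a) set) \<Rightarrow> 'p \<Rightarrow> 'n \<times> 'a \<Rightarrow> bool" where
  "local_Lagrangian_intersection_problem A I \<Lambda> \<Gamma> \<mu>s zs \<longleftrightarrow>
     open I \<and> \<mu>s \<in> I \<and>
     smooth_family_of_Lagrangian_submanifolds A I \<Lambda> \<and>
     smooth_family_of_Lagrangian_submanifolds A I \<Gamma> \<and>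
     zs \<in> \<Lambda> \<mu>s \<inter> \<Gamma> \<mu>s"


section \<open>Singularities\<close>

text \<open>\<open>h\<close>, defined on \<open>J \<times> U\<close>, represents the singularity occurring at \<open>(\<mu>s, zs)\<close>: after shrinking
  the parameter set to \<open>J\<close> and the submanifolds to their parts in the neighbourhood \<open>W\<close> of \<open>zs\<close>, a
  symplectomorphism fixing \<open>zs\<close> turns both families into images of exact one-forms \<open>d f\<^sub>\<mu>\<close> and
  \<open>d g\<^sub>\<mu>\<close>, and \<open>h\<^sub>\<mu> = f\<^sub>\<mu> - g\<^sub>\<mu>\<close>.\<close>

definition singularity_occurring_at ::
    "('n, 'a::euclidean_space) atlas \<Rightarrow> 'p::euclidean_space set \<Rightarrow>
     ('p \<Rightarrow> ('n \<times> 'a) set) \<Rightarrow> ('p \<Rightarrow> ('n \<times> 'a) set) \<Rightarrow> 'p \<Rightarrow> 'n \<times> 'a \<Rightarrow>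
     'p set \<Rightarrow> 'n set \<Rightarrow> ('p \<Rightarrow> 'n \<Rightarrow> real) \<Rightarrow> bool" where
  "singularity_occurring_at A I \<Lambda> \<Gamma> \<mu>s zs J U h \<longleftrightarrow>
     open J \<and> \<mu>s \<in> J \<and> J \<subseteq> I \<and>
     openin (manifold_topology A) U \<and> fst zs \<in> U \<and>
     (\<exists>W W' \<Psi> f g.
        symplectomorphism A W W' \<Psi> \<and> zs \<in> W \<and> \<Psi> zs = zs \<and>
        smooth_family_of_functions A J U f \<and> smooth_family_of_functions A J U g \<and>
        (\<forall>\<mu>\<in>J. \<Psi> ` (\<Gamma> \<mu> \<inter> W) = exact_one_form A (f \<mu>) ` U) \<and>
        (\<forall>\<mu>\<in>J. \<Psi> ` (\<Lambda> \<mu> \<inter> W) = exact_one_form A (g \<mu>) ` U) \<and>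
        (\<forall>\<mu>\<in>J. \<forall>x\<in>U. h \<mu> x = f \<mu> x - g \<mu> x))"

text \<open>A nondegenerate quadratic form in the variables \<open>t\<^sub>i\<close> with \<open>i \<in> M\<close>.\<close>

definition nondegenerate_quadratic_form :: "'d::finite set \<Rightarrow> (real^'d \<Rightarrow> real) \<Rightarrow> bool" where
  "nondegenerate_quadratic_form M Q \<longleftrightarrow>
     (\<exists>B :: 'd \<Rightarrow> 'd \<Rightarrow> real.
        (\<forall>i\<in>M. \<forall>j\<in>M. B i j = B j i) \<and>
        (\<forall>t. Q t = (\<Sum>i\<in>M. \<Sum>j\<in>M. B i j * t $ i * t $ j)) \<and>
        (\<forall>t::real^'d. (\<forall>i\<in>M. (\<Sum>j\<in>M. B i j * t $ j) = 0) \<longrightarrow> (\<forall>j\<in>M. t $ j = 0)))"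

text \<open>Stable equivalence of the singularity of \<open>h\<close> (defined on \<open>J \<times> U\<close>) at \<open>(\<mu>s, xs)\<close> to one of a
  gradient-zero-problem with \<open>k\<close> variables.  The coordinates of \<open>\<real>\<^sup>d\<close> are indexed by a type
  without distinguished order, so \<open>t\<^sub>1, \<dots>, t\<^sub>k\<close> are the coordinates in a set \<open>K\<close> of \<open>k\<close>
  indices; a map \<open>\<real>\<^sup>k \<rightarrow> \<real>\<close> is a map on \<open>\<real>\<^sup>d\<close> depending on these coordinates only.\<close>

definition obtainable_in_gradient_zero_problem ::
    "nat \<Rightarrow> ('n, real^'d) atlas \<Rightarrow> 'p::euclidean_space \<Rightarrow> 'n \<Rightarrow>
     'p set \<Rightarrow> 'n set \<Rightarrow> ('p \<Rightarrow> 'n \<Rightarrow> real) \<Rightarrow> bool" where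
  "obtainable_in_gradient_zero_problem k A \<mu>s xs J U h \<longleftrightarrow>
     (\<exists>J' (T :: (real^'d) set) \<theta> K g Q c.
        open J' \<and> \<mu>s \<in> J' \<and> J' \<subseteq> J \<and> open T \<and> 0 \<in> T \<and>
        smooth_map euclidean_atlas A (J' \<times> T) (\<lambda>(\<mu>, t). \<theta> \<mu> t) \<and>
        (\<forall>\<mu>\<in>J'. diffeomorphism euclidean_atlas A T (\<theta> \<mu> ` T) (\<theta> \<mu>) \<and> \<theta> \<mu> ` T \<subseteq> U) \<and>
        \<theta> \<mu>s 0 = xs \<and>
        card K = k \<and>
        smooth_on (\<lambda>(\<mu>, t). g \<mu> t) (J' \<times> UNIV) \<and>
        (\<forall>\<mu>\<in>J'. \<forall>s t. (\<forall>i\<in>K. s $ i = t $ i) \<longrightarrow> g \<mu> s = g \<mu> t) \<and>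
        nondegenerate_quadratic_form (- K) Q \<and>
        (\<forall>\<mu>\<in>J'. \<forall>t\<in>T. h \<mu> (\<theta> \<mu> t) = g \<mu> t + Q t + c \<mu>))"

end

theory Submission
  imports Defs
begin

text \<open>
  At \<open>zs\<close> the two one-forms \<open>df\<close> and \<open>dg\<close> agree, so \<open>h\<close> is critical there. If \<open>v\<close> lies in the
  kernel of the Hessian of \<open>h\<close>, the curves \<open>s \<mapsto> df(x + s v)\<close> and \<open>s \<mapsto> dg(x + s v)\<close> have the same
  velocity at \<open>s = 0\<close>; pulled back by the symplectomorphism, this velocity is tangent to both
  submanifolds. Hence the corank of the Hessian is at most \<open>m\<close>, and the splitting lemma with
  parameters separates off a nondegenerate quadratic form in all but corank many variables. The
  splitting is done one variable at a time: as long as the Hessian in the remaining variables does not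
  vanish, a shear produces a coordinate with nonzero second derivative, which a change of this single
  coordinate turns into a separate square. Only the inverse function theorem for changes of one
  coordinate is needed, where the derivative of the inverse is explicit.
\<close>

section \<open>Calculus of smooth maps\<close>

text \<open>Parameter and variable are joined in one space \<open>'p \<times> 'a\<close>, and all
  changes of coordinates fix the \<open>'p\<close>-coordinates near the base point. A statement
  about a family thus becomes a statement about one germ at \<open>(\<mu>s, 0)\<close>, and no
  neighbourhood has to be chosen uniformly in \<open>\<mu>\<close>. The price is that this germ is
  critical in the variable directions only. Its Hessian in these directions still transforms like a
  bilinear form, because the changes of coordinates have no second derivative in the parameter
  directions; so a kernel computed after all changes can be carried back by their derivative.

  A second obstacle is that the reduced function has to be smooth on a whole Euclidean space,
  whereas splitting only yields germs. Precomposing with a diffeomorphism that squeezes the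
  remaining variables into a small ball overcomes it. The separate squares survive, since their
  coordinates are left alone.\<close>

lemma has_derivative_cong_open:
  assumes "open S" "x \<in> S" "\<And>y. y \<in> S \<Longrightarrow> f y = g y"
  shows "(f has_derivative f') (at x) \<longleftrightarrow> (g has_derivative f') (at x)"
  using assms has_derivative_transform_within_open[of f f' x UNIV S g]
    has_derivative_transform_within_open[of g f' x UNIV S f] by auto

lemma frechet_derivative_cong_open:
  assumes "open S" "x \<in> S" "\<And>y. y \<in> S \<Longrightarrow> f y = g y"
  shows "frechet_derivative f (at x) = frechet_derivative g (at x)"
  unfolding frechet_derivative_def using has_derivative_cong_open[OF assms] by simp

lemma frechet_derivative_eqI:
  "(f has_derivative f') (at x) \<Longrightarrow> frechet_derivative f (at x) = f'"
  using frechet_derivative_at by metis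

lemma times_differentiable_on_cong:
  assumes "open S" "\<And>y. y \<in> S \<Longrightarrow> f y = g y" "times_differentiable_on r f S"
  shows "times_differentiable_on r g S"
  using assms(2,3)
proof (induction r arbitrary: f g)
  case 0
  then show ?case by (auto intro: continuous_on_eq)
next
  case (Suc r)
  have "times_differentiable_on r (\<lambda>x. frechet_derivative g (at x) v) S" for v
  proof (rule Suc.IH)
    show "frechet_derivative f (at x) v = frechet_derivative g (at x) v" if "x \<in> S" for x
      using frechet_derivative_cong_open[OF assms(1) that Suc.prems(1)] by simp
  qed (use Suc.prems(2) in simp)
  moreover have "g differentiable (at x)" if "x \<in> S" for x
  proof -
    obtain D where "(f has_derivative D) (at x)"
      using Suc.prems(2) \<open>x \<in> S\<close> by (auto simp: differentiable_def)
    then have "(g has_derivative D) (at x)"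
      using has_derivative_transform_within_open[OF _ assms(1) that Suc.prems(1)] by auto
    then show ?thesis by (auto simp: differentiable_def)
  qed
  ultimately show ?case by simp
qed

lemma times_differentiable_on_subset:
  "times_differentiable_on r f S \<Longrightarrow> T \<subseteq> S \<Longrightarrow> times_differentiable_on r f T"
  by (induction r arbitrary: f) (auto intro: continuous_on_subset)

lemma times_differentiable_on_lessD:
  "times_differentiable_on (Suc r) f S \<Longrightarrow> times_differentiable_on r f S"
proof (induction r arbitrary: f)
  case 0
  then show ?case
    by (simp add: continuous_at_imp_continuous_on differentiable_imp_continuous_within)
next
  case (Suc r)
  have "times_differentiable_on r (\<lambda>x. frechet_derivative f (at x) v) S" for v
    by (rule Suc.IH) (use Suc.prems in simp)
  then show ?case using Suc.prems by simp
qed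

lemma times_differentiable_on_imp_continuous_on:
  "times_differentiable_on r f S \<Longrightarrow> continuous_on S f"
proof (induction r)
  case (Suc r)
  show ?case by (rule Suc.IH[OF times_differentiable_on_lessD[OF Suc.prems]])
qed simp

text \<open>On an open set the derivative is unique, so any explicit formula may stand in for
  \<open>frechet_derivative\<close>. The rules below are inductions on the order in which this lemma
  supplies the successor step.\<close>

lemma times_differentiable_on_SucI:
  assumes "open S" "\<And>x. x \<in> S \<Longrightarrow> (f has_derivative f' x) (at x)"
    and "\<And>v. times_differentiable_on r (\<lambda>x. f' x v) S"
  shows "times_differentiable_on (Suc r) f S"
proof -
  have "f' x v = frechet_derivative f (at x) v" if "x \<in> S" for x v
    using frechet_derivative_eqI[OF assms(2)[OF that]] by simp
  then have "times_differentiable_on r (\<lambda>x. frechet_derivative f (at x) v) S" for v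
    by (intro times_differentiable_on_cong[OF assms(1) _ assms(3)[of v]]) auto
  then show ?thesis using assms(2) by (auto simp: differentiable_def)
qed

lemma times_differentiable_on_SucD:
  assumes "times_differentiable_on (Suc r) f S" "x \<in> S"
  shows "(f has_derivative frechet_derivative f (at x)) (at x)"
  using assms frechet_derivative_works by auto

lemma times_differentiable_on_SucD2:
  "times_differentiable_on (Suc r) f S \<Longrightarrow> times_differentiable_on r (\<lambda>x. frechet_derivative f (at x) v) S"
  by simp

section \<open>Closure rules for differentiability of finite order\<close>

lemma times_differentiable_on_const: "times_differentiable_on r (\<lambda>x. c) S"
  by (induction r arbitrary: c) auto

lemma times_differentiable_on_linear:
  assumes "open S" "bounded_linear f"
  shows "times_differentiable_on r f S"
proof (cases r)
  case 0
  then show ?thesis using assms by (simp add: linear_continuous_on)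
next
  case (Suc n)
  then show ?thesis
    using times_differentiable_on_SucI[OF assms(1), of f "\<lambda>_. f" n]
      bounded_linear_imp_has_derivative[OF assms(2)] times_differentiable_on_const by blast
qed

lemma times_differentiable_on_add:
  assumes "open S" "times_differentiable_on r f S" "times_differentiable_on r g S"
  shows "times_differentiable_on r (\<lambda>x. f x + g x) S"
  using assms(2,3)
proof (induction r arbitrary: f g)
  case 0
  then show ?case by (simp add: continuous_on_add)
next
  case (Suc r)
  show ?case
  proof (rule times_differentiable_on_SucI[OF assms(1)])
    show "((\<lambda>x. f x + g x) has_derivative
        (\<lambda>v. frechet_derivative f (at x) v + frechet_derivative g (at x) v)) (at x)"
      if "x \<in> S" for x
      using Suc.prems that by (intro has_derivative_add times_differentiable_on_SucD)
  qed (intro Suc.IH times_differentiable_on_SucD2 Suc.prems)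
qed

lemma times_differentiable_on_bilinear:
  fixes prod :: "'b::euclidean_space \<Rightarrow> 'c::euclidean_space \<Rightarrow> 'd::euclidean_space"
    and f :: "'a::euclidean_space \<Rightarrow> 'b"
  assumes "bounded_bilinear prod" "open S"
    and "times_differentiable_on r f S" "times_differentiable_on r g S"
  shows "times_differentiable_on r (\<lambda>x. prod (f x) (g x)) S"
  using assms(3,4)
proof (induction r arbitrary: f g)
  case 0
  then show ?case using bounded_bilinear.continuous_on[OF assms(1)] by auto
next
  case (Suc r)
  show ?case
  proof (rule times_differentiable_on_SucI[OF assms(2)])
    show "((\<lambda>x. prod (f x) (g x)) has_derivative
       (\<lambda>v. prod (f x) (frechet_derivative g (at x) v) + prod (frechet_derivative f (at x) v) (g x))) (at x)"
      if "x \<in> S" for x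
      using Suc.prems that
      by (intro bounded_bilinear.FDERIV[OF assms(1)] times_differentiable_on_SucD)
    show "times_differentiable_on r
       (\<lambda>x. prod (f x) (frechet_derivative g (at x) v) + prod (frechet_derivative f (at x) v) (g x)) S" for v
      by (intro times_differentiable_on_add[OF assms(2)] Suc.IH
          times_differentiable_on_SucD2[OF Suc.prems(1)] times_differentiable_on_SucD2[OF Suc.prems(2)]
          times_differentiable_on_lessD[OF Suc.prems(1)] times_differentiable_on_lessD[OF Suc.prems(2)])
  qed
qed

lemma times_differentiable_on_sum:
  assumes "open S" "\<And>i. i \<in> B \<Longrightarrow> times_differentiable_on r (f i) S"
  shows "times_differentiable_on r (\<lambda>x. \<Sum>i\<in>B. f i x) S"
  using assms(2)
proof (induction B rule: infinite_finite_induct)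
  case (insert b B)
  then show ?case
    using times_differentiable_on_add[OF assms(1), of r "f b" "\<lambda>x. \<Sum>i\<in>B. f i x"] by simp
qed (simp_all add: times_differentiable_on_const)

lemma times_differentiable_on_linear_compose:
  assumes "bounded_linear L" "open S" "times_differentiable_on r f S"
  shows "times_differentiable_on r (\<lambda>x. L (f x)) S"
  using assms(3)
proof (induction r arbitrary: f)
  case 0
  then show ?case using assms(1) by (auto intro: bounded_linear.continuous_on)
next
  case (Suc r)
  show ?case
  proof (rule times_differentiable_on_SucI[OF assms(2)])
    show "((\<lambda>x. L (f x)) has_derivative (\<lambda>v. L (frechet_derivative f (at x) v))) (at x)" if "x \<in> S" for x
      using Suc.prems that by (intro bounded_linear.has_derivative[OF assms(1)] times_differentiable_on_SucD)
  qed (intro Suc.IH times_differentiable_on_SucD2 Suc.prems)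
qed

text \<open>The chain rule evaluates the derivative of \<open>g\<close> in a direction that depends
  on \<open>x\<close>, to which the induction hypothesis does not apply. Expanding this direction in
  the basis leaves derivatives of \<open>g\<close> in constant directions, composed with
  \<open>f\<close>, times scalar components of the derivative of \<open>f\<close>.\<close>

lemma times_differentiable_on_compose:
  assumes "open S" "open T" "f ` S \<subseteq> T"
    and "times_differentiable_on r f S" "times_differentiable_on r g T"
  shows "times_differentiable_on r (\<lambda>x. g (f x)) S"
  using assms(4,5)
proof (induction r arbitrary: g)
  case 0
  then show ?case using assms(3) by (auto intro: continuous_on_compose2)
next
  case (Suc r)
  let ?g' = "\<lambda>x. frechet_derivative g (at (f x))"
  let ?f' = "\<lambda>x. frechet_derivative f (at x)"
  show ?case
  proof (rule times_differentiable_on_SucI[OF assms(1)])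
    fix x assume x: "x \<in> S"
    have g': "(g has_derivative ?g' x) (at (f x))"
      using times_differentiable_on_SucD[OF Suc.prems(2)] assms(3) x by blast
    have *: "((\<lambda>x. g (f x)) has_derivative (\<lambda>v. ?g' x (?f' x v))) (at x)"
      using has_derivative_compose[OF times_differentiable_on_SucD[OF Suc.prems(1) x] g'] .
    have eq: "?g' x w = (\<Sum>b\<in>Basis. (w \<bullet> b) *\<^sub>R ?g' x b)" for w
    proof -
      have "?g' x (\<Sum>b\<in>Basis. (w \<bullet> b) *\<^sub>R b) = (\<Sum>b\<in>Basis. (w \<bullet> b) *\<^sub>R ?g' x b)"
        by (simp only: linear_sum[OF has_derivative_linear[OF g']] linear_cmul[OF has_derivative_linear[OF g']])
      then show ?thesis by (simp only: euclidean_representation)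
    qed
    show "((\<lambda>x. g (f x)) has_derivative
        (\<lambda>v. \<Sum>b\<in>Basis. (?f' x v \<bullet> b) *\<^sub>R ?g' x b)) (at x)"
      by (rule has_derivative_eq_rhs[OF * ext[OF eq]])
  next
    fix v
    show "times_differentiable_on r (\<lambda>x. \<Sum>b\<in>Basis. (?f' x v \<bullet> b) *\<^sub>R ?g' x b) S"
    proof (intro times_differentiable_on_sum times_differentiable_on_bilinear[OF bounded_bilinear_scaleR] assms(1))
      fix b :: 'b
      show "times_differentiable_on r (\<lambda>x. ?f' x v \<bullet> b) S"
        by (intro times_differentiable_on_linear_compose[OF bounded_linear_inner_left assms(1)]
            times_differentiable_on_SucD2 Suc.prems)
      show "times_differentiable_on r (\<lambda>x. ?g' x b) S"
        by (rule Suc.IH[OF times_differentiable_on_lessD[OF Suc.prems(1)]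
            times_differentiable_on_SucD2[OF Suc.prems(2)]])
    qed
  qed
qed

text \<open>The derivative is a polynomial in the function itself, so the induction hypothesis
  already controls it. The square root below works in the same way, through its reciprocal.\<close>

lemma times_differentiable_on_inverse: "times_differentiable_on r (inverse :: real \<Rightarrow> real) (- {0})"
proof (induction r)
  case 0
  then show ?case by (auto intro!: continuous_intros)
next
  case (Suc r)
  show ?case
  proof (rule times_differentiable_on_SucI)
    show "(inverse has_derivative (\<lambda>v. - (inverse x * v * inverse x))) (at x)" if "x \<in> - {0}" for x :: real
      using has_derivative_inverse'[of x] that by auto
    show "times_differentiable_on r (\<lambda>x::real. - (inverse x * v * inverse x)) (- {0})" for v
    proof -
      have "times_differentiable_on r (\<lambda>x::real. inverse x * inverse x) (- {0})"
        by (rule times_differentiable_on_bilinear[OF bounded_bilinear_mult _ Suc Suc]) auto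
      from times_differentiable_on_linear_compose[OF bounded_linear_mult_right[of "- v"] _ this]
      show ?thesis
        by (rule times_differentiable_on_cong[rotated 2]) (auto simp: algebra_simps)
    qed
  qed auto
qed

lemma times_differentiable_on_sqrt: "times_differentiable_on r sqrt {0<..}"
proof (induction r)
  case 0
  then show ?case by (auto intro!: continuous_intros)
next
  case (Suc r)
  show ?case
  proof (rule times_differentiable_on_SucI)
    show "(sqrt has_derivative (\<lambda>v. inverse (sqrt x) / 2 * v)) (at x)" if "x \<in> {0<..}" for x
      by (rule DERIV_real_sqrt[unfolded has_field_derivative_def]) (use that in simp)
    have *: "times_differentiable_on r (\<lambda>x. inverse (sqrt x)) {0<..}"
      by (rule times_differentiable_on_compose[OF _ _ _ Suc times_differentiable_on_inverse]) auto
    show "times_differentiable_on r (\<lambda>x::real. inverse (sqrt x) / 2 * v) {0<..}" for v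
      using times_differentiable_on_linear_compose[OF bounded_linear_mult_left[of "v / 2"] _ *] by simp
  qed auto
qed

text \<open>Differentiation under the integral sign, iterated: the derivative in direction
  \<open>v\<close> is the integral of the derivative of the integrand in direction
  \<open>(v, 0)\<close>, which is again an integral of the same kind. The open set \<open>O'\<close>
  around \<open>S \<times> {0..1}\<close> is there because differentiability of higher order is only
  meant for open sets.\<close>

lemma times_differentiable_on_integral:
  fixes k :: "'a::euclidean_space \<Rightarrow> real \<Rightarrow> 'b::euclidean_space"
  assumes "open S" "convex S" "open O'" "S \<times> {0..1} \<subseteq> O'"
    and "times_differentiable_on r (\<lambda>(z, s). k z s) O'"
  shows "times_differentiable_on r (\<lambda>z. integral {0..1} (k z)) S"
  using assms(5)
proof (induction r arbitrary: k)
  case 0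
  then have "continuous_on (S \<times> cbox 0 1) (\<lambda>(z, s). k z s)"
    using assms(4) continuous_on_subset by (metis box_real(2) times_differentiable_on.simps(1))
  then show ?case using integral_continuous_on_param[of S 0 1 k] by simp
next
  case (Suc r)
  let ?k' = "\<lambda>z s v. frechet_derivative (\<lambda>(z, s). k z s) (at (z, s)) (v, 0)"
  have kder: "(k' has_derivative (?k' z s)) (at z)" if "z \<in> S" "s \<in> {0..1}" "k' = (\<lambda>z. k z s)" for z s k'
  proof -
    have "(z, s) \<in> O'" using that assms(4) by auto
    from has_derivative_compose[OF has_derivative_Pair[OF has_derivative_ident has_derivative_const]
        times_differentiable_on_SucD[OF Suc.prems this, THEN has_derivative_at_withinI]]
    show ?thesis using that by simp
  qed
  have bl: "bounded_linear (?k' z s)" if "z \<in> S" "s \<in> {0..1}" for z s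
    using has_derivative_bounded_linear[OF kder[OF that refl]] .
  have td: "times_differentiable_on r (\<lambda>(z, s). ?k' z s v) O'" for v
    using Suc.prems by (auto simp: case_prod_unfold)
  have contk: "continuous_on (S \<times> cbox 0 1) (\<lambda>(z, s). k z s)"
    by (rule continuous_on_subset[OF times_differentiable_on_imp_continuous_on[OF Suc.prems]])
      (use assms(4) in simp)
  have ki: "k z integrable_on cbox 0 1" if "z \<in> S" for z
  proof (rule integrable_continuous)
    show "continuous_on (cbox 0 1) (k z)"
      using continuous_on_compose2[OF contk, of "cbox 0 1" "\<lambda>s. (z, s)"] that
      by (auto simp: image_subset_iff continuous_on_Pair)
  qed
  have contk': "continuous_on (S \<times> cbox 0 1) (\<lambda>(z, s). ?k' z s v)" for v
    by (rule continuous_on_subset[OF times_differentiable_on_imp_continuous_on[OF td]])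
      (use assms(4) in simp)
  \<comment> \<open>The Leibniz rule asks for a derivative that is continuous as a bounded operator;
    in finite dimension it suffices to test this on each vector.\<close>
  have contB: "continuous_on (S \<times> cbox 0 1) (\<lambda>(z, s). Blinfun (?k' z s))"
  proof (rule continuous_on_blinfun_componentwise)
    fix v
    show "continuous_on (S \<times> cbox 0 1) (\<lambda>p. blinfun_apply (case p of (z, s) \<Rightarrow> Blinfun (?k' z s)) v)"
      by (rule continuous_on_eq[OF contk'[of v]]) (auto simp: bounded_linear_Blinfun_apply[OF bl])
  qed
  have intB: "(\<lambda>s. Blinfun (?k' z s)) integrable_on cbox 0 1" if "z \<in> S" for z
    using continuous_on_compose2[OF contB, of "cbox 0 1" "\<lambda>s. (z, s)"] that
    by (intro integrable_continuous) (auto simp: image_subset_iff continuous_on_Pair)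
  show ?case
  proof (rule times_differentiable_on_SucI[OF assms(1)])
    fix z assume z: "z \<in> S"
    have "((\<lambda>z. k z s) has_derivative blinfun_apply (Blinfun (?k' z s))) (at z within S)"
      if "z \<in> S" "s \<in> cbox 0 1" for z s
      using has_derivative_at_withinI[OF kder[of z s]] that bounded_linear_Blinfun_apply[OF bl[of z s]]
      by simp
    then have *: "((\<lambda>z. integral (cbox 0 1) (k z)) has_derivative
       integral (cbox 0 1) (\<lambda>s. Blinfun (?k' z s))) (at z within S)"
      by (rule leibniz_rule[OF _ ki contB z assms(2)])
    have "blinfun_apply (integral (cbox 0 1) (\<lambda>s. Blinfun (?k' z s))) v =
        integral (cbox 0 1) (\<lambda>s. ?k' z s v)" for v
    proof -
      have "blinfun_apply (integral (cbox 0 1) (\<lambda>s. Blinfun (?k' z s))) v =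
        integral (cbox 0 1) (\<lambda>s. blinfun_apply (Blinfun (?k' z s)) v)"
        using integral_linear[OF intB[OF z] blinfun.bounded_linear_left[of v]]
        by (simp add: o_def)
      also have "\<dots> = integral (cbox 0 1) (\<lambda>s. ?k' z s v)"
        by (rule integral_cong) (simp add: bounded_linear_Blinfun_apply[OF bl[OF z]])
      finally show ?thesis .
    qed
    from has_derivative_eq_rhs[OF * ext[OF this]]
    show "((\<lambda>z. integral {0..1} (k z)) has_derivative
       (\<lambda>v. integral {0..1} (\<lambda>s. ?k' z s v))) (at z)"
      by (simp add: at_within_open[OF z assms(1)])
  next
    fix v
    show "times_differentiable_on r (\<lambda>z. integral {0..1} (\<lambda>s. ?k' z s v)) S"
      by (rule Suc.IH[OF td])
  qed
qed

lemma times_differentiable_on_local: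
  assumes "\<And>x. x \<in> S \<Longrightarrow> \<exists>T. open T \<and> x \<in> T \<and> times_differentiable_on r f T"
  shows "times_differentiable_on r f S"
  using assms
proof (induction r arbitrary: f)
  case 0
  have "isCont f x" if "x \<in> S" for x
    using 0[OF that] continuous_on_eq_continuous_at by auto
  then show ?case by (simp add: continuous_at_imp_continuous_on)
next
  case (Suc r)
  have "f differentiable (at x)" if "x \<in> S" for x
    using Suc.prems[OF that] by auto
  moreover have "times_differentiable_on r (\<lambda>x. frechet_derivative f (at x) v) S" for v
  proof (rule Suc.IH)
    show "\<exists>T. open T \<and> x \<in> T \<and> times_differentiable_on r (\<lambda>x. frechet_derivative f (at x) v) T"
      if "x \<in> S" for x
      using Suc.prems[OF that] by auto
  qed
  ultimately show ?case by simp
qed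

section \<open>Smoothness as differentiability of every order\<close>

lemma smooth_onD: "smooth_on f S \<Longrightarrow> times_differentiable_on r f S"
  by (simp add: smooth_on_def)

lemma smooth_onI: "(\<And>r. times_differentiable_on r f S) \<Longrightarrow> smooth_on f S"
  by (simp add: smooth_on_def)

lemma smooth_on_local:
  assumes "\<And>x. x \<in> S \<Longrightarrow> \<exists>T. open T \<and> x \<in> T \<and> smooth_on f T"
  shows "smooth_on f S"
proof (rule smooth_onI, rule times_differentiable_on_local)
  show "\<exists>T. open T \<and> x \<in> T \<and> times_differentiable_on r f T" if "x \<in> S" for r x
    using assms[OF that] smooth_onD by blast
qed

lemma smooth_on_cong: "open S \<Longrightarrow> (\<And>y. y \<in> S \<Longrightarrow> f y = g y) \<Longrightarrow> smooth_on f S \<Longrightarrow> smooth_on g S"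
  by (meson smooth_on_def times_differentiable_on_cong)

lemma smooth_on_subset: "smooth_on f S \<Longrightarrow> T \<subseteq> S \<Longrightarrow> smooth_on f T"
  by (meson smooth_on_def times_differentiable_on_subset)

lemma smooth_on_const: "smooth_on (\<lambda>x. c) S"
  by (simp add: smooth_on_def times_differentiable_on_const)

lemma smooth_on_linear: "open S \<Longrightarrow> bounded_linear f \<Longrightarrow> smooth_on f S"
  by (simp add: smooth_on_def times_differentiable_on_linear)

lemma smooth_on_linear_compose:
  "bounded_linear L \<Longrightarrow> open S \<Longrightarrow> smooth_on f S \<Longrightarrow> smooth_on (\<lambda>x. L (f x)) S"
  by (simp add: smooth_on_def times_differentiable_on_linear_compose)

lemma smooth_on_add:
  "open S \<Longrightarrow> smooth_on f S \<Longrightarrow> smooth_on g S \<Longrightarrow> smooth_on (\<lambda>x. f x + g x) S"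
  by (simp add: smooth_on_def times_differentiable_on_add)

lemma smooth_on_diff:
  assumes "open S" "smooth_on f S" "smooth_on g S"
  shows "smooth_on (\<lambda>x. f x - g x) S"
  using smooth_on_add[OF assms(1,2) smooth_on_linear_compose[OF
        bounded_linear_minus[OF bounded_linear_ident] assms(1,3)]] by simp

lemma smooth_on_bilinear:
  fixes prod :: "'b::euclidean_space \<Rightarrow> 'c::euclidean_space \<Rightarrow> 'd::euclidean_space"
  shows "bounded_bilinear prod \<Longrightarrow> open S \<Longrightarrow> smooth_on f S \<Longrightarrow> smooth_on g S
    \<Longrightarrow> smooth_on (\<lambda>x. prod (f x) (g x)) S"
  by (simp add: smooth_on_def times_differentiable_on_bilinear)

lemma smooth_on_sum:
  "open S \<Longrightarrow> (\<And>i. i \<in> B \<Longrightarrow> smooth_on (f i) S) \<Longrightarrow> smooth_on (\<lambda>x. \<Sum>i\<in>B. f i x) S"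
  by (simp add: smooth_on_def times_differentiable_on_sum)

lemma smooth_on_Pair:
  assumes "open S" "smooth_on f S" "smooth_on g S"
  shows "smooth_on (\<lambda>x. (f x, g x)) S"
proof -
  have "smooth_on (\<lambda>x. (f x, 0) + (0, g x)) S"
    by (intro smooth_on_add smooth_on_linear_compose[of "\<lambda>y. (y, 0)"]
        smooth_on_linear_compose[of "\<lambda>y. (0, y)"] bounded_linear_Pair bounded_linear_ident
        bounded_linear_zero assms)
  then show ?thesis by simp
qed

lemma smooth_on_compose:
  "open S \<Longrightarrow> open T \<Longrightarrow> f ` S \<subseteq> T \<Longrightarrow> smooth_on f S \<Longrightarrow> smooth_on g T
    \<Longrightarrow> smooth_on (\<lambda>x. g (f x)) S"
  by (rule smooth_onI, rule times_differentiable_on_compose[of S T]) (auto dest: smooth_onD)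

lemma smooth_on_frechet_derivative:
  "smooth_on f S \<Longrightarrow> smooth_on (\<lambda>x. frechet_derivative f (at x) v) S"
  unfolding smooth_on_def using times_differentiable_on_SucD2 by blast

lemma smooth_on_has_derivative:
  "smooth_on f S \<Longrightarrow> x \<in> S \<Longrightarrow> (f has_derivative frechet_derivative f (at x)) (at x)"
  unfolding smooth_on_def using times_differentiable_on_SucD by blast

lemma smooth_on_imp_continuous_on: "smooth_on f S \<Longrightarrow> continuous_on S f"
  unfolding smooth_on_def using times_differentiable_on_imp_continuous_on by blast

section \<open>Germs\<close>

text \<open>Smoothness on an entire neighbourhood is demanded, not just derivatives at the point. It
  is therefore an open condition, inherited by derivatives and composites without any record of
  domains.\<close>

definition smooth_at :: "('a::euclidean_space \<Rightarrow> 'b::euclidean_space) \<Rightarrow> 'a \<Rightarrow> bool" where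
  "smooth_at f z \<longleftrightarrow> (\<exists>S. open S \<and> z \<in> S \<and> smooth_on f S)"

lemma smooth_atI: "open S \<Longrightarrow> z \<in> S \<Longrightarrow> smooth_on f S \<Longrightarrow> smooth_at f z"
  by (auto simp: smooth_at_def)

lemma smooth_at_iff: "open S \<Longrightarrow> smooth_on f S \<longleftrightarrow> (\<forall>x\<in>S. smooth_at f x)"
  by (metis smooth_at_def smooth_on_local)

lemma smooth_at_eventually: "smooth_at f z \<Longrightarrow> \<forall>\<^sub>F x in nhds z. smooth_at f x"
  by (auto simp: smooth_at_def eventually_nhds)

lemma smooth_at_has_derivative:
  "smooth_at f z \<Longrightarrow> (f has_derivative frechet_derivative f (at z)) (at z)"
  by (auto simp: smooth_at_def smooth_on_has_derivative)

lemma smooth_at_linear_derivative: "smooth_at f z \<Longrightarrow> linear (frechet_derivative f (at z))"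
  using has_derivative_linear smooth_at_has_derivative by blast

lemma smooth_at_frechet_derivative:
  "smooth_at f z \<Longrightarrow> smooth_at (\<lambda>x. frechet_derivative f (at x) v) z"
  by (auto simp: smooth_at_def intro: smooth_on_frechet_derivative)

lemma smooth_at_isCont: "smooth_at f z \<Longrightarrow> isCont f z"
  using has_derivative_continuous smooth_at_has_derivative by blast

lemma smooth_at_eventually_compose:
  assumes "smooth_at f z" "\<forall>\<^sub>F y in nhds (f z). P y"
  shows "\<forall>\<^sub>F x in nhds z. P (f x)"
proof -
  have "(f \<longlongrightarrow> f z) (nhds z)"
    using smooth_at_isCont[OF assms(1)] unfolding isCont_def tendsto_at_iff_tendsto_nhds .
  then show ?thesis using assms(2) unfolding filterlim_iff by blast
qed

lemma smooth_at_compose: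
  assumes "smooth_at f z" "smooth_at g (f z)"
  shows "smooth_at (\<lambda>x. g (f x)) z"
proof -
  obtain S where S: "open S" "z \<in> S" "smooth_on f S" using assms(1) by (auto simp: smooth_at_def)
  obtain T where T: "open T" "f z \<in> T" "smooth_on g T" using assms(2) by (auto simp: smooth_at_def)
  have "open (S \<inter> f -` T)"
    using continuous_open_preimage[OF smooth_on_imp_continuous_on[OF S(3)] S(1) T(1)] .
  moreover have "smooth_on (\<lambda>x. g (f x)) (S \<inter> f -` T)"
    by (rule smooth_on_compose[OF \<open>open (S \<inter> f -` T)\<close> T(1) _ _ T(3)])
      (auto intro: smooth_on_subset[OF S(3)])
  ultimately show ?thesis using S T by (intro smooth_atI) auto
qed

lemma smooth_at_const: "smooth_at (\<lambda>x. c) z"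
  using smooth_atI[of UNIV] smooth_on_const by blast

lemma smooth_at_linear: "bounded_linear f \<Longrightarrow> smooth_at f z"
  using smooth_atI[of UNIV] smooth_on_linear by blast

lemma smooth_at_linear_compose: "bounded_linear L \<Longrightarrow> smooth_at f z \<Longrightarrow> smooth_at (\<lambda>x. L (f x)) z"
  using smooth_at_compose smooth_at_linear by blast

lemma smooth_at_bilinear:
  fixes prod :: "'b::euclidean_space \<Rightarrow> 'c::euclidean_space \<Rightarrow> 'd::euclidean_space"
  assumes "bounded_bilinear prod" "smooth_at f z" "smooth_at g z"
  shows "smooth_at (\<lambda>x. prod (f x) (g x)) z"
proof -
  obtain S T where "open S" "z \<in> S" "smooth_on f S" "open T" "z \<in> T" "smooth_on g T"
    using assms by (auto simp: smooth_at_def)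
  then show ?thesis
    using smooth_on_bilinear[OF assms(1), of "S \<inter> T" f g] smooth_on_subset[of f S "S \<inter> T"]
      smooth_on_subset[of g T "S \<inter> T"]
    by (intro smooth_atI[of "S \<inter> T"]) auto
qed

lemmas smooth_at_mult = smooth_at_bilinear[OF bounded_bilinear_mult]
  and smooth_at_scaleR = smooth_at_bilinear[OF bounded_bilinear_scaleR]
  and smooth_at_inner = smooth_at_bilinear[OF bounded_bilinear_inner]

lemma smooth_at_Pair:
  assumes "smooth_at f z" "smooth_at g z"
  shows "smooth_at (\<lambda>x. (f x, g x)) z"
proof -
  obtain S T where "open S" "z \<in> S" "smooth_on f S" "open T" "z \<in> T" "smooth_on g T"
    using assms by (auto simp: smooth_at_def)
  then show ?thesis
    using smooth_on_Pair[of "S \<inter> T" f g] smooth_on_subset[of f S "S \<inter> T"]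
      smooth_on_subset[of g T "S \<inter> T"]
    by (intro smooth_atI[of "S \<inter> T"]) auto
qed

lemma smooth_at_add:
  assumes "smooth_at f z" "smooth_at g z"
  shows "smooth_at (\<lambda>x. f x + g x) z"
  using smooth_at_linear_compose[OF bounded_linear_add[OF bounded_linear_fst bounded_linear_snd]
      smooth_at_Pair[OF assms]] by simp

lemma smooth_at_diff:
  assumes "smooth_at f z" "smooth_at g z"
  shows "smooth_at (\<lambda>x. f x - g x) z"
  using smooth_at_linear_compose[OF bounded_linear_sub[OF bounded_linear_fst bounded_linear_snd]
      smooth_at_Pair[OF assms]] by simp

lemma smooth_at_inverse:
  fixes f :: "'a::euclidean_space \<Rightarrow> real"
  assumes "smooth_at f z" "f z \<noteq> 0"
  shows "smooth_at (\<lambda>x. inverse (f x)) z"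
proof -
  have "smooth_at (inverse :: real \<Rightarrow> real) (f z)"
    by (rule smooth_atI[of "- {0}"]) (use assms(2) times_differentiable_on_inverse in \<open>auto simp: smooth_on_def\<close>)
  then show ?thesis by (rule smooth_at_compose[OF assms(1)])
qed

lemma smooth_at_sqrt:
  assumes "smooth_at f z" "f z > 0"
  shows "smooth_at (\<lambda>x. sqrt (f x)) z"
proof -
  have "smooth_at sqrt (f z)"
    by (rule smooth_atI[of "{0<..}"]) (use assms(2) times_differentiable_on_sqrt in \<open>auto simp: smooth_on_def\<close>)
  then show ?thesis by (rule smooth_at_compose[OF assms(1)])
qed

lemma frechet_derivative_cong_nhds:
  assumes "\<forall>\<^sub>F y in nhds z. f y = g y"
  shows "frechet_derivative f (at z) = frechet_derivative g (at z)"
  using assms frechet_derivative_cong_open[of _ z f g] by (auto simp: eventually_nhds)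

lemma frechet_derivative_chain:
  assumes "smooth_at f z" "smooth_at g (f z)"
  shows "frechet_derivative (\<lambda>x. g (f x)) (at z) v =
    frechet_derivative g (at (f z)) (frechet_derivative f (at z) v)"
  using frechet_derivative_eqI[OF has_derivative_compose[OF smooth_at_has_derivative[OF assms(1)]
        smooth_at_has_derivative[OF assms(2)]]] by simp

section \<open>Symmetry of second derivatives\<close>

lemma has_real_derivative_line:
  assumes "(f has_derivative f') (at (x + s *\<^sub>R v))"
  shows "((\<lambda>s. f (x + s *\<^sub>R v)) has_real_derivative f' v) (at s)"
proof -
  have "((\<lambda>s. x + s *\<^sub>R v) has_derivative (\<lambda>t. t *\<^sub>R v)) (at s)"
    by (auto intro!: derivative_eq_intros)
  from has_derivative_compose[OF this assms]
  have "((\<lambda>s. f (x + s *\<^sub>R v)) has_derivative (\<lambda>t. f' (t *\<^sub>R v))) (at s)" .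
  moreover have "f' (t *\<^sub>R v) = f' v * t" for t
    using linear_cmul[OF has_derivative_linear[OF assms]] by (simp add: mult.commute)
  ultimately show ?thesis
    unfolding has_field_derivative_def by (metis (no_types, lifting) has_derivative_eq_rhs ext)
qed

text \<open>The second difference over a parallelogram is symmetric in \<open>u\<close> and
  \<open>v\<close>. The mean value theorem along \<open>u\<close>, followed by the one along
  \<open>v\<close>, turns it into a mixed derivative at a point of the parallelogram.\<close>

lemma second_difference:
  fixes f :: "'a::euclidean_space \<Rightarrow> real"
  assumes f: "smooth_on f (ball z r)" and t: "0 < t" "t * (norm u + norm v) < r"
  obtains p where "dist p z \<le> t * (norm u + norm v)"
    "f (z + t *\<^sub>R u + t *\<^sub>R v) - f (z + t *\<^sub>R u) - f (z + t *\<^sub>R v) + f z =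
      t\<^sup>2 * frechet_derivative (\<lambda>x. frechet_derivative f (at x) u) (at p) v"
proof -
  let ?u = "\<lambda>x. frechet_derivative f (at x) u"
  have near: "dist (z + a *\<^sub>R u + b *\<^sub>R v) z \<le> t * (norm u + norm v)"
    if "0 \<le> a" "a \<le> t" "0 \<le> b" "b \<le> t" for a b
  proof -
    have "dist (z + a *\<^sub>R u + b *\<^sub>R v) z = norm (a *\<^sub>R u + b *\<^sub>R v)"
      by (simp add: dist_norm)
    also have "\<dots> \<le> a * norm u + b * norm v"
      using norm_triangle_ineq[of "a *\<^sub>R u" "b *\<^sub>R v"] that by simp
    also have "\<dots> \<le> t * norm u + t * norm v"
      using that by (intro add_mono mult_right_mono) auto
    finally show ?thesis by (simp add: distrib_left)
  qed
  have inb: "z + a *\<^sub>R u + b *\<^sub>R v \<in> ball z r" if "0 \<le> a" "a \<le> t" "0 \<le> b" "b \<le> t" for a b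
    using near[OF that] t by (simp add: dist_commute)
  have d1: "((\<lambda>s. f (z + s *\<^sub>R u + b *\<^sub>R v)) has_real_derivative ?u (z + a *\<^sub>R u + b *\<^sub>R v)) (at a)"
    if "0 \<le> a" "a \<le> t" "0 \<le> b" "b \<le> t" for a b
    using has_real_derivative_line[of f _ "z + b *\<^sub>R v" a u] smooth_on_has_derivative[OF f inb[OF that]]
    by (simp add: algebra_simps)
  \<comment> \<open>The first mean value argument concerns the difference of \<open>f\<close> along
    the two opposite edges in direction \<open>u\<close>.\<close>
  have d1': "((\<lambda>s. f (z + s *\<^sub>R u + t *\<^sub>R v) - f (z + s *\<^sub>R u)) has_real_derivative
      ?u (z + a *\<^sub>R u + t *\<^sub>R v) - ?u (z + a *\<^sub>R u)) (at a)" if "0 \<le> a" "a \<le> t" for a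
    using DERIV_diff[OF d1[of a t] d1[of a 0]] that t by simp
  obtain a where a: "0 < a" "a < t" "(f (z + t *\<^sub>R u + t *\<^sub>R v) - f (z + t *\<^sub>R u)) - (f (z + t *\<^sub>R v) - f z)
     = t * (?u (z + a *\<^sub>R u + t *\<^sub>R v) - ?u (z + a *\<^sub>R u))"
    using MVT2[OF t(1) d1'] by auto
  have d2: "((\<lambda>s. ?u (z + a *\<^sub>R u + s *\<^sub>R v)) has_real_derivative
      frechet_derivative ?u (at (z + a *\<^sub>R u + b *\<^sub>R v)) v) (at b)" if "0 \<le> b" "b \<le> t" for b
    using has_real_derivative_line[of ?u _ "z + a *\<^sub>R u" b v] a that
      smooth_on_has_derivative[OF smooth_on_frechet_derivative[OF f] inb[of a b]] by simp
  obtain b where b: "0 < b" "b < t" "?u (z + a *\<^sub>R u + t *\<^sub>R v) - ?u (z + a *\<^sub>R u)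
     = t * frechet_derivative ?u (at (z + a *\<^sub>R u + b *\<^sub>R v)) v"
    using MVT2[OF t(1) d2] by auto
  show ?thesis
    using that[of "z + a *\<^sub>R u + b *\<^sub>R v"] near[of a b] a b by (simp add: power2_eq_square algebra_simps)
qed

text \<open>Both orders of \<open>u\<close> and \<open>v\<close> give the same second difference,
  hence equal mixed derivatives at two points of the parallelogram. As it shrinks, both points tend
  to \<open>z\<close> and continuity finishes.\<close>

lemma symmetric_second_derivative:
  fixes f :: "'a::euclidean_space \<Rightarrow> real"
  assumes "smooth_at f z"
  shows "frechet_derivative (\<lambda>x. frechet_derivative f (at x) u) (at z) v =
    frechet_derivative (\<lambda>x. frechet_derivative f (at x) v) (at z) u"
proof -
  let ?uv = "\<lambda>u v p. frechet_derivative (\<lambda>x. frechet_derivative f (at x) u) (at p) v"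
  obtain S where S: "open S" "z \<in> S" "smooth_on f S" using assms by (auto simp: smooth_at_def)
  then obtain r where r: "r > 0" "ball z r \<subseteq> S" using open_contains_ball by blast
  have f: "smooth_on f (ball z r)" using smooth_on_subset[OF S(3) r(2)] .
  have *: "0 < norm u + norm v + 1" by (intro add_nonneg_pos) auto
  \<comment> \<open>The summand 1 keeps the denominator positive when \<open>u\<close> and
    \<open>v\<close> vanish, and makes the parallelogram fit strictly inside the ball.\<close>
  define t where "t n = r / (norm u + norm v + 1) * inverse (real (Suc n))" for n
  have t: "0 < t n" "t n * (norm u + norm v) < r" for n
  proof -
    show "0 < t n" using r * by (simp add: t_def)
    then have "t n * (norm u + norm v) < t n * (norm u + norm v + 1)" by simp
    also have "\<dots> = r * inverse (real (Suc n))" using * by (simp add: t_def)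
    also have "\<dots> \<le> r" using r(1) by (simp add: field_simps)
    finally show "t n * (norm u + norm v) < r" .
  qed
  have "\<exists>p q. dist p z \<le> t n * (norm u + norm v) \<and> dist q z \<le> t n * (norm u + norm v) \<and>
      ?uv u v p = ?uv v u q" for n
  proof -
    obtain p where p: "dist p z \<le> t n * (norm u + norm v)"
      "f (z + t n *\<^sub>R u + t n *\<^sub>R v) - f (z + t n *\<^sub>R u) - f (z + t n *\<^sub>R v) + f z = (t n)\<^sup>2 * ?uv u v p"
      using second_difference[OF f t] by blast
    have t': "t n * (norm v + norm u) < r" using t(2)[of n] by (simp add: add.commute)
    obtain q where q: "dist q z \<le> t n * (norm v + norm u)"
      "f (z + t n *\<^sub>R v + t n *\<^sub>R u) - f (z + t n *\<^sub>R v) - f (z + t n *\<^sub>R u) + f z = (t n)\<^sup>2 * ?uv v u q"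
      using second_difference[OF f t(1) t'] by blast
    have "(t n)\<^sup>2 * ?uv u v p = (t n)\<^sup>2 * ?uv v u q"
      using p(2) q(2) by (simp add: algebra_simps)
    then have "?uv u v p = ?uv v u q" using t(1)[of n] by simp
    then show ?thesis using p(1) q(1)[unfolded add.commute[of "norm v"]] by blast
  qed
  then obtain p q where pq: "\<And>n. dist (p n) z \<le> t n * (norm u + norm v)"
    "\<And>n. dist (q n) z \<le> t n * (norm u + norm v)" "\<And>n. ?uv u v (p n) = ?uv v u (q n)"
    by metis
  have "t \<longlonglongrightarrow> 0"
    unfolding t_def by (rule tendsto_mult_right_zero[OF LIMSEQ_inverse_real_of_nat])
  then have t0: "(\<lambda>n. t n * (norm u + norm v)) \<longlonglongrightarrow> 0"
    by (rule tendsto_mult_left_zero)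
  have lim: "x \<longlonglongrightarrow> z" if "\<And>n. dist (x n) z \<le> t n * (norm u + norm v)" for x
    by (rule metric_tendsto_imp_tendsto[OF t0])
      (use order_trans[OF that abs_ge_self] in \<open>simp add: always_eventually\<close>)
  have p: "p \<longlonglongrightarrow> z" and q: "q \<longlonglongrightarrow> z" using lim pq(1,2) by blast+
  have c: "isCont (?uv a b) z" for a b
    by (intro smooth_at_isCont smooth_at_frechet_derivative assms)
  have "(\<lambda>n. ?uv u v (p n)) \<longlonglongrightarrow> ?uv u v z"
    using isCont_tendsto_compose[OF c p] .
  moreover have "(\<lambda>n. ?uv u v (p n)) \<longlonglongrightarrow> ?uv v u z"
    unfolding pq(3) using isCont_tendsto_compose[OF c q] .
  ultimately show ?thesis using LIMSEQ_unique by blast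
qed

section \<open>The splitting lemma with parameters\<close>

text \<open>Integrate the derivative of \<open>F\<close> along the segment from the foot of
  \<open>z\<close> on the hyperplane to \<open>z\<close>. One factor \<open>z \<bullet> i\<close>
  comes from the velocity of the segment and one from \<open>Fk\<close>, and what remains is the
  integral of \<open>s * k\<close>, with value \<open>k z0 / 2\<close> at \<open>z0\<close>.\<close>

lemma hadamard_second_order:
  fixes F k :: "'a::euclidean_space \<Rightarrow> real"
  assumes F: "smooth_at F z0" and k: "smooth_at k z0" and i: "norm i = 1" "z0 \<bullet> i = 0"
    and Fk: "\<forall>\<^sub>F z in nhds z0. frechet_derivative F (at z) i = (z \<bullet> i) * k z"
  obtains b where "smooth_at b z0" "b z0 = k z0 / 2"
    "\<forall>\<^sub>F z in nhds z0. F z = F (z - (z \<bullet> i) *\<^sub>R i) + (z \<bullet> i)\<^sup>2 * b z"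
proof -
  have "\<forall>\<^sub>F z in nhds z0. smooth_at F z \<and> smooth_at k z \<and> frechet_derivative F (at z) i = (z \<bullet> i) * k z"
    using smooth_at_eventually[OF F] smooth_at_eventually[OF k] Fk by eventually_elim auto
  then obtain S where S: "open S" "z0 \<in> S"
    "\<And>z. z \<in> S \<Longrightarrow> smooth_at F z \<and> smooth_at k z \<and> frechet_derivative F (at z) i = (z \<bullet> i) * k z"
    by (auto simp: eventually_nhds)
  then obtain r' where r: "r' > 0" "ball z0 r' \<subseteq> S" using open_contains_ball by blast
  let ?B = "ball z0 r'"
  \<comment> \<open>For \<open>s\<close> from 0 to 1 this runs from the orthogonal projection of
    \<open>z\<close> onto the hyperplane to \<open>z\<close> itself.\<close>
  define p where "p z s = z - ((1 - s) * (z \<bullet> i)) *\<^sub>R i" for z s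
  have ii: "i \<bullet> i = 1" using i(1) by (simp add: dot_square_norm)
  have p0: "p z 0 = z - (z \<bullet> i) *\<^sub>R i" and p1: "p z 1 = z" for z by (simp_all add: p_def)
  have pi: "p z s \<bullet> i = s * (z \<bullet> i)" for z s
    by (simp add: p_def inner_diff_left ii algebra_simps)
  \<comment> \<open>Orthogonal projection onto a hyperplane through \<open>z0\<close> does not
    increase the distance to \<open>z0\<close>. By convexity the segment then stays in the
    ball.\<close>
  have proj: "z - (z \<bullet> i) *\<^sub>R i \<in> ?B" if "z \<in> ?B" for z
  proof -
    have "z - (z \<bullet> i) *\<^sub>R i - z0 = (z - z0) - ((z - z0) \<bullet> i) *\<^sub>R i"
      using i(2) by (simp add: inner_diff_left)
    moreover have "(norm (w - (w \<bullet> i) *\<^sub>R i))\<^sup>2 \<le> (norm w)\<^sup>2" for w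
    proof -
      have "(norm (w - (w \<bullet> i) *\<^sub>R i))\<^sup>2 = (norm w)\<^sup>2 - (w \<bullet> i)\<^sup>2"
        unfolding power2_norm_eq_inner
        by (simp add: inner_diff_left inner_diff_right ii inner_commute[of i w] power2_eq_square)
      then show ?thesis by simp
    qed
    ultimately have "norm (z - (z \<bullet> i) *\<^sub>R i - z0) \<le> norm (z - z0)"
      using norm_ge_zero power2_le_imp_le by metis
    then show ?thesis using that by (simp add: dist_norm norm_minus_commute)
  qed
  have pB: "p z s \<in> ?B" if "z \<in> ?B" "s \<in> {0..1}" for z s
  proof -
    have "p z s = s *\<^sub>R z + (1 - s) *\<^sub>R (z - (z \<bullet> i) *\<^sub>R i)"
      by (simp add: p_def algebra_simps)
    then show ?thesis
      using convexD[OF convex_ball that(1) proj[OF that(1)], of s "1 - s"] that(2) by simp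
  qed
  define b where "b z = integral {0..1} (\<lambda>s. s * k (p z s))" for z
  \<comment> \<open>The open set of all pairs of a point and a time whose path point lies in the
    ball; it contains \<open>?B \<times> {0..1}\<close>, as the integral lemma requires.\<close>
  let ?O = "(\<lambda>q. p (fst q) (snd q)) -` ?B"
  have p_smooth: "smooth_at (\<lambda>q. p (fst q) (snd q)) q" for q
    unfolding p_def
    by (intro smooth_at_diff smooth_at_scaleR smooth_at_mult smooth_at_inner smooth_at_const
        smooth_at_linear bounded_linear_fst bounded_linear_snd)
  have O: "open ?O"
    by (rule open_vimage) (auto intro!: continuous_at_imp_continuous_on smooth_at_isCont[OF p_smooth])
  have "smooth_on b ?B"
    unfolding b_def
  proof (rule smooth_onI, rule times_differentiable_on_integral[OF _ convex_ball O])
    show "?B \<times> {0..1} \<subseteq> ?O" using pB by auto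
    fix r
    have "smooth_at (\<lambda>q. snd q * k (p (fst q) (snd q))) q" if "q \<in> ?O" for q
    proof -
      have "smooth_at k (p (fst q) (snd q))" using that \<open>ball z0 r' \<subseteq> S\<close> S(3) by auto
      then show ?thesis
        by (rule smooth_at_mult[OF smooth_at_linear[OF bounded_linear_snd] smooth_at_compose[OF p_smooth]])
    qed
    then show "times_differentiable_on r (\<lambda>(z, s). s * k (p z s)) ?O"
      unfolding case_prod_unfold by (intro smooth_onD) (simp add: smooth_at_iff[OF O])
  qed auto
  then have "smooth_at b z0" using r(1) by (intro smooth_atI[of ?B]) auto
  moreover have "b z0 = k z0 / 2"
  proof -
    have "p z0 s = z0" for s by (simp add: p_def i(2))
    moreover have "((\<lambda>s::real. s * k z0) has_integral ((1\<^sup>2 - 0\<^sup>2) / 2) * k z0) {0..1}"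
      by (rule has_integral_mult_left[OF ident_has_integral]) simp
    ultimately show ?thesis unfolding b_def using integral_unique by fastforce
  qed
  moreover have "F z = F (z - (z \<bullet> i) *\<^sub>R i) + (z \<bullet> i)\<^sup>2 * b z" if z: "z \<in> ?B" for z
  proof -
    have "((\<lambda>s. F (p z s)) has_real_derivative (z \<bullet> i)\<^sup>2 * (s * k (p z s))) (at s)" if "s \<in> {0..1}" for s
    proof -
      have *: "p z s \<in> S" using pB[OF z that] r by auto
      have eq: "p z s = p z 0 + s *\<^sub>R ((z \<bullet> i) *\<^sub>R i)" for s
        by (simp add: p_def algebra_simps)
      have "((\<lambda>s. F (p z 0 + s *\<^sub>R ((z \<bullet> i) *\<^sub>R i))) has_real_derivative
          frechet_derivative F (at (p z s)) ((z \<bullet> i) *\<^sub>R i)) (at s)"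
        by (rule has_real_derivative_line) (use smooth_at_has_derivative S(3)[OF *] eq in metis)
      moreover have "frechet_derivative F (at (p z s)) ((z \<bullet> i) *\<^sub>R i) = (z \<bullet> i)\<^sup>2 * (s * k (p z s))"
        using linear_cmul[OF smooth_at_linear_derivative, of F "p z s" "z \<bullet> i" i] S(3)[OF *] pi
        by (simp add: power2_eq_square)
      ultimately show ?thesis unfolding eq[symmetric] by simp
    qed
    then have "((\<lambda>s. (z \<bullet> i)\<^sup>2 * (s * k (p z s))) has_integral F (p z 1) - F (p z 0)) {0..1}"
      by (intro fundamental_theorem_of_calculus)
        (auto simp: has_real_derivative_iff_has_vector_derivative has_vector_derivative_at_within)
    then have "integral {0..1} (\<lambda>s. (z \<bullet> i)\<^sup>2 * (s * k (p z s))) = F (p z 1) - F (p z 0)"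
      by (rule integral_unique)
    then show ?thesis by (simp add: b_def p0 p1)
  qed
  then have "\<forall>\<^sub>F z in nhds z0. F z = F (z - (z \<bullet> i) *\<^sub>R i) + (z \<bullet> i)\<^sup>2 * b z"
    using r(1) by (auto simp: eventually_nhds intro!: exI[of _ ?B])
  ultimately show ?thesis using that by blast
qed

text \<open>Both maps fix \<open>z\<close>, so germs compose and invert with all identities holding
  near the same point. The inverse is carried along as data.\<close>

definition diffeo_germ :: "'a::euclidean_space \<Rightarrow> ('a \<Rightarrow> 'a) \<Rightarrow> ('a \<Rightarrow> 'a) \<Rightarrow> bool" where
  "diffeo_germ z R R' \<longleftrightarrow> smooth_at R z \<and> smooth_at R' z \<and> R z = z \<and> R' z = z \<and>
     (\<forall>\<^sub>F y in nhds z. R' (R y) = y) \<and> (\<forall>\<^sub>F y in nhds z. R (R' y) = y)"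

lemma diffeo_germ_sym: "diffeo_germ z R R' \<Longrightarrow> diffeo_germ z R' R"
  by (auto simp: diffeo_germ_def)

lemma diffeo_germ_eventually_compose:
  assumes "diffeo_germ z R R'" "\<forall>\<^sub>F y in nhds z. P y"
  shows "\<forall>\<^sub>F y in nhds z. P (R y)"
  using smooth_at_eventually_compose[of R z P] assms by (auto simp: diffeo_germ_def)

lemma diffeo_germ_id: "diffeo_germ z (\<lambda>y. y) (\<lambda>y. y)"
  by (auto simp: diffeo_germ_def smooth_at_linear)

lemma diffeo_germ_compose:
  assumes R: "diffeo_germ z R R'" and S: "diffeo_germ z S S'"
  shows "diffeo_germ z (\<lambda>y. R (S y)) (\<lambda>y. S' (R' y))"
proof -
  have "\<forall>\<^sub>F y in nhds z. S' (R' (R (S y))) = y"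
    using diffeo_germ_eventually_compose[OF S, of "\<lambda>y. R' (R y) = y"] R S
    unfolding diffeo_germ_def by (auto elim: eventually_elim2)
  moreover have "\<forall>\<^sub>F y in nhds z. R (S (S' (R' y))) = y"
    using diffeo_germ_eventually_compose[OF diffeo_germ_sym[OF R], of "\<lambda>y. S (S' y) = y"] R S
    unfolding diffeo_germ_def by (auto elim: eventually_elim2)
  ultimately show ?thesis
    using R S by (auto simp: diffeo_germ_def intro: smooth_at_compose)
qed

lemma diffeo_germ_derivative_inverse:
  assumes "diffeo_germ z R R'"
  shows "frechet_derivative R' (at z) (frechet_derivative R (at z) v) = v"
proof -
  have "frechet_derivative R' (at z) (frechet_derivative R (at z) v) = frechet_derivative (\<lambda>y. R' (R y)) (at z) v"
    using frechet_derivative_chain[of R z R' v] assms by (simp add: diffeo_germ_def)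
  also have "\<dots> = frechet_derivative (\<lambda>y. y) (at z) v"
    using assms by (subst frechet_derivative_cong_nhds[where g = "\<lambda>y. y"]) (auto simp: diffeo_germ_def)
  also have "\<dots> = v" by (simp add: frechet_derivative_eqI[OF has_derivative_ident])
  finally show ?thesis .
qed

text \<open>The map replaces the coordinate along \<open>i\<close> by \<open>s\<close>. Its
  derivative differs from the identity by an operator with range in the line of \<open>i\<close>,
  and is invertible precisely when the derivative of \<open>s\<close> along \<open>i\<close> does
  not vanish.\<close>

lemma one_coordinate_inverse_germ:
  fixes s :: "'a::euclidean_space \<Rightarrow> real"
  assumes s: "smooth_at s z0" "s z0 = z0 \<bullet> i" "frechet_derivative s (at z0) i \<noteq> 0" and i: "norm i = 1"
  obtains R where "diffeo_germ z0 (\<lambda>z. z + (s z - z \<bullet> i) *\<^sub>R i) R"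
proof -
  define \<Phi> where "\<Phi> z = z + (s z - z \<bullet> i) *\<^sub>R i" for z
  let ?s' = "\<lambda>z. frechet_derivative s (at z)"
  have ii: "i \<bullet> i = 1" using i(1) by (simp add: dot_square_norm)
  have "\<forall>\<^sub>F z in nhds z0. ?s' z i \<noteq> 0"
    using tendsto_at_iff_tendsto_nhds[of "\<lambda>z. ?s' z i" z0]
      smooth_at_isCont[OF smooth_at_frechet_derivative[OF s(1)], of i] s(3)
    by (auto simp: isCont_def intro: tendsto_imp_eventually_ne)
  then have "\<forall>\<^sub>F z in nhds z0. smooth_at s z \<and> ?s' z i \<noteq> 0"
    using smooth_at_eventually[OF s(1)] by eventually_elim auto
  then obtain U where U: "open U" "z0 \<in> U" "\<And>z. z \<in> U \<Longrightarrow> smooth_at s z" "\<And>z. z \<in> U \<Longrightarrow> ?s' z i \<noteq> 0"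
    by (auto simp: eventually_nhds)
  define \<phi> where "\<phi> z v = v + (?s' z v - v \<bullet> i) *\<^sub>R i" for z v
  \<comment> \<open>Obtained by solving \<open>\<phi> z x = v\<close> for \<open>x\<close>: the
    difference of \<open>x\<close> and \<open>v\<close> is a multiple of \<open>i\<close>, and
    applying the derivative of \<open>s\<close> to the equation determines the factor.\<close>
  define \<psi> where "\<psi> z v = v + ((v \<bullet> i - ?s' z v) * inverse (?s' z i)) *\<^sub>R i" for z v
  have lin: "bounded_linear (?s' z)" if "z \<in> U" for z
    using has_derivative_bounded_linear smooth_at_has_derivative U(3)[OF that] by blast
  have \<Phi>': "(\<Phi> has_derivative \<phi> z) (at z)" if "z \<in> U" for z
    unfolding \<Phi>_def \<phi>_def using smooth_at_has_derivative[OF U(3)[OF that]]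
    by (auto intro!: derivative_eq_intros)
  have bl: "bounded_linear (\<phi> z)" if "z \<in> U" for z
    using has_derivative_bounded_linear[OF \<Phi>'[OF that]] .
  have bl': "bounded_linear (\<psi> z)" if "z \<in> U" for z
    unfolding \<psi>_def
    by (intro bounded_linear_add bounded_linear_ident bounded_linear_compose[OF bounded_linear_scaleR_left]
        bounded_linear_compose[OF bounded_linear_mult_left] bounded_linear_sub bounded_linear_inner_left lin that)
  have inv1: "\<psi> z (\<phi> z v) = v" if "z \<in> U" for z v
  proof -
    have "?s' z (\<phi> z v) = ?s' z v + (?s' z v - v \<bullet> i) * ?s' z i"
      using bounded_linear.linear[OF lin[OF that]] by (simp add: \<phi>_def linear_add linear_cmul)
    moreover have "\<phi> z v \<bullet> i = ?s' z v" by (simp add: \<phi>_def inner_add_left ii)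
    ultimately have eq: "(\<phi> z v \<bullet> i - ?s' z (\<phi> z v)) * inverse (?s' z i) = - (?s' z v - v \<bullet> i)"
      using U(4)[OF that] by (simp add: field_simps)
    show ?thesis unfolding \<psi>_def[of z "\<phi> z v"] eq by (simp add: \<phi>_def algebra_simps)
  qed
  \<comment> \<open>In finite dimension a linear left inverse is also a right inverse.\<close>
  have inv2: "\<phi> z (\<psi> z v) = v" if "z \<in> U" for z v
    using inv1[OF that] bounded_linear.linear[OF bl[OF that]] bounded_linear.linear[OF bl'[OF that]]
      linear_inverse_left[of "\<psi> z" "\<phi> z"] by (metis (no_types, lifting) comp_apply id_apply ext)
  have blin: "blinfun_apply (Blinfun (\<phi> z)) = \<phi> z" if "z \<in> U" for z
    using bounded_linear_Blinfun_apply[OF bl[OF that]] .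
  have "continuous_on U (\<lambda>z. Blinfun (\<phi> z))"
  proof (rule continuous_on_blinfun_componentwise)
    fix v :: 'a
    have "continuous_on U (\<lambda>z. \<phi> z v)"
      unfolding \<phi>_def using U(3)
      by (intro continuous_at_imp_continuous_on ballI smooth_at_isCont smooth_at_add smooth_at_scaleR
          smooth_at_diff smooth_at_const smooth_at_frechet_derivative) auto
    then show "continuous_on U (\<lambda>z. blinfun_apply (Blinfun (\<phi> z)) v)"
      by (rule continuous_on_eq) (simp add: blin)
  qed
  moreover have "Blinfun (\<psi> z0) o\<^sub>L Blinfun (\<phi> z0) = id_blinfun"
    by (rule blinfun_eqI)
      (simp add: blin[OF U(2)] bounded_linear_Blinfun_apply[OF bl'[OF U(2)]] inv1[OF U(2)])
  moreover have "(\<Phi> has_derivative blinfun_apply (Blinfun (\<phi> z))) (at z)" if "z \<in> U" for z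
    using \<Phi>'[OF that] blin[OF that] by simp
  ultimately obtain U' V R R' where R: "open U'" "U' \<subseteq> U" "z0 \<in> U'" "open V" "\<Phi> z0 \<in> V"
    "homeomorphism U' V \<Phi> R" "\<And>y. y \<in> V \<Longrightarrow> (R has_derivative (R' y)) (at y)"
    "\<And>y. y \<in> V \<Longrightarrow> R' y = inv (blinfun_apply (Blinfun (\<phi> (R y))))"
    using inverse_function_theorem[OF U(1) _ _ U(2), of \<Phi> "\<lambda>z. Blinfun (\<phi> z)" "Blinfun (\<psi> z0)"]
    by metis
  have hom: "\<And>z. z \<in> U' \<Longrightarrow> R (\<Phi> z) = z" "\<And>y. y \<in> V \<Longrightarrow> \<Phi> (R y) = y" "R ` V = U'" "continuous_on V R"
    using R(6) by (auto simp: homeomorphism_def)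
  have RV: "R y \<in> U" if "y \<in> V" for y using hom(3) R(2) that by blast
  have R': "(R has_derivative \<psi> (R y)) (at y)" if "y \<in> V" for y
  proof -
    have "inv (\<phi> (R y)) = \<psi> (R y)"
      using inv1[OF RV[OF that]] inv2[OF RV[OF that]] by (simp add: inv_equality)
    then show ?thesis using R(7,8)[OF that] blin[OF RV[OF that]] by simp
  qed
  \<comment> \<open>A bootstrap: the derivative of \<open>R\<close> is \<open>\<psi>\<close>, smooth
    in its base point, evaluated at \<open>R y\<close>. So each order of differentiability of
    \<open>R\<close> yields the next one.\<close>
  have "times_differentiable_on r R V" for r
  proof (induction r)
    case 0
    then show ?case using hom(4) by simp
  next
    case (Suc r)
    have "times_differentiable_on r (\<lambda>y. \<psi> (R y) v) V" for v
    proof (rule times_differentiable_on_compose[OF R(4) U(1) _ Suc])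
      show "R ` V \<subseteq> U" using RV by auto
      have "smooth_on (\<lambda>z. \<psi> z v) U"
        unfolding smooth_at_iff[OF U(1)] \<psi>_def using U(3,4)
        by (intro ballI smooth_at_add smooth_at_scaleR smooth_at_mult smooth_at_diff smooth_at_const
            smooth_at_inverse smooth_at_frechet_derivative) auto
      then show "times_differentiable_on r (\<lambda>z. \<psi> z v) U" by (rule smooth_onD)
    qed
    from times_differentiable_on_SucI[OF R(4) R' this] show ?case .
  qed
  then have "smooth_on R V" by (rule smooth_onI)
  moreover have z0: "\<Phi> z0 = z0" by (simp add: \<Phi>_def s(2))
  ultimately have "smooth_at R z0" using R(4,5) smooth_atI by metis
  moreover have "smooth_at \<Phi> z0"
    unfolding \<Phi>_def by (intro smooth_at_add smooth_at_scaleR smooth_at_diff smooth_at_const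
        smooth_at_linear bounded_linear_ident bounded_linear_inner_left s(1))
  moreover have "\<forall>\<^sub>F z in nhds z0. R (\<Phi> z) = z" "\<forall>\<^sub>F y in nhds z0. \<Phi> (R y) = y" "R z0 = z0"
    using hom R z0 by (auto simp: eventually_nhds)
  ultimately have "diffeo_germ z0 \<Phi> R" using z0 by (simp add: diffeo_germ_def)
  then show ?thesis using that unfolding \<Phi>_def by blast
qed

text \<open>\<open>R\<close> inverts the map that puts \<open>s\<close> in the place of the
  coordinate along \<open>i\<close>; hence \<open>s\<close>, read through \<open>R\<close>, is this
  coordinate. Invariance of \<open>s\<close> under \<open>P\<close> makes that map commute with
  \<open>P\<close>, and its inverse inherits this.\<close>

lemma coordinate_change:
  fixes s :: "'a::euclidean_space \<Rightarrow> real" and P :: "'a \<Rightarrow> 'a"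
  assumes s: "smooth_at s z0" "s z0 = 0" "frechet_derivative s (at z0) i \<noteq> 0"
    and i: "norm i = 1" "z0 \<bullet> i = 0"
    and P: "bounded_linear P" "P z0 = z0" "P i = i" "\<And>z. P z \<bullet> i = z \<bullet> i"
    and sP: "\<forall>\<^sub>F z in nhds z0. s (P z) = s z"
  obtains R R' where "diffeo_germ z0 R R'" "\<forall>\<^sub>F z in nhds z0. R z = z + (R z \<bullet> i - z \<bullet> i) *\<^sub>R i"
    "\<forall>\<^sub>F z in nhds z0. s (R z) = z \<bullet> i" "\<forall>\<^sub>F z in nhds z0. R (P z) = P (R z)"
proof -
  have ii: "i \<bullet> i = 1" using i(1) by (simp add: dot_square_norm)
  define \<Phi> where "\<Phi> z = z + (s z - z \<bullet> i) *\<^sub>R i" for z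
  obtain R where "diffeo_germ z0 \<Phi> R"
    using one_coordinate_inverse_germ[OF s(1) _ s(3) i(1)] s(2) i(2) unfolding \<Phi>_def by metis
  then have R: "diffeo_germ z0 R \<Phi>" by (rule diffeo_germ_sym)
  have \<Phi>R: "\<forall>\<^sub>F z in nhds z0. \<Phi> (R z) = z" and R\<Phi>: "\<forall>\<^sub>F z in nhds z0. R (\<Phi> z) = z"
    using R by (auto simp: diffeo_germ_def)
  have sR: "\<forall>\<^sub>F z in nhds z0. s (R z) = z \<bullet> i"
    using \<Phi>R
  proof eventually_elim
    case (elim z)
    have "\<Phi> (R z) \<bullet> i = s (R z)" by (simp add: \<Phi>_def inner_add_left ii)
    then show ?case using elim by simp
  qed
  have Ri: "\<forall>\<^sub>F z in nhds z0. R z = z + (R z \<bullet> i - z \<bullet> i) *\<^sub>R i"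
    using \<Phi>R sR
  proof eventually_elim
    case (elim z)
    have "R z + (s (R z) - R z \<bullet> i) *\<^sub>R i = z" using elim(1) by (simp only: \<Phi>_def)
    then have "R z = z - (s (R z) - R z \<bullet> i) *\<^sub>R i" by (simp only: eq_diff_eq)
    also have "\<dots> = z + (R z \<bullet> i - z \<bullet> i) *\<^sub>R i"
      unfolding elim(2) by (simp add: algebra_simps)
    finally show ?case .
  qed
  have \<Phi>P: "\<forall>\<^sub>F z in nhds z0. \<Phi> (P z) = P (\<Phi> z)"
    using sP
    by eventually_elim
      (simp add: \<Phi>_def P(3,4) bounded_linear.linear[OF P(1)] linear_add linear_cmul)
  have PR: "smooth_at (\<lambda>z. P (R z)) z0" "P (R z0) = z0"
    using R P(2) by (auto simp: diffeo_germ_def intro: smooth_at_linear_compose[OF P(1)])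
  \<comment> \<open>Near \<open>z0\<close> one has \<open>R (P z) = R (P (\<Phi> (R z))) = R (\<Phi>
    (P (R z))) = P (R z)\<close>.\<close>
  have "\<forall>\<^sub>F z in nhds z0. R (P z) = P (R z)"
    using \<Phi>R diffeo_germ_eventually_compose[OF R \<Phi>P]
      smooth_at_eventually_compose[OF PR(1), of "\<lambda>y. R (\<Phi> y) = y", unfolded PR(2), OF R\<Phi>]
  proof eventually_elim
    case (elim z)
    then show ?case by metis
  qed
  then show ?thesis using that R Ri sR by blast
qed

text \<open>First the coordinate \<open>i\<close> is replaced by the partial derivative of \<open>G\<close> in this direction, which
  moves the critical points in direction \<open>i\<close> to the hyperplane where the coordinate vanishes. There
  Hadamard's lemma applies, and the square root of its factor yields the second change of the same
  coordinate. The projection \<open>P\<close> forgets the variables that are split off already.\<close>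

lemma morse_step:
  fixes G :: "'a::euclidean_space \<Rightarrow> real" and P :: "'a \<Rightarrow> 'a"
  assumes G: "smooth_at G z0" "frechet_derivative G (at z0) i = 0"
    "frechet_derivative (\<lambda>z. frechet_derivative G (at z) i) (at z0) i \<noteq> 0"
    and i: "norm i = 1" "z0 \<bullet> i = 0"
    and P: "bounded_linear P" "P z0 = z0" "P i = i" "\<And>z. P z \<bullet> i = z \<bullet> i" "\<And>z. P (P z) = P z"
    and GP: "\<And>z. G (P z) = G z"
  obtains R R' e where "diffeo_germ z0 R R'" "e \<noteq> 0"
    "\<forall>\<^sub>F z in nhds z0. R z = z + (R z \<bullet> i - z \<bullet> i) *\<^sub>R i"
    "\<forall>\<^sub>F z in nhds z0. R (P z) = P (R z)"
    "\<forall>\<^sub>F z in nhds z0. G (R z) = G (R (z - (z \<bullet> i) *\<^sub>R i)) + e * (z \<bullet> i)\<^sup>2"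
proof -
  have ii: "i \<bullet> i = 1" using i(1) by (simp add: dot_square_norm)
  have Psm: "smooth_at P z" for z using P(1) by (rule smooth_at_linear)
  have PD: "frechet_derivative P (at z) v = P v" for z v
    using frechet_derivative_eqI[OF bounded_linear_imp_has_derivative[OF P(1)]] by metis
  have evP: "\<forall>\<^sub>F z in nhds z0. Q (P z)" if "\<forall>\<^sub>F z in nhds z0. Q z" for Q
    using smooth_at_eventually_compose[OF Psm, of Q z0] that by (simp add: P(2))
  define q where "q z = z - (z \<bullet> i) *\<^sub>R i" for z
  have evq: "\<forall>\<^sub>F z in nhds z0. Q (q z)" if "\<forall>\<^sub>F z in nhds z0. Q z" for Q
  proof -
    have "smooth_at q z0" unfolding q_def
      by (intro smooth_at_diff smooth_at_scaleR smooth_at_const smooth_at_linear bounded_linear_ident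
          bounded_linear_inner_left)
    then show ?thesis using smooth_at_eventually_compose[of q z0 Q] that by (simp add: q_def i(2))
  qed
  define s where "s z = frechet_derivative G (at z) i" for z
  have s: "smooth_at s z0" "s z0 = 0" "frechet_derivative s (at z0) i \<noteq> 0"
    using G smooth_at_frechet_derivative[OF G(1)] by (simp_all add: s_def[abs_def])
  \<comment> \<open>Differentiate \<open>G (P z) = G z\<close> in direction \<open>i\<close>, which
    \<open>P\<close> fixes.\<close>
  have "\<forall>\<^sub>F z in nhds z0. s (P z) = s z"
    using evP[OF smooth_at_eventually[OF G(1)]]
  proof eventually_elim
    case (elim z)
    have "frechet_derivative (\<lambda>z. G (P z)) (at z) i = s (P z)"
      using frechet_derivative_chain[OF Psm elim] by (simp add: PD P(3) s_def)
    then show ?case by (simp add: GP s_def)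
  qed
  from coordinate_change[OF s i P(1-4) this]
  obtain R1 R1' where R1: "diffeo_germ z0 R1 R1'"
    "\<forall>\<^sub>F z in nhds z0. R1 z = z + (R1 z \<bullet> i - z \<bullet> i) *\<^sub>R i"
    "\<forall>\<^sub>F z in nhds z0. s (R1 z) = z \<bullet> i" "\<forall>\<^sub>F z in nhds z0. R1 (P z) = P (R1 z)" by blast
  have R1s: "smooth_at R1 z0" "R1 z0 = z0" using R1(1) by (auto simp: diffeo_germ_def)
  define F where "F z = G (R1 z)" for z
  define k where "k z = frechet_derivative (\<lambda>y. R1 y \<bullet> i) (at z) i" for z
  have \<sigma>: "smooth_at (\<lambda>y. R1 y \<bullet> i) z" if "smooth_at R1 z" for z
    using that by (rule smooth_at_linear_compose[OF bounded_linear_inner_left])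
  have F: "smooth_at F z0"
    unfolding F_def using smooth_at_compose[OF R1s(1)] G(1) R1s(2) by simp
  have k: "smooth_at k z0"
    unfolding k_def by (rule smooth_at_frechet_derivative[OF \<sigma>[OF R1s(1)]])
  \<comment> \<open>\<open>R1\<close> moves points only along \<open>i\<close>, so its derivative
    maps \<open>i\<close> to a multiple of \<open>i\<close>. Consequently the derivative of
    \<open>F\<close> along \<open>i\<close> is \<open>s (R1 z) * k z\<close>, that is
    \<open>(z \<bullet> i) * k z\<close>.\<close>
  have DR1: "frechet_derivative R1 (at z) i = k z *\<^sub>R i"
    if "smooth_at R1 z" "\<forall>\<^sub>F y in nhds z. R1 y = y + (R1 y \<bullet> i - y \<bullet> i) *\<^sub>R i" for z
  proof -
    have "((\<lambda>y. y + (R1 y \<bullet> i - y \<bullet> i) *\<^sub>R i) has_derivative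
       (\<lambda>v. v + (frechet_derivative (\<lambda>y. R1 y \<bullet> i) (at z) v - v \<bullet> i) *\<^sub>R i)) (at z)"
      using smooth_at_has_derivative[OF \<sigma>[OF that(1)]]
      by (intro has_derivative_add has_derivative_ident has_derivative_scaleR_left has_derivative_diff
          bounded_linear_imp_has_derivative bounded_linear_inner_left) auto
    from frechet_derivative_eqI[OF this]
    show ?thesis
      unfolding frechet_derivative_cong_nhds[OF that(2)] by (simp add: k_def ii algebra_simps)
  qed
  have "\<forall>\<^sub>F z in nhds z0. frechet_derivative F (at z) i = (z \<bullet> i) * k z"
    using smooth_at_eventually[OF R1s(1)] R1(2)[THEN iffD2[OF eventually_eventually]] R1(3)
      diffeo_germ_eventually_compose[OF R1(1) smooth_at_eventually[OF G(1)]]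
  proof eventually_elim
    case (elim z)
    have "frechet_derivative F (at z) i = frechet_derivative G (at (R1 z)) (k z *\<^sub>R i)"
      unfolding F_def using frechet_derivative_chain[OF elim(1,4)] DR1[OF elim(1,2)] by simp
    then show ?case
      using elim(3) linear_cmul[OF smooth_at_linear_derivative[OF elim(4)]] by (simp add: s_def)
  qed
  from hadamard_second_order[OF F k i this] obtain b where
    b: "smooth_at b z0" "b z0 = k z0 / 2" "\<forall>\<^sub>F z in nhds z0. F z = F (q z) + (z \<bullet> i)\<^sup>2 * b z"
    unfolding q_def by blast
  \<comment> \<open>Differentiating \<open>s (R1 z) = z \<bullet> i\<close> along \<open>i\<close>
    shows that the derivative of \<open>s\<close> maps \<open>k z0 *\<^sub>R i\<close> to 1.\<close>
  have "k z0 \<noteq> 0"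
  proof -
    have "frechet_derivative (\<lambda>z. s (R1 z)) (at z0) i = frechet_derivative (\<lambda>z. z \<bullet> i) (at z0) i"
      using frechet_derivative_cong_nhds[OF R1(3)] by simp
    also have "\<dots> = 1"
      using frechet_derivative_eqI[OF bounded_linear_imp_has_derivative[OF bounded_linear_inner_left, of i]]
      by (simp add: ii)
    finally have "frechet_derivative s (at z0) (k z0 *\<^sub>R i) = 1"
      using frechet_derivative_chain[OF R1s(1), of s i] s(1) R1s DR1[OF R1s(1) R1(2)] by simp
    then show ?thesis using linear_0[OF smooth_at_linear_derivative[OF s(1)]] by fastforce
  qed
  define e where "e = b z0"
  have e: "e \<noteq> 0" using \<open>k z0 \<noteq> 0\<close> b(2) by (simp add: e_def)
  have FP: "\<forall>\<^sub>F z in nhds z0. F (P z) = F z"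
    using R1(4) by eventually_elim (simp add: F_def GP)
  have Pq: "q (P z) = P (q z)" for z
    by (simp add: q_def P(3,4) bounded_linear.linear[OF P(1)] linear_diff linear_cmul)
  \<comment> \<open>Hadamard's factor need not be invariant under \<open>P\<close>, but
    \<open>F\<close> is. Evaluating the expansion at \<open>P z\<close> replaces \<open>b z\<close>
    by \<open>b (P z)\<close>, so that the second change of coordinate commutes with
    \<open>P\<close> as well.\<close>
  have Fq: "\<forall>\<^sub>F z in nhds z0. F z = F (q z) + (z \<bullet> i)\<^sup>2 * b (P z)"
    using FP evP[OF b(3)] evq[OF FP] by eventually_elim (simp add: Pq P(4))
  \<comment> \<open>Dividing by the value \<open>e\<close> at \<open>z0\<close> gives a factor equal
    to 1 there; its square root is smooth near \<open>z0\<close> whatever the sign of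
    \<open>e\<close> is.\<close>
  define w where "w z = b (P z) * inverse e" for z
  have w: "smooth_at w z0" "w z0 = 1"
    unfolding w_def using smooth_at_compose[OF Psm, of b z0] b(1) e
    by (auto simp: P(2) e_def[symmetric] intro!: smooth_at_mult smooth_at_const)
  define \<zeta> where "\<zeta> z = (z \<bullet> i) * sqrt (w z)" for z
  have \<zeta>: "smooth_at \<zeta> z0"
    unfolding \<zeta>_def
    by (rule smooth_at_mult[OF smooth_at_linear[OF bounded_linear_inner_left] smooth_at_sqrt[OF w(1)]])
      (simp add: w(2))
  have "frechet_derivative \<zeta> (at z0) i \<noteq> 0"
  proof -
    have *: "smooth_at (\<lambda>z. sqrt (w z)) z0" using w by (intro smooth_at_sqrt) auto
    show ?thesis
      unfolding \<zeta>_def frechet_derivative_eqI[OF has_derivative_mult[OF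
          bounded_linear_imp_has_derivative[OF bounded_linear_inner_left] smooth_at_has_derivative[OF *]]]
      by (simp add: w(2) i(2) ii)
  qed
  moreover have "\<forall>\<^sub>F z in nhds z0. \<zeta> (P z) = \<zeta> z"
    by (simp add: \<zeta>_def w_def P(4,5))
  moreover have "\<zeta> z0 = 0" by (simp add: \<zeta>_def i(2))
  ultimately obtain R2 R2' where R2: "diffeo_germ z0 R2 R2'"
    "\<forall>\<^sub>F z in nhds z0. R2 z = z + (R2 z \<bullet> i - z \<bullet> i) *\<^sub>R i"
    "\<forall>\<^sub>F z in nhds z0. \<zeta> (R2 z) = z \<bullet> i" "\<forall>\<^sub>F z in nhds z0. R2 (P z) = P (R2 z)"
    using coordinate_change[OF \<zeta> _ _ i P(1-4)] by blast
  have "\<forall>\<^sub>F z in nhds z0. w z > 0"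
    using order_tendstoD(1)[of w "w z0" "nhds z0" 0] tendsto_at_iff_tendsto_nhds[of w z0]
      smooth_at_isCont[OF w(1)] w(2) by (simp add: isCont_def)
  then have F\<zeta>: "\<forall>\<^sub>F z in nhds z0. F z = F (q z) + e * (\<zeta> z)\<^sup>2"
    using Fq
  proof eventually_elim
    case (elim z)
    have "e * (\<zeta> z)\<^sup>2 = (z \<bullet> i)\<^sup>2 * (e * w z)"
      using elim(1) by (simp add: \<zeta>_def power_mult_distrib)
    also have "e * w z = b (P z)" using e by (simp add: w_def)
    finally show ?case using elim(2) by simp
  qed
  \<comment> \<open>\<open>R2\<close> moves points only along \<open>i\<close>, so it does not
    change \<open>q z\<close>.\<close>
  have FR2: "\<forall>\<^sub>F z in nhds z0. F (R2 z) = F (q z) + e * (z \<bullet> i)\<^sup>2"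
    using diffeo_germ_eventually_compose[OF R2(1) F\<zeta>] R2(2,3)
  proof eventually_elim
    case (elim z)
    have "q (R2 z) = q z"
      unfolding q_def by (subst (1) elim(2)) (simp add: algebra_simps)
    then show ?case using elim(1,3) by simp
  qed
  have qq: "q (q z) = q z" "q z \<bullet> i = 0" for z
    by (simp_all add: q_def inner_diff_left ii)
  \<comment> \<open>Taking \<open>FR2\<close> at \<open>q z\<close>, where the square vanishes,
    identifies \<open>F (q z)\<close> with \<open>F (R2 (q z))\<close>. The composed change of
    coordinates then occurs in both terms of the conclusion.\<close>
  have "\<forall>\<^sub>F z in nhds z0. F (R2 z) = F (R2 (q z)) + e * (z \<bullet> i)\<^sup>2"
    using FR2 evq[OF FR2] by eventually_elim (simp add: qq)
  moreover have "\<forall>\<^sub>F z in nhds z0. R1 (R2 z) = z + (R1 (R2 z) \<bullet> i - z \<bullet> i) *\<^sub>R i"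
    using diffeo_germ_eventually_compose[OF R2(1) R1(2)] R2(2)
  proof eventually_elim
    case (elim z)
    have A: "R1 (R2 z) - R2 z = (R1 (R2 z) \<bullet> i - R2 z \<bullet> i) *\<^sub>R i"
      by (subst (1) elim(1)) simp
    have B: "R2 z - z = (R2 z \<bullet> i - z \<bullet> i) *\<^sub>R i"
      by (subst (1) elim(2)) simp
    have "R1 (R2 z) = z + ((R1 (R2 z) - R2 z) + (R2 z - z))" by simp
    also have "\<dots> = z + (R1 (R2 z) \<bullet> i - z \<bullet> i) *\<^sub>R i"
      unfolding A B by (simp add: algebra_simps)
    finally show ?case .
  qed
  moreover have "\<forall>\<^sub>F z in nhds z0. R1 (R2 (P z)) = P (R1 (R2 z))"
    using diffeo_germ_eventually_compose[OF R2(1) R1(4)] R2(4) by eventually_elim simp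
  ultimately show ?thesis
    using that[OF diffeo_germ_compose[OF R1(1) R2(1)] e] unfolding F_def q_def by blast
qed

section \<open>Splitting off one variable after another\<close>

definition drop_coords :: "'a::euclidean_space set \<Rightarrow> 'a \<Rightarrow> 'a" where
  "drop_coords M z = z - (\<Sum>b\<in>M. (z \<bullet> b) *\<^sub>R b)"

lemma bounded_linear_drop_coords: "bounded_linear (drop_coords M)"
  unfolding drop_coords_def[abs_def]
  by (intro bounded_linear_sub bounded_linear_ident bounded_linear_sum
      bounded_linear_compose[OF bounded_linear_scaleR_left bounded_linear_inner_left])

lemma inner_drop_coords:
  assumes "M \<subseteq> Basis" "b \<in> Basis"
  shows "drop_coords M z \<bullet> b = (if b \<in> M then 0 else z \<bullet> b)"
proof -
  have "finite M" using assms(1) finite_Basis finite_subset by blast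
  have "(\<Sum>c\<in>M. (z \<bullet> c) *\<^sub>R c) \<bullet> b = (\<Sum>c\<in>M. if c = b then z \<bullet> b else 0)"
    unfolding inner_sum_left using assms by (intro sum.cong) (auto simp: inner_Basis)
  then show ?thesis using \<open>finite M\<close> by (simp add: drop_coords_def inner_diff_left)
qed

lemma drop_coords_eq:
  assumes "\<And>b. b \<in> M \<Longrightarrow> z \<bullet> b = 0"
  shows "drop_coords M z = z"
  using assms by (simp add: drop_coords_def)

lemma drop_coords_insert:
  assumes "finite M" "M \<subseteq> Basis" "i \<in> Basis" "i \<notin> M"
  shows "drop_coords (insert i M) z = drop_coords M (z - (z \<bullet> i) *\<^sub>R i)"
  by (rule euclidean_eqI) (use assms in \<open>auto simp: inner_drop_coords inner_diff_left inner_Basis\<close>)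

text \<open>As \<open>w\<close> is orthogonal to \<open>i\<close>, the shear preserves the
  coordinate along \<open>i\<close>, and subtracting the same multiple of \<open>w\<close> undoes
  it.\<close>

lemma shear_diffeo_germ:
  assumes "(w::'a::euclidean_space) \<bullet> i = 0" "z0 \<bullet> i = 0"
  shows "diffeo_germ z0 (\<lambda>z. z + (z \<bullet> i) *\<^sub>R w) (\<lambda>z. z - (z \<bullet> i) *\<^sub>R w)"
proof -
  have *: "smooth_at (\<lambda>z. (z \<bullet> i) *\<^sub>R w) z0"
    by (intro smooth_at_linear bounded_linear_compose[OF bounded_linear_scaleR_left bounded_linear_inner_left])
  then show ?thesis
    using assms smooth_at_add[OF smooth_at_linear[OF bounded_linear_ident] *]
      smooth_at_diff[OF smooth_at_linear[OF bounded_linear_ident] *]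
    by (simp add: diffeo_germ_def inner_add_left inner_diff_left)
qed

text \<open>Only the coordinates in \<open>D\<close> may be changed, the others are the parameters; \<open>M \<subseteq> D\<close> are the
  coordinates that already occur in separate squares only.\<close>

definition partial_splitting ::
    "('a::euclidean_space \<Rightarrow> real) \<Rightarrow> 'a \<Rightarrow> 'a set \<Rightarrow> 'a set \<Rightarrow> ('a \<Rightarrow> real) \<Rightarrow> ('a \<Rightarrow> 'a) \<Rightarrow> ('a \<Rightarrow> 'a) \<Rightarrow> bool" where
  "partial_splitting h z0 D M e R R' \<longleftrightarrow>
     M \<subseteq> D \<and> (\<forall>b\<in>M. e b \<noteq> 0) \<and> diffeo_germ z0 R R' \<and>
     (\<forall>\<^sub>F z in nhds z0. \<forall>c\<in>Basis - D. R z \<bullet> c = z \<bullet> c) \<and>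
     (\<forall>\<^sub>F z in nhds z0. h (R z) = h (R (drop_coords M z)) + (\<Sum>b\<in>M. e b * (z \<bullet> b)\<^sup>2))"

text \<open>Since \<open>R\<close> leaves the coordinates outside \<open>D\<close> alone, its
  derivative preserves the span of \<open>D\<close>, on which the derivative of \<open>h\<close>
  vanishes. So composing with \<open>R\<close> keeps the point critical in these directions.\<close>

lemma partial_splitting_derivative:
  assumes h: "smooth_at h z0" "\<And>b. b \<in> D \<Longrightarrow> frechet_derivative h (at z0) b = 0"
    and R: "diffeo_germ z0 R R'" "\<forall>\<^sub>F z in nhds z0. \<forall>c\<in>Basis - D. R z \<bullet> c = z \<bullet> c"
    and D: "D \<subseteq> Basis" and v: "\<And>c. c \<in> Basis - D \<Longrightarrow> v \<bullet> c = 0"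
  shows "\<And>c. c \<in> Basis - D \<Longrightarrow> frechet_derivative R (at z0) v \<bullet> c = 0"
    and "frechet_derivative (\<lambda>z. h (R z)) (at z0) v = 0"
proof -
  let ?w = "frechet_derivative R (at z0) v"
  have Rs: "smooth_at R z0" "R z0 = z0" using R(1) by (auto simp: diffeo_germ_def)
  show w: "?w \<bullet> c = 0" if "c \<in> Basis - D" for c
  proof -
    have "\<forall>\<^sub>F z in nhds z0. R z \<bullet> c = z \<bullet> c" using R(2) that by (auto elim: eventually_mono)
    then have "frechet_derivative (\<lambda>z. R z \<bullet> c) (at z0) = frechet_derivative (\<lambda>z. z \<bullet> c) (at z0)"
      by (rule frechet_derivative_cong_nhds)
    moreover have "frechet_derivative (\<lambda>z. z \<bullet> c) (at z0) = (\<lambda>z. z \<bullet> c)"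
      by (rule frechet_derivative_eqI) (rule bounded_linear_imp_has_derivative[OF bounded_linear_inner_left])
    moreover have "frechet_derivative (\<lambda>z. R z \<bullet> c) (at z0) = (\<lambda>v. frechet_derivative R (at z0) v \<bullet> c)"
      by (rule frechet_derivative_eqI) (rule has_derivative_inner_left[OF smooth_at_has_derivative[OF Rs(1)]])
    ultimately show ?thesis using v[OF that] by metis
  qed
  have lin: "linear (frechet_derivative h (at z0))" by (rule smooth_at_linear_derivative[OF h(1)])
  have "frechet_derivative h (at z0) (\<Sum>b\<in>Basis. (?w \<bullet> b) *\<^sub>R b) =
      (\<Sum>b\<in>Basis. (?w \<bullet> b) *\<^sub>R frechet_derivative h (at z0) b)"
    by (simp only: linear_sum[OF lin] linear_cmul[OF lin])
  also have "\<dots> = 0"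
  proof (rule sum.neutral, rule ballI)
    show "(?w \<bullet> b) *\<^sub>R frechet_derivative h (at z0) b = 0" if "b \<in> Basis" for b
      using w[of b] h(2)[of b] that by (cases "b \<in> D") auto
  qed
  finally have "frechet_derivative h (at z0) ?w = 0" by (simp only: euclidean_representation)
  then show "frechet_derivative (\<lambda>z. h (R z)) (at z0) v = 0"
    using frechet_derivative_chain[OF Rs(1), of h v] h(1) Rs(2) by simp
qed

text \<open>A nonzero Hessian entry between unsplit variables yields an unsplit direction
  \<open>u\<close> with nonzero second derivative. A shear turns \<open>u\<close> into a coordinate
  direction, and \<open>morse_step\<close> splits this coordinate off without disturbing the squares
  found before.\<close>

lemma partial_splitting_improve:
  fixes h :: "'a::euclidean_space \<Rightarrow> real"
  assumes h: "smooth_at h z0" "\<And>b. b \<in> D \<Longrightarrow> frechet_derivative h (at z0) b = 0"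
    and D: "D \<subseteq> Basis" "\<And>b. b \<in> D \<Longrightarrow> z0 \<bullet> b = 0"
    and split: "partial_splitting h z0 D M e R R'"
    and bc: "b \<in> D - M" "c \<in> D - M"
      "frechet_derivative (\<lambda>z. frechet_derivative (\<lambda>z. h (R z)) (at z) c) (at z0) b \<noteq> 0"
  obtains i e' R1 R1' where "i \<in> D - M" "partial_splitting h z0 D (insert i M) e' R1 R1'"
proof -
  define f where "f z = h (R z)" for z
  have R: "M \<subseteq> D" "\<forall>b\<in>M. e b \<noteq> 0" "diffeo_germ z0 R R'"
    "\<forall>\<^sub>F z in nhds z0. \<forall>c\<in>Basis - D. R z \<bullet> c = z \<bullet> c"
    "\<forall>\<^sub>F z in nhds z0. f z = f (drop_coords M z) + (\<Sum>b\<in>M. e b * (z \<bullet> b)\<^sup>2)"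
    using split by (auto simp: partial_splitting_def f_def)
  have Rs: "smooth_at R z0" "R z0 = z0" using R(3) by (auto simp: diffeo_germ_def)
  have f: "smooth_at f z0"
    unfolding f_def using smooth_at_compose[OF Rs(1)] h(1) Rs(2) by simp
  let ?H = "\<lambda>v w. frechet_derivative (\<lambda>z. frechet_derivative f (at z) v) (at z0) w"
  have Hcb: "?H c b \<noteq> 0" using bc(3) by (simp add: f_def[abs_def])
  have MB: "M \<subseteq> Basis" by (rule subset_trans[OF R(1) D(1)])
  have fin: "finite M" by (rule finite_subset[OF MB finite_Basis])
  have Hadd: "?H v (w + w') = ?H v w + ?H v w'" for v w w'
    by (rule linear_add[OF smooth_at_linear_derivative[OF smooth_at_frechet_derivative[OF f]]])
  have Hsym: "?H v w = ?H w v" for v w by (rule symmetric_second_derivative[OF f])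
  \<comment> \<open>Polarisation: if both diagonal entries at \<open>b\<close> and \<open>c\<close>
    vanish, the quadratic form takes the value \<open>2 * ?H b c\<close> at \<open>b + c\<close>.
    Otherwise one of the two basis vectors serves as \<open>u\<close>.\<close>
  have "\<exists>i u. i \<in> D - M \<and> u \<bullet> i = 1 \<and> ?H u u \<noteq> 0 \<and> (\<forall>x\<in>Basis - (D - M). u \<bullet> x = 0)"
  proof (cases "?H b b = 0 \<and> ?H c c = 0")
    case True
    have ne: "b \<noteq> c" using True Hcb by auto
    have "?H (b + c) (b + c) = ?H b b + ?H c b + (?H b c + ?H c c)"
      using Hadd[of "b + c" b c] Hsym[of "b + c" b] Hsym[of "b + c" c] Hadd[of b b c]
        Hadd[of c b c] Hsym[of b c] by linarith
    then have "?H (b + c) (b + c) \<noteq> 0" using True Hcb Hsym[of b c] by linarith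
    moreover have B: "b \<in> Basis" "c \<in> Basis" using bc(1,2) D(1) by blast+
    then have "(b + c) \<bullet> b = 1" using ne by (simp add: inner_add_left inner_Basis)
    moreover have "(b + c) \<bullet> x = 0" if "x \<in> Basis - (D - M)" for x
    proof -
      have "b \<noteq> x" "c \<noteq> x" using that bc(1,2) by blast+
      then show ?thesis using that B by (simp add: inner_add_left inner_Basis)
    qed
    ultimately show ?thesis using bc(1) by blast
  next
    case False
    then obtain u where "u \<in> D - M" "?H u u \<noteq> 0" using bc by blast
    moreover have B: "u \<in> Basis" using \<open>u \<in> D - M\<close> D(1) by blast
    then have "u \<bullet> u = 1" by (simp add: inner_Basis)
    moreover have "u \<bullet> x = 0" if "x \<in> Basis - (D - M)" for x
    proof -
      have "u \<noteq> x" using that \<open>u \<in> D - M\<close> by blast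
      then show ?thesis using that B by (simp add: inner_Basis)
    qed
    ultimately show ?thesis by blast
  qed
  then obtain i u where iu: "i \<in> D - M" "u \<bullet> i = 1" "?H u u \<noteq> 0"
    "\<And>x. x \<in> Basis - (D - M) \<Longrightarrow> u \<bullet> x = 0" by blast
  have iB: "i \<in> Basis" using iu(1) D(1) by blast
  then have iB: "i \<in> Basis" "norm i = 1" "i \<bullet> i = 1" by (simp_all add: inner_Basis)
  have z0i: "z0 \<bullet> i = 0" using D(2) iu(1) by blast
  let ?P = "drop_coords M"
  have P: "bounded_linear ?P" "?P z0 = z0" "?P i = i" "\<And>z. ?P z \<bullet> i = z \<bullet> i" "\<And>z. ?P (?P z) = ?P z"
  proof -
    show "?P z0 = z0" using D(2) R(1) by (intro drop_coords_eq) blast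
    show "?P i = i" using iu(1) MB iB(1) by (intro drop_coords_eq) (auto simp: inner_Basis subset_iff)
    show "?P z \<bullet> i = z \<bullet> i" for z using iu(1) iB(1) by (simp add: inner_drop_coords[OF MB])
    show "?P (?P z) = ?P z" for z
      by (rule euclidean_eqI) (simp add: inner_drop_coords[OF MB])
  qed (rule bounded_linear_drop_coords)
  \<comment> \<open>The shear sends \<open>i\<close> to \<open>u\<close> and fixes the hyperplane
    orthogonal to \<open>i\<close>. As \<open>u - i\<close> has no components outside
    \<open>D - M\<close>, it commutes with \<open>?P\<close>.\<close>
  define L where "L z = z + (z \<bullet> i) *\<^sub>R (u - i)" for z
  define L' where "L' z = z - (z \<bullet> i) *\<^sub>R (u - i)" for z
  have L: "diffeo_germ z0 L L'"
    using shear_diffeo_germ[of "u - i" i z0] iu(2) iB(3) z0i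
    by (simp add: L_def[abs_def] L'_def[abs_def] inner_diff_left)
  have Lz0: "L z0 = z0" by (simp add: L_def z0i)
  have Lbl: "bounded_linear L"
    unfolding L_def[abs_def]
    by (intro bounded_linear_add bounded_linear_ident
        bounded_linear_compose[OF bounded_linear_scaleR_left bounded_linear_inner_left])
  have ui: "(u - i) \<bullet> x = 0" if "x \<in> Basis - (D - M)" for x
    using iu(1,4) that iB(1) by (auto simp: inner_diff_left inner_Basis)
  have PL: "?P (L z) = L (?P z)" for z
    by (rule euclidean_eqI) (use ui MB in \<open>auto simp: inner_drop_coords[OF MB] L_def inner_add_left P(4)\<close>)
  have LPs: "smooth_at (\<lambda>z. L (?P z)) z" for z
    by (intro smooth_at_linear bounded_linear_compose[OF Lbl P(1)])
  have LPD: "frechet_derivative (\<lambda>z. L (?P z)) (at z) i = u" for z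
    using frechet_derivative_eqI[OF bounded_linear_imp_has_derivative[OF bounded_linear_compose[OF Lbl P(1)]]]
    by (simp add: P(3) L_def iB(3))
  have LPz0: "L (?P z0) = z0" by (simp add: P(2) Lz0)
  \<comment> \<open>Inserting \<open>?P\<close> gives a function that ignores the coordinates in
    \<open>M\<close>, as \<open>morse_step\<close> demands. Its second derivative along
    \<open>i\<close> is that of \<open>f\<close> along \<open>u\<close>.\<close>
  define G where "G z = f (L (?P z))" for z
  have G: "smooth_at G z0"
    unfolding G_def using smooth_at_compose[OF LPs, of f z0] f LPz0 by simp
  have DG: "\<forall>\<^sub>F z in nhds z0. frechet_derivative G (at z) i = frechet_derivative f (at (L (?P z))) u"
    using smooth_at_eventually_compose[OF LPs, of "smooth_at f" z0, unfolded LPz0, OF smooth_at_eventually[OF f]]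
  proof eventually_elim
    case (elim z)
    show ?case unfolding G_def frechet_derivative_chain[OF LPs elim] LPD ..
  qed
  have "frechet_derivative f (at z0) u = 0"
    unfolding f_def using partial_splitting_derivative(2)[OF h R(3,4) D(1), of u] iu(4) by auto
  then have G1: "frechet_derivative G (at z0) i = 0"
    using eventually_nhds_x_imp_x[OF DG] LPz0 by simp
  have "frechet_derivative (\<lambda>z. frechet_derivative G (at z) i) (at z0) i = ?H u u"
    unfolding frechet_derivative_cong_nhds[OF DG]
    using frechet_derivative_chain[OF LPs, of "\<lambda>z. frechet_derivative f (at z) u" z0 i]
      smooth_at_frechet_derivative[OF f] by (simp add: LPz0 LPD)
  then have G2: "frechet_derivative (\<lambda>z. frechet_derivative G (at z) i) (at z0) i \<noteq> 0"
    using iu(3) by simp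
  have GP: "G (?P z) = G z" for z by (simp add: G_def P(5))
  obtain S S' e0 where S: "diffeo_germ z0 S S'" "e0 \<noteq> 0"
    "\<forall>\<^sub>F z in nhds z0. S z = z + (S z \<bullet> i - z \<bullet> i) *\<^sub>R i"
    "\<forall>\<^sub>F z in nhds z0. S (?P z) = ?P (S z)"
    "\<forall>\<^sub>F z in nhds z0. G (S z) = G (S (z - (z \<bullet> i) *\<^sub>R i)) + e0 * (z \<bullet> i)\<^sup>2"
    using morse_step[OF G G1 G2 iB(2) z0i P GP] by blast
  define T where "T z = L (S z)" for z
  have T: "diffeo_germ z0 T (\<lambda>z. S' (L' z))"
    unfolding T_def by (rule diffeo_germ_compose[OF L S(1)])
  have Sx: "\<forall>\<^sub>F z in nhds z0. \<forall>x\<in>Basis. x \<noteq> i \<longrightarrow> S z \<bullet> x = z \<bullet> x"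
    using S(3)
  proof eventually_elim
    case (elim z)
    have "(z + (S z \<bullet> i - z \<bullet> i) *\<^sub>R i) \<bullet> x = z \<bullet> x" if "x \<in> Basis" "x \<noteq> i" for x
      using that iB(1) by (simp add: inner_add_left inner_Basis)
    then show ?case using elim by metis
  qed
  have Tx: "\<forall>\<^sub>F z in nhds z0. \<forall>x\<in>Basis - (D - M). T z \<bullet> x = z \<bullet> x"
    using Sx
  proof eventually_elim
    case (elim z)
    show ?case
    proof
      fix x assume x: "x \<in> Basis - (D - M)"
      then have "x \<noteq> i" using iu(1) by blast
      then show "T z \<bullet> x = z \<bullet> x"
        using elim x ui[OF x] by (simp add: T_def L_def inner_add_left)
    qed
  qed
  let ?Q = "\<lambda>z. \<Sum>b\<in>M. e b * (z \<bullet> b)\<^sup>2"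
  \<comment> \<open>\<open>T\<close> fixes the coordinates in \<open>M\<close> and hence the old
    squares, while the rest of \<open>f\<close> becomes \<open>G \<circ> S\<close> because
    \<open>?P\<close> commutes with \<open>L\<close>.\<close>
  have fT: "\<forall>\<^sub>F z in nhds z0. f (T z) = G (S z) + ?Q z"
    using diffeo_germ_eventually_compose[OF T R(5)] Tx
  proof eventually_elim
    case (elim z)
    have "?Q (T z) = ?Q z"
      by (rule sum.cong) (use elim(2) MB in auto)
    moreover have "f (drop_coords M (T z)) = G (S z)"
      by (simp add: T_def PL G_def)
    ultimately show ?case using elim(1) by simp
  qed
  let ?M = "insert i M"
  have evk: "\<forall>\<^sub>F z in nhds z0. Q (drop_coords N z)" if "\<forall>\<^sub>F z in nhds z0. Q z" "N \<subseteq> D" for Q N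
  proof -
    have "drop_coords N z0 = z0" using D(2) that(2) by (intro drop_coords_eq) blast
    then show ?thesis
      using smooth_at_eventually_compose[OF smooth_at_linear[OF bounded_linear_drop_coords], of Q N z0] that(1) by simp
  qed
  have kM: "drop_coords ?M z = ?P (z - (z \<bullet> i) *\<^sub>R i)" for z
    using drop_coords_insert[OF fin MB iB(1)] iu(1) by simp
  have iM: "?M \<subseteq> D" and iD: "{i} \<subseteq> D" using iu(1) R(1) by blast+
  have ki: "drop_coords {i} z = z - (z \<bullet> i) *\<^sub>R i" for z by (simp add: drop_coords_def)
  \<comment> \<open>Compare \<open>fT\<close> at \<open>z\<close> with \<open>fT\<close> at the
    projected point. There the old squares vanish, and \<open>S\<close> commuting with
    \<open>?P\<close> together with the invariance of \<open>G\<close> leaves the first term of the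
    new splitting.\<close>
  have "\<forall>\<^sub>F z in nhds z0. f (T z) = f (T (drop_coords ?M z)) + (\<Sum>b\<in>?M. (e(i := e0)) b * (z \<bullet> b)\<^sup>2)"
    using fT evk[OF fT iM] S(5) evk[OF S(4) iD]
  proof eventually_elim
    case (elim z)
    have "?Q (drop_coords ?M z) = 0"
      using MB iB(1) by (intro sum.neutral ballI) (auto simp: inner_drop_coords subset_iff)
    moreover have "G (S (drop_coords ?M z)) = G (S (z - (z \<bullet> i) *\<^sub>R i))"
      using elim(4) by (simp add: kM ki GP)
    moreover have "(\<Sum>b\<in>?M. (e(i := e0)) b * (z \<bullet> b)\<^sup>2) = e0 * (z \<bullet> i)\<^sup>2 + ?Q z"
    proof -
      have "(\<Sum>b\<in>M. (e(i := e0)) b * (z \<bullet> b)\<^sup>2) = ?Q z" by (rule sum.cong) (use iu(1) in auto)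
      then show ?thesis using sum.insert[OF fin, of i "\<lambda>b. (e(i := e0)) b * (z \<bullet> b)\<^sup>2"] iu(1) by simp
    qed
    ultimately show ?case using elim(1-3) by simp
  qed
  moreover have "\<forall>\<^sub>F z in nhds z0. \<forall>c\<in>Basis - D. R (T z) \<bullet> c = z \<bullet> c"
    using diffeo_germ_eventually_compose[OF T R(4)] Tx by eventually_elim auto
  ultimately have "partial_splitting h z0 D ?M (e(i := e0)) (\<lambda>z. R (T z)) (\<lambda>z. S' (L' (R' z)))"
    unfolding partial_splitting_def f_def
    using R(1,2) iu(1) S(2) diffeo_germ_compose[OF R(3) T] by auto
  then show ?thesis using that iu(1) by blast
qed

text \<open>Take a splitting with as many separate squares as possible. By maximality the Hessian
  vanishes between unsplit variables; between an unsplit and a split variable it vanishes because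
  the latter occurs in its own square only.\<close>

theorem parametric_splitting:
  fixes h :: "'a::euclidean_space \<Rightarrow> real"
  assumes h: "smooth_at h z0" "\<And>b. b \<in> D \<Longrightarrow> frechet_derivative h (at z0) b = 0"
    and D: "D \<subseteq> Basis" "\<And>b. b \<in> D \<Longrightarrow> z0 \<bullet> b = 0"
  obtains M e R R' where "partial_splitting h z0 D M e R R'"
    "\<And>b c. b \<in> D - M \<Longrightarrow> c \<in> D \<Longrightarrow>
      frechet_derivative (\<lambda>z. frechet_derivative (\<lambda>z. h (R z)) (at z) c) (at z0) b = 0"
proof -
  define ok where "ok M \<longleftrightarrow> (\<exists>e R R'. partial_splitting h z0 D M e R R')" for M
  have "ok {}"
    by (auto simp: ok_def partial_splitting_def drop_coords_def diffeo_germ_id intro!: exI[of _ "\<lambda>z. z"])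
  moreover have fD: "finite D" by (rule finite_subset[OF D(1) finite_Basis])
  then have "\<forall>M. ok M \<longrightarrow> card M < Suc (card D)"
    by (auto simp: ok_def partial_splitting_def less_Suc_eq_le intro: card_mono)
  ultimately have "\<exists>M. ok M \<and> (\<forall>N. ok N \<longrightarrow> card N \<le> card M)"
    by (rule ex_has_greatest_nat)
  then obtain M where M: "ok M" "\<And>N. ok N \<Longrightarrow> card N \<le> card M" by blast
  from M(1) obtain e R R' where s: "partial_splitting h z0 D M e R R'" unfolding ok_def by blast
  have MD: "M \<subseteq> D" using s by (simp add: partial_splitting_def)
  then have fin: "finite M" by (rule finite_subset[OF _ fD])
  let ?f = "\<lambda>z. h (R z)"
  have f: "smooth_at ?f z0"
    using smooth_at_compose[of R z0 h] h(1) s by (auto simp: partial_splitting_def diffeo_germ_def)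
  have "frechet_derivative (\<lambda>z. frechet_derivative ?f (at z) c) (at z0) b = 0" if b: "b \<in> D - M" and c: "c \<in> D" for b c
  proof (cases "c \<in> M")
    case False
    show ?thesis
    proof (rule ccontr)
      assume "\<not> ?thesis"
      with partial_splitting_improve[OF h D s b, of c] False c
      obtain i e' R1 R1' where i: "i \<in> D - M" "partial_splitting h z0 D (insert i M) e' R1 R1'"
        by blast
      have "card (insert i M) \<le> card M" by (rule M(2)) (use i(2) in \<open>auto simp: ok_def\<close>)
      then show False using i(1) fin by simp
    qed
  next
    case True
    have MB: "M \<subseteq> Basis" using MD D(1) by blast
    have ev: "\<forall>\<^sub>F z in nhds z0. \<forall>\<^sub>F y in nhds z. ?f y = ?f (drop_coords M y) + (\<Sum>b\<in>M. e b * (y \<bullet> b)\<^sup>2)"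
      using s by (auto simp: partial_splitting_def eventually_eventually)
    have kz0: "drop_coords M z0 = z0" using D(2) MD by (intro drop_coords_eq) blast
    have sk: "smooth_at (drop_coords M) z" for z by (rule smooth_at_linear[OF bounded_linear_drop_coords])
    have "drop_coords M c = 0"
      by (rule euclidean_eqI) (use True MB in \<open>auto simp: inner_drop_coords inner_Basis\<close>)
    \<comment> \<open>As \<open>drop_coords M\<close> kills \<open>c\<close>, only the square of
      this coordinate contributes. The result does not vary in direction \<open>b\<close>, since
      \<open>b\<close> and \<open>c\<close> are different basis vectors.\<close>
    have "\<forall>\<^sub>F z in nhds z0. frechet_derivative ?f (at z) c = 2 * e c * (z \<bullet> c)"
      using ev smooth_at_eventually_compose[OF sk, of "smooth_at ?f" z0, unfolded kz0, OF smooth_at_eventually[OF f]]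
    proof eventually_elim
      case (elim z)
      have "((\<lambda>y. ?f (drop_coords M y)) has_derivative (\<lambda>v. frechet_derivative ?f (at (drop_coords M z)) (drop_coords M v))) (at z)"
        using has_derivative_compose[OF bounded_linear_imp_has_derivative[OF bounded_linear_drop_coords]
            smooth_at_has_derivative[OF elim(2)]] .
      moreover have "((\<lambda>y. \<Sum>b\<in>M. e b * (y \<bullet> b)\<^sup>2) has_derivative
          (\<lambda>v. \<Sum>b\<in>M. e b * (2 * (z \<bullet> b) * (v \<bullet> b)))) (at z)"
        by (auto intro!: derivative_eq_intros sum.cong)
      ultimately have "((\<lambda>y. ?f (drop_coords M y) + (\<Sum>b\<in>M. e b * (y \<bullet> b)\<^sup>2)) has_derivative
          (\<lambda>v. frechet_derivative ?f (at (drop_coords M z)) (drop_coords M v) + (\<Sum>b\<in>M. e b * (2 * (z \<bullet> b) * (v \<bullet> b))))) (at z)"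
        by (rule has_derivative_add)
      from frechet_derivative_eqI[OF this] frechet_derivative_cong_nhds[OF elim(1)]
      have "frechet_derivative ?f (at z) c = frechet_derivative ?f (at (drop_coords M z)) (drop_coords M c) +
          (\<Sum>b\<in>M. e b * (2 * (z \<bullet> b) * (c \<bullet> b)))" by simp
      also have "(\<Sum>b\<in>M. e b * (2 * (z \<bullet> b) * (c \<bullet> b))) = (\<Sum>b\<in>M. if b = c then 2 * e c * (z \<bullet> c) else 0)"
        using True MB by (intro sum.cong) (auto simp: inner_Basis subset_iff)
      also have "\<dots> = 2 * e c * (z \<bullet> c)" using True fin by simp
      finally show ?case
        by (simp add: \<open>drop_coords M c = 0\<close> linear_0[OF smooth_at_linear_derivative[OF elim(2)]])
    qed
    from frechet_derivative_cong_nhds[OF this]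
    have "frechet_derivative (\<lambda>z. frechet_derivative ?f (at z) c) (at z0) b = 2 * e c * (b \<bullet> c)"
      using frechet_derivative_eqI[OF bounded_linear_imp_has_derivative[OF
            bounded_linear_compose[OF bounded_linear_mult_right bounded_linear_inner_left]], of "2 * e c" c z0]
      by simp
    then show ?thesis using b True MB D(1) by (auto simp: inner_Basis subset_iff)
  qed
  then show ?thesis using that s by blast
qed

section \<open>The normal form with a globally defined reduced function\<close>

lemma open_iff_eventually: "open S \<longleftrightarrow> (\<forall>x\<in>S. \<forall>\<^sub>F y in nhds x. y \<in> S)"
  unfolding eventually_nhds subset_eq[symmetric] by (rule open_subopen)

text \<open>In general a term pairing the first derivative of \<open>h\<close> with the second
  derivative of \<open>R\<close> appears. Here it vanishes: \<open>h\<close> is critical in the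
  directions of \<open>D\<close>, and in the other directions \<open>R\<close> agrees with the
  identity and has no second derivative.\<close>

lemma second_derivative_compose_critical:
  fixes h :: "'a::euclidean_space \<Rightarrow> real"
  assumes h: "smooth_at h z0" "\<And>b. b \<in> D \<Longrightarrow> frechet_derivative h (at z0) b = 0"
    and R: "diffeo_germ z0 R R'" "\<forall>\<^sub>F z in nhds z0. \<forall>c\<in>Basis - D. R z \<bullet> c = z \<bullet> c"
  shows "frechet_derivative (\<lambda>z. frechet_derivative (\<lambda>z. h (R z)) (at z) c) (at z0) b =
    frechet_derivative (\<lambda>z. frechet_derivative h (at z) (frechet_derivative R (at z0) c)) (at z0)
      (frechet_derivative R (at z0) b)"
proof -
  have Rs: "smooth_at R z0" "R z0 = z0" using R(1) by (auto simp: diffeo_germ_def)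
  let ?R = "\<lambda>z. frechet_derivative R (at z) c" and ?h = "\<lambda>x z. frechet_derivative h (at z) x"
  let ?b = "frechet_derivative R (at z0) b"
  \<comment> \<open>The chain rule yields a direction that moves with the base point. Expanding it
    in the basis makes the product rule applicable.\<close>
  have lin: "frechet_derivative h (at z) w = (\<Sum>x\<in>Basis. (w \<bullet> x) * ?h x z)" if "smooth_at h z" for z w
  proof -
    have l: "linear (frechet_derivative h (at z))" by (rule smooth_at_linear_derivative[OF that])
    have "frechet_derivative h (at z) (\<Sum>x\<in>Basis. (w \<bullet> x) *\<^sub>R x) = (\<Sum>x\<in>Basis. (w \<bullet> x) * ?h x z)"
      by (simp only: linear_sum[OF l] linear_cmul[OF l] real_scaleR_def)
    then show ?thesis by (simp only: euclidean_representation)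
  qed
  have "\<forall>\<^sub>F z in nhds z0. frechet_derivative (\<lambda>z. h (R z)) (at z) c = (\<Sum>x\<in>Basis. (?R z \<bullet> x) * ?h x (R z))"
    using smooth_at_eventually[OF Rs(1)] diffeo_germ_eventually_compose[OF R(1) smooth_at_eventually[OF h(1)]]
  proof eventually_elim
    case (elim z)
    show ?case unfolding frechet_derivative_chain[OF elim] by (rule lin[OF elim(2)])
  qed
  from frechet_derivative_cong_nhds[OF this]
  have "frechet_derivative (\<lambda>z. frechet_derivative (\<lambda>z. h (R z)) (at z) c) (at z0) b =
    frechet_derivative (\<lambda>z. \<Sum>x\<in>Basis. (?R z \<bullet> x) * ?h x (R z)) (at z0) b" by (rule fun_cong)
  also have "\<dots> = (\<Sum>x\<in>Basis. (?R z0 \<bullet> x) * frechet_derivative (?h x) (at z0) ?b)"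
  proof -
    have dR: "((\<lambda>z. ?R z \<bullet> x) has_derivative (\<lambda>v. frechet_derivative ?R (at z0) v \<bullet> x)) (at z0)" for x
      by (rule has_derivative_inner_left[OF smooth_at_has_derivative[OF smooth_at_frechet_derivative[OF Rs(1)]]])
    have dh: "((\<lambda>z. ?h x (R z)) has_derivative
        (\<lambda>v. frechet_derivative (?h x) (at z0) (frechet_derivative R (at z0) v))) (at z0)" for x
      using has_derivative_compose[OF smooth_at_has_derivative[OF Rs(1)]]
        smooth_at_has_derivative[OF smooth_at_frechet_derivative[OF h(1), of x]] unfolding Rs(2) by blast
    have zero: "(frechet_derivative ?R (at z0) b \<bullet> x) * ?h x z0 = 0" if x: "x \<in> Basis" for x
    proof (cases "x \<in> D")
      case False
      have "\<forall>\<^sub>F z in nhds z0. ?R z \<bullet> x = c \<bullet> x"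
        using R(2)[THEN iffD2[OF eventually_eventually]] smooth_at_eventually[OF Rs(1)]
      proof eventually_elim
        case (elim z)
        have "\<forall>\<^sub>F y in nhds z. R y \<bullet> x = y \<bullet> x"
          by (rule eventually_mono[OF elim(1)]) (use x False in auto)
        then have "frechet_derivative (\<lambda>y. R y \<bullet> x) (at z) = frechet_derivative (\<lambda>y. y \<bullet> x) (at z)"
          by (rule frechet_derivative_cong_nhds)
        moreover have "frechet_derivative (\<lambda>y. y \<bullet> x) (at z) = (\<lambda>y. y \<bullet> x)"
          by (rule frechet_derivative_eqI) (rule bounded_linear_imp_has_derivative[OF bounded_linear_inner_left])
        moreover have "frechet_derivative (\<lambda>y. R y \<bullet> x) (at z) = (\<lambda>v. frechet_derivative R (at z) v \<bullet> x)"
          by (rule frechet_derivative_eqI) (rule has_derivative_inner_left[OF smooth_at_has_derivative[OF elim(2)]])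
        ultimately show ?case by metis
      qed
      from frechet_derivative_cong_nhds[OF this]
      have "(\<lambda>v. frechet_derivative ?R (at z0) v \<bullet> x) = (\<lambda>v. 0)"
        unfolding frechet_derivative_eqI[OF dR] frechet_derivative_eqI[OF has_derivative_const] .
      then show ?thesis by (metis mult_zero_left)
    qed (simp add: h(2))
    have "((\<lambda>z. \<Sum>x\<in>Basis. (?R z \<bullet> x) * ?h x (R z)) has_derivative
       (\<lambda>v. \<Sum>x\<in>Basis. (?R z0 \<bullet> x) * frechet_derivative (?h x) (at z0) (frechet_derivative R (at z0) v) +
          (frechet_derivative ?R (at z0) v \<bullet> x) * ?h x (R z0))) (at z0)"
      by (intro has_derivative_sum has_derivative_mult dR dh)
    from fun_cong[OF frechet_derivative_eqI[OF this], of b]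
    show ?thesis unfolding Rs(2) by (simp add: zero cong: sum.cong)
  qed
  also have "\<dots> = frechet_derivative (?h (?R z0)) (at z0) ?b"
  proof -
    have "\<forall>\<^sub>F z in nhds z0. ?h (?R z0) z = (\<Sum>x\<in>Basis. (?R z0 \<bullet> x) * ?h x z)"
      using smooth_at_eventually[OF h(1)] by eventually_elim (rule lin)
    then have A: "frechet_derivative (?h (?R z0)) (at z0) = frechet_derivative (\<lambda>z. \<Sum>x\<in>Basis. (?R z0 \<bullet> x) * ?h x z) (at z0)"
      by (rule frechet_derivative_cong_nhds)
    have B: "((\<lambda>z. \<Sum>x\<in>Basis. (?R z0 \<bullet> x) * ?h x z) has_derivative
        (\<lambda>v. \<Sum>x\<in>Basis. (?R z0 \<bullet> x) * frechet_derivative (?h x) (at z0) v)) (at z0)"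
      by (intro has_derivative_sum has_derivative_mult_right
          smooth_at_has_derivative[OF smooth_at_frechet_derivative[OF h(1)]])
    show ?thesis by (rule fun_cong[OF trans[OF A frechet_derivative_eqI[OF B]], symmetric])
  qed
  finally show ?thesis .
qed

text \<open>The map \<open>squash r \<pi>\<close> is a diffeomorphism germ at \<open>0\<close> that compresses the range of the
  projection \<open>\<pi>\<close> into the ball of radius \<open>r\<close>. Composing with it turns a function
  defined near \<open>0\<close> only into a globally defined one, without cut-off functions.\<close>

definition squash :: "real \<Rightarrow> ('a::euclidean_space \<Rightarrow> 'a) \<Rightarrow> 'a \<Rightarrow> 'a" where
  "squash r \<pi> t = (r * inverse (sqrt (1 + \<pi> t \<bullet> \<pi> t))) *\<^sub>R \<pi> t + (t - \<pi> t)"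

text \<open>Solves \<open>x = (r / sqrt (1 + y \<bullet> y)) *\<^sub>R y\<close> for
  \<open>y\<close>, where \<open>x\<close> and \<open>y\<close> are the projections: then
  \<open>1 + y \<bullet> y\<close> equals \<open>r\<^sup>2 / (r\<^sup>2 - x \<bullet> x)\<close>.
  The formula inverts \<open>squash\<close> where the projection has norm less than
  \<open>r\<close>, in particular near 0.\<close>

definition unsquash :: "real \<Rightarrow> ('a::euclidean_space \<Rightarrow> 'a) \<Rightarrow> 'a \<Rightarrow> 'a" where
  "unsquash r \<pi> t = inverse (sqrt (r\<^sup>2 - \<pi> t \<bullet> \<pi> t)) *\<^sub>R \<pi> t + (t - \<pi> t)"

lemma squash:
  fixes \<pi> :: "'a::euclidean_space \<Rightarrow> 'a"
  assumes \<pi>: "bounded_linear \<pi>" "\<And>t. \<pi> (\<pi> t) = \<pi> t" and r: "r > 0"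
  shows smooth_at_squash: "smooth_at (squash r \<pi>) t"
    and proj_squash: "\<pi> (squash r \<pi> t) = squash r \<pi> (\<pi> t)"
    and norm_squash_proj: "norm (squash r \<pi> (\<pi> t)) < r"
    and diffeo_germ_squash: "diffeo_germ 0 (squash r \<pi>) (unsquash r \<pi>)"
proof -
  have lin: "linear \<pi>" using \<pi>(1) by (rule bounded_linear.linear)
  note [simp] = linear_add[OF lin] linear_diff[OF lin] linear_cmul[OF lin] \<pi>(2) linear_0[OF lin]
  have pos: "1 + \<pi> t \<bullet> \<pi> t > 0" for t by (intro add_pos_nonneg) auto
  have \<pi>s: "smooth_at \<pi> t" for t by (rule smooth_at_linear[OF \<pi>(1)])
  have diff: "smooth_at (\<lambda>t. t - \<pi> t) t" for t
    by (rule smooth_at_diff[OF smooth_at_linear[OF bounded_linear_ident] \<pi>s])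
  show sm: "smooth_at (squash r \<pi>) t" for t
    unfolding squash_def[abs_def] using pos[of t]
    by (intro smooth_at_add[OF _ diff] smooth_at_scaleR[OF _ \<pi>s] smooth_at_mult[OF smooth_at_const]
        smooth_at_inverse smooth_at_sqrt smooth_at_add[OF smooth_at_const] smooth_at_inner \<pi>s) auto
  show "\<pi> (squash r \<pi> t) = squash r \<pi> (\<pi> t)" by (simp add: squash_def)
  have "(norm (squash r \<pi> (\<pi> t)))\<^sup>2 = r\<^sup>2 * ((\<pi> t \<bullet> \<pi> t) / (1 + \<pi> t \<bullet> \<pi> t))"
    using pos[of t] by (simp add: squash_def power2_norm_eq_inner power_mult_distrib power_inverse field_simps
        flip: power2_eq_square)
  also have "\<dots> < r\<^sup>2 * 1"
    using pos[of t] r by (intro mult_strict_left_mono) (auto simp: field_simps)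
  finally show "norm (squash r \<pi> (\<pi> t)) < r"
    using r by (auto intro: power2_less_imp_less)
  have usm: "smooth_at (unsquash r \<pi>) 0"
    unfolding unsquash_def[abs_def] using r
    by (intro smooth_at_add[OF _ diff] smooth_at_scaleR[OF _ \<pi>s]
        smooth_at_inverse smooth_at_sqrt smooth_at_diff[OF smooth_at_const] smooth_at_inner \<pi>s) auto
  have "unsquash r \<pi> (squash r \<pi> t) = t" for t
  proof -
    define a where "a = sqrt (1 + \<pi> t \<bullet> \<pi> t)"
    have a: "a > 0" "a\<^sup>2 = 1 + \<pi> t \<bullet> \<pi> t" using pos[of t] by (auto simp: a_def)
    have "r\<^sup>2 - \<pi> (squash r \<pi> t) \<bullet> \<pi> (squash r \<pi> t) = r\<^sup>2 - (r * inverse a)\<^sup>2 * (a\<^sup>2 - 1)"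
      using a(2) by (simp add: squash_def a_def[symmetric] power2_eq_square)
    also have "\<dots> = (r * inverse a)\<^sup>2" using a(1) by (simp add: field_simps power2_eq_square)
    finally have "sqrt (r\<^sup>2 - \<pi> (squash r \<pi> t) \<bullet> \<pi> (squash r \<pi> t)) = r * inverse a"
      using a(1) r by (simp add: real_sqrt_abs)
    moreover obtain k where k: "r * inverse a = k" "k \<noteq> 0" using a(1) r by force
    ultimately have s: "sqrt (r\<^sup>2 - \<pi> (squash r \<pi> t) \<bullet> \<pi> (squash r \<pi> t)) = k" by (simp only:)
    have p: "\<pi> (squash r \<pi> t) = k *\<^sub>R \<pi> t" "squash r \<pi> t = k *\<^sub>R \<pi> t + (t - \<pi> t)"
      by (simp_all add: squash_def a_def[symmetric] k(1))
    show ?thesis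
      unfolding unsquash_def s unfolding p(1) unfolding p(2) using k(2) by simp
  qed
  moreover have "\<forall>\<^sub>F x in nhds 0. squash r \<pi> (unsquash r \<pi> x) = x"
  proof -
    have "isCont (\<lambda>x. r\<^sup>2 - \<pi> x \<bullet> \<pi> x) 0"
      by (intro smooth_at_isCont smooth_at_diff[OF smooth_at_const] smooth_at_inner \<pi>s)
    then have "\<forall>\<^sub>F x in nhds 0. r\<^sup>2 - \<pi> x \<bullet> \<pi> x > 0"
      using order_tendstoD(1)[of "\<lambda>x. r\<^sup>2 - \<pi> x \<bullet> \<pi> x" "r\<^sup>2" "nhds 0" 0] r
        tendsto_at_iff_tendsto_nhds[of "\<lambda>x. r\<^sup>2 - \<pi> x \<bullet> \<pi> x" 0] by (simp add: isCont_def)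
    then show ?thesis
    proof eventually_elim
      case (elim x)
      define a where "a = sqrt (r\<^sup>2 - \<pi> x \<bullet> \<pi> x)"
      have a: "a > 0" "a\<^sup>2 = r\<^sup>2 - \<pi> x \<bullet> \<pi> x" using elim by (auto simp: a_def)
      have p: "\<pi> (unsquash r \<pi> x) = inverse a *\<^sub>R \<pi> x"
        "unsquash r \<pi> x = inverse a *\<^sub>R \<pi> x + (x - \<pi> x)"
        by (simp_all add: unsquash_def a_def[symmetric])
      have "1 + \<pi> (unsquash r \<pi> x) \<bullet> \<pi> (unsquash r \<pi> x) = 1 + (inverse a)\<^sup>2 * (r\<^sup>2 - a\<^sup>2)"
        unfolding p(1) a(2) by (simp add: power2_eq_square)
      also have "\<dots> = (r * inverse a)\<^sup>2" using a(1) by (simp add: field_simps power2_eq_square)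
      finally have s: "sqrt (1 + \<pi> (unsquash r \<pi> x) \<bullet> \<pi> (unsquash r \<pi> x)) = r * inverse a"
        using a(1) r by (simp add: real_sqrt_abs)
      have "r * inverse (r * inverse a) * inverse a = 1" using a(1) r by (simp add: field_simps)
      then have "(r * inverse (r * inverse a)) *\<^sub>R inverse a *\<^sub>R \<pi> x = \<pi> x"
        by (metis scaleR_one scaleR_scaleR)
      then show ?case unfolding squash_def s unfolding p(1) unfolding p(2) by (simp only:) simp
    qed
  qed
  ultimately show "diffeo_germ 0 (squash r \<pi>) (unsquash r \<pi>)"
    using sm usm by (simp add: diffeo_germ_def) (simp add: squash_def unsquash_def)
qed

lemma diffeo_germ_snd:
  assumes "diffeo_germ t S S'"
  shows "diffeo_germ (\<mu>, t) (\<lambda>z. (fst z, S (snd z))) (\<lambda>z. (fst z, S' (snd z)))"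
proof -
  have s: "smooth_at (\<lambda>z. (fst z, S (snd z))) (\<mu>, t)" if "smooth_at S t" for S
    using that smooth_at_compose[OF smooth_at_linear[OF bounded_linear_snd], of S "(\<mu>, t)"]
    by (intro smooth_at_Pair smooth_at_linear[OF bounded_linear_fst]) simp
  have e: "\<forall>\<^sub>F z in nhds (\<mu>, t). Q (snd z)" if "\<forall>\<^sub>F y in nhds t. Q y" for Q
    using smooth_at_eventually_compose[OF smooth_at_linear[OF bounded_linear_snd], of Q "(\<mu>, t)"] that by simp
  show ?thesis
    using assms unfolding diffeo_germ_def
    by (auto intro!: s dest!: e elim: eventually_mono)
qed

text \<open>\<open>V\<close> is the derivative, in the variable directions, of the splitting change
  of coordinates. It is part of the conclusion because it carries the unsplit basis vectors into the
  kernel of the Hessian of the original \<open>h\<close>, which is the Hessian with a geometric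
  meaning.\<close>

theorem parametric_normal_form:
  fixes h :: "'p::euclidean_space \<times> 'a::euclidean_space \<Rightarrow> real"
  assumes h: "smooth_at h (\<mu>s, 0)" "\<And>v. frechet_derivative h (at (\<mu>s, 0)) (0, v) = 0"
    and N: "open N" "(\<mu>s, 0) \<in> N"
  obtains M :: "'a set" and e J T \<theta> \<theta>' g V where
    "M \<subseteq> Basis" "\<And>b. b \<in> M \<Longrightarrow> e b \<noteq> 0" "open J" "\<mu>s \<in> J" "open T" "0 \<in> T"
    "\<theta> \<mu>s 0 = 0" "\<And>\<mu> t. \<mu> \<in> J \<Longrightarrow> t \<in> T \<Longrightarrow> (\<mu>, \<theta> \<mu> t) \<in> N"
    "smooth_on (\<lambda>(\<mu>, t). \<theta> \<mu> t) (J \<times> T)"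
    "\<And>\<mu> t. \<mu> \<in> J \<Longrightarrow> t \<in> T \<Longrightarrow> \<theta>' \<mu> (\<theta> \<mu> t) = t"
    "\<And>\<mu>. \<mu> \<in> J \<Longrightarrow> open (\<theta> \<mu> ` T)" "\<And>\<mu>. \<mu> \<in> J \<Longrightarrow> smooth_on (\<theta>' \<mu>) (\<theta> \<mu> ` T)"
    "smooth_on (\<lambda>(\<mu>, t). g \<mu> t) (J \<times> UNIV)"
    "\<And>\<mu> s t. (\<And>b. b \<in> Basis - M \<Longrightarrow> s \<bullet> b = t \<bullet> b) \<Longrightarrow> g \<mu> s = g \<mu> t"
    "\<And>\<mu> t. \<mu> \<in> J \<Longrightarrow> t \<in> T \<Longrightarrow> h (\<mu>, \<theta> \<mu> t) = g \<mu> t + (\<Sum>b\<in>M. e b * (t \<bullet> b)\<^sup>2)"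
    "linear V" "inj V"
    "\<And>b w. b \<in> Basis - M \<Longrightarrow>
       frechet_derivative (\<lambda>z. frechet_derivative h (at z) (0, w)) (at (\<mu>s, 0)) (0, V b) = 0"
proof -
  let ?z = "(\<mu>s, 0 :: 'a)"
  \<comment> \<open>Only the variable coordinates are free to change; the basis vectors outside
    \<open>D\<close> span the parameter space.\<close>
  define D :: "('p \<times> 'a) set" where "D = Pair 0 ` Basis"
  have D: "D \<subseteq> Basis" by (auto simp: D_def Basis_prod_def)
  have BD: "Basis - D = (\<lambda>u. (u, 0)) ` Basis" by (auto simp: D_def Basis_prod_def)
  have D0: "?z \<bullet> b = 0" if "b \<in> D" for b using that by (auto simp: D_def)
  have hD: "frechet_derivative h (at ?z) b = 0" if "b \<in> D" for b using that h(2) by (auto simp: D_def)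
  obtain MM ee R R' where split: "partial_splitting h ?z D MM ee R R'" and
    kernel: "\<And>b c. b \<in> D - MM \<Longrightarrow> c \<in> D \<Longrightarrow>
      frechet_derivative (\<lambda>z. frechet_derivative (\<lambda>z. h (R z)) (at z) c) (at ?z) b = 0"
    using parametric_splitting[OF h(1) hD D D0] by blast
  define M where "M = {b. (0, b) \<in> MM}"
  define e where "e b = ee (0, b)" for b :: 'a
  have MM: "MM = Pair 0 ` M" and MB: "M \<subseteq> Basis"
    using split by (auto simp: partial_splitting_def D_def M_def)
  have e0: "e b \<noteq> 0" if "b \<in> M" for b using split that by (auto simp: partial_splitting_def M_def e_def)
  have R: "diffeo_germ ?z R R'" "\<forall>\<^sub>F z in nhds ?z. \<forall>c\<in>Basis - D. R z \<bullet> c = z \<bullet> c"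
    using split by (auto simp: partial_splitting_def)
  have Rfst: "\<forall>\<^sub>F z in nhds ?z. fst (R z) = fst z"
    using R(2)
  proof eventually_elim
    case (elim z)
    show ?case
    proof (rule euclidean_eqI)
      fix u :: 'p assume "u \<in> Basis"
      then have "R z \<bullet> (u, 0) = z \<bullet> (u, 0)" using elim BD by blast
      then show "fst (R z) \<bullet> u = fst z \<bullet> u" by (simp add: inner_prod_def)
    qed
  qed
  have drop_coords: "drop_coords MM (\<mu>, t) = (\<mu>, drop_coords M t)" for \<mu> and t :: 'a
  proof -
    have "(\<Sum>b\<in>MM. ((\<mu>, t) \<bullet> b) *\<^sub>R b) = (\<Sum>b\<in>M. (0, (t \<bullet> b) *\<^sub>R b))"
      unfolding MM by (subst sum.reindex) (simp_all add: inj_on_def)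
    then show ?thesis unfolding drop_coords_def by (simp add: prod_eq_iff fst_sum snd_sum)
  qed
  have quad: "(\<Sum>b\<in>MM. ee b * (z \<bullet> b)\<^sup>2) = (\<Sum>b\<in>M. e b * (snd z \<bullet> b)\<^sup>2)" for z :: "'p \<times> 'a"
    unfolding MM by (subst sum.reindex) (simp_all add: inj_on_def e_def inner_prod_def)
  have Rs: "smooth_at R ?z" "R ?z = ?z" using R(1) by (auto simp: diffeo_germ_def)
  let ?\<pi> = "drop_coords M"
  have \<pi>: "bounded_linear ?\<pi>" "\<And>t. ?\<pi> (?\<pi> t) = ?\<pi> t"
    by (rule bounded_linear_drop_coords) (rule euclidean_eqI, simp add: inner_drop_coords[OF MB])

  \<comment> \<open>All that is used about \<open>R\<close> at a single point. It has to hold on a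
    full ball, because the radius of that ball is fed into \<open>squash\<close>.\<close>
  let ?good = "\<lambda>z. smooth_at R z \<and> smooth_at h (R z) \<and> R z \<in> N \<and> fst (R z) = fst z \<and>
    h (R z) = h (R (drop_coords MM z)) + (\<Sum>b\<in>MM. ee b * (z \<bullet> b)\<^sup>2)"
  have "\<forall>\<^sub>F z in nhds ?z. z \<in> N" using N by (auto simp: eventually_nhds)
  from diffeo_germ_eventually_compose[OF R(1) this] have "\<forall>\<^sub>F z in nhds ?z. R z \<in> N" .
  moreover have "\<forall>\<^sub>F z in nhds ?z. h (R z) = h (R (drop_coords MM z)) + (\<Sum>b\<in>MM. ee b * (z \<bullet> b)\<^sup>2)"
    using split by (simp add: partial_splitting_def)
  ultimately have "\<forall>\<^sub>F z in nhds ?z. ?good z"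
    using smooth_at_eventually[OF Rs(1)] Rfst
      diffeo_germ_eventually_compose[OF R(1) smooth_at_eventually[OF h(1)]]
    by eventually_elim auto
  then obtain S where S: "open S" "?z \<in> S" "\<And>z. z \<in> S \<Longrightarrow> ?good z" unfolding eventually_nhds by blast
  obtain J1 B1 where J1: "open J1" "open B1" "?z \<in> J1 \<times> B1" "J1 \<times> B1 \<subseteq> S" using open_prod_elim[OF S(1,2)] by metis
  then obtain r where r: "r > 0" "ball 0 r \<subseteq> B1" using open_contains_ball[of B1] by auto
  have good: "?good (\<mu>, t)" if "\<mu> \<in> J1" "norm t < r" for \<mu> t
    by (rule S(3)) (use that J1(4) r(2) in auto)

  define \<rho> where "\<rho> = squash r ?\<pi>"
  note \<rho> = smooth_at_squash[OF \<pi> r(1), folded \<rho>_def] proj_squash[OF \<pi> r(1), folded \<rho>_def]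
    norm_squash_proj[OF \<pi> r(1), folded \<rho>_def] diffeo_germ_squash[OF \<pi> r(1), folded \<rho>_def]
  define W where "W z = R (fst z, \<rho> (snd z))" for z
  define W' where "W' z = (\<lambda>z. (fst z, unsquash r ?\<pi> (snd z))) (R' z)" for z
  have W: "diffeo_germ ?z W W'"
    unfolding W_def[abs_def] W'_def[abs_def] by (rule diffeo_germ_compose[OF R(1) diffeo_germ_snd[OF \<rho>(4)]])
  have Ws: "smooth_at W ?z" "smooth_at W' ?z" "W ?z = ?z" using W by (auto simp: diffeo_germ_def)
  \<comment> \<open>Collected at every point of a product neighbourhood, so that for each fixed
    parameter the map \<open>\<theta> \<mu>\<close> has an open image and a smooth inverse.\<close>
  let ?ok = "\<lambda>z. smooth_at W z \<and> smooth_at W' (W z) \<and> W' (W z) = z \<and>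
    (\<forall>\<^sub>F w in nhds (W z). W (W' w) = w) \<and> fst z \<in> J1 \<and> norm (\<rho> (snd z)) < r"
  have "\<forall>\<^sub>F w in nhds ?z. \<forall>\<^sub>F w' in nhds w. W (W' w') = w'"
    using W by (simp add: diffeo_germ_def eventually_eventually)
  from diffeo_germ_eventually_compose[OF W this]
  have "\<forall>\<^sub>F z in nhds ?z. \<forall>\<^sub>F w in nhds (W z). W (W' w) = w" .
  moreover have "\<forall>\<^sub>F z in nhds ?z. fst z \<in> J1 \<and> norm (\<rho> (snd z)) < r"
  proof -
    have "\<forall>\<^sub>F z in nhds ?z. z \<in> J1 \<times> ball 0 r"
      using J1(1,3) r(1) open_Times[OF J1(1) open_ball] unfolding eventually_nhds
      by (intro exI[of _ "J1 \<times> ball 0 r"]) auto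
    from diffeo_germ_eventually_compose[OF diffeo_germ_snd[OF \<rho>(4)] this] show ?thesis
      by eventually_elim simp
  qed
  moreover have "\<forall>\<^sub>F z in nhds ?z. W' (W z) = z" using W by (simp add: diffeo_germ_def)
  ultimately have "\<forall>\<^sub>F z in nhds ?z. ?ok z"
    using smooth_at_eventually[OF Ws(1)] diffeo_germ_eventually_compose[OF W smooth_at_eventually[OF Ws(2)]]
    by eventually_elim auto
  then obtain S' where S': "open S'" "?z \<in> S'" "\<And>z. z \<in> S' \<Longrightarrow> ?ok z" unfolding eventually_nhds by blast
  obtain J T where JT: "open J" "open T" "?z \<in> J \<times> T" "J \<times> T \<subseteq> S'" using open_prod_elim[OF S'(1,2)] by metis
  have ok: "?ok (\<mu>, t)" if "\<mu> \<in> J" "t \<in> T" for \<mu> t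
    by (rule S'(3)) (use that JT(4) in auto)
  have J1J: "\<mu> \<in> J1" if "\<mu> \<in> J" for \<mu>
    using ok[OF that, of 0] JT(3) by auto
  define \<theta> where "\<theta> \<mu> t = snd (W (\<mu>, t))" for \<mu> t
  define \<theta>' where "\<theta>' \<mu> x = snd (W' (\<mu>, x))" for \<mu> x
  have goodW: "?good (\<mu>, \<rho> t)" if "\<mu> \<in> J" "t \<in> T" for \<mu> t
    using good ok[OF that] by simp
  have W\<theta>: "W (\<mu>, t) = (\<mu>, \<theta> \<mu> t)" if "\<mu> \<in> J" "t \<in> T" for \<mu> t
    using goodW[OF that] by (simp add: W_def \<theta>_def prod_eq_iff)
  have W'\<theta>: "smooth_at W' (\<mu>, \<theta> \<mu> t)" "W' (\<mu>, \<theta> \<mu> t) = (\<mu>, t)"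
    "\<forall>\<^sub>F w in nhds (\<mu>, \<theta> \<mu> t). W (W' w) = w" if "\<mu> \<in> J" "t \<in> T" for \<mu> t
    using ok[OF that] unfolding W\<theta>[OF that] by auto
  have pair: "smooth_at (Pair \<mu>) x" for \<mu> :: 'p and x :: 'a
    by (rule smooth_at_Pair[OF smooth_at_const smooth_at_linear[OF bounded_linear_ident]])
  \<comment> \<open>The projection removes the dependence on the coordinates in \<open>M\<close>.
    For every \<open>t\<close> the squeezed point \<open>\<rho> (?\<pi> t)\<close> lies in the ball
    of radius \<open>r\<close>, so \<open>g\<close> is smooth on the whole space.\<close>
  define g where "g \<mu> t = h (R (\<mu>, \<rho> (?\<pi> t)))" for \<mu> t
  have V0: "fst (frechet_derivative R (at ?z) (0, v)) = 0" for v
  proof (rule euclidean_eqI)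
    fix u :: 'p assume u: "u \<in> Basis"
    have "frechet_derivative R (at ?z) (0, v) \<bullet> (u, 0) = 0"
      by (rule partial_splitting_derivative(1)[OF h(1) hD R D]) (use u in \<open>auto simp: BD\<close>)
    then show "fst (frechet_derivative R (at ?z) (0, v)) \<bullet> u = 0 \<bullet> u" by (simp add: inner_prod_def)
  qed
  define V where "V v = snd (frechet_derivative R (at ?z) (0, v))" for v
  have RV: "frechet_derivative R (at ?z) (0, v) = (0, V v)" for v
    using V0[of v] by (simp add: V_def prod_eq_iff)
  have linR: "linear (frechet_derivative R (at ?z))" by (rule smooth_at_linear_derivative[OF Rs(1)])
  have linV: "linear V"
    unfolding V_def[abs_def]
    by (intro linear_compose[unfolded o_def, OF linear_compose[unfolded o_def, OF _ linR]]
        bounded_linear.linear bounded_linear_snd bounded_linear_Pair bounded_linear_zero bounded_linear_ident)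
  have injV: "inj V"
  proof (rule injI)
    fix v w assume "V v = V w"
    then have "frechet_derivative R (at ?z) (0, v) = frechet_derivative R (at ?z) (0, w)" by (simp add: RV)
    then show "v = w" using diffeo_germ_derivative_inverse[OF R(1)] by (metis snd_conv)
  qed
  show ?thesis
  proof (rule that[of M e J T \<theta> \<theta>' g V])
    show "M \<subseteq> Basis" by (rule MB)
    show "e b \<noteq> 0" if "b \<in> M" for b by (rule e0[OF that])
    show "open J" "\<mu>s \<in> J" "open T" "0 \<in> T" using JT by auto
    show "\<theta> \<mu>s 0 = 0" by (simp add: \<theta>_def Ws(3))
    show "(\<mu>, \<theta> \<mu> t) \<in> N" if "\<mu> \<in> J" "t \<in> T" for \<mu> t
      using goodW[OF that] W\<theta>[OF that] by (simp add: W_def)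
    show "smooth_on (\<lambda>(\<mu>, t). \<theta> \<mu> t) (J \<times> T)"
      unfolding smooth_at_iff[OF open_Times[OF JT(1,2)]] \<theta>_def
      using ok by (auto simp: case_prod_unfold intro!: smooth_at_linear_compose[OF bounded_linear_snd])
    show "\<theta>' \<mu> (\<theta> \<mu> t) = t" if "\<mu> \<in> J" "t \<in> T" for \<mu> t
      by (simp add: \<theta>'_def W'\<theta>(2)[OF that])
    show op: "open (\<theta> \<mu> ` T)" if \<mu>: "\<mu> \<in> J" for \<mu>
      unfolding open_iff_eventually
    proof
      fix x assume "x \<in> \<theta> \<mu> ` T"
      then obtain t where t: "t \<in> T" "x = \<theta> \<mu> t" by blast
      \<comment> \<open>\<open>W'\<close> maps points \<open>(\<mu>, y)\<close> near
        \<open>(\<mu>, x)\<close> back into \<open>J \<times> T\<close>. As \<open>W\<close> keeps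
        the parameter, each such \<open>y\<close> is a value of
        \<open>\<theta> \<mu>\<close>.\<close>
      have "\<forall>\<^sub>F z in nhds (\<mu>, t). z \<in> J \<times> T"
        using \<mu> t(1) open_Times[OF JT(1,2)] by (auto simp: eventually_nhds)
      from smooth_at_eventually_compose[OF W'\<theta>(1)[OF \<mu> t(1)], unfolded W'\<theta>(2)[OF \<mu> t(1)], OF this]
      have "\<forall>\<^sub>F w in nhds (\<mu>, x). W' w \<in> J \<times> T \<and> W (W' w) = w"
        using W'\<theta>(3)[OF \<mu> t(1)] unfolding t(2) by eventually_elim auto
      from smooth_at_eventually_compose[OF pair this]
      show "\<forall>\<^sub>F y in nhds x. y \<in> \<theta> \<mu> ` T"
      proof eventually_elim
        case (elim y)
        obtain \<mu>' t' where W': "W' (\<mu>, y) = (\<mu>', t')" by fastforce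
        then have "\<mu>' \<in> J" "t' \<in> T" using elim by auto
        then have "(\<mu>', \<theta> \<mu>' t') = (\<mu>, y)" using W\<theta> elim W' by metis
        then show ?case using \<open>t' \<in> T\<close> by auto
      qed
    qed
    show "smooth_on (\<theta>' \<mu>) (\<theta> \<mu> ` T)" if \<mu>: "\<mu> \<in> J" for \<mu>
      unfolding smooth_at_iff[OF op[OF \<mu>]]
    proof
      fix x assume "x \<in> \<theta> \<mu> ` T"
      then have "smooth_at W' (\<mu>, x)" using W'\<theta>(1)[OF \<mu>] by auto
      then show "smooth_at (\<theta>' \<mu>) x"
        unfolding \<theta>'_def[abs_def] by (intro smooth_at_linear_compose[OF bounded_linear_snd] smooth_at_compose[OF pair])
    qed
    show "smooth_on (\<lambda>(\<mu>, t). g \<mu> t) (J \<times> UNIV)"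
      unfolding smooth_at_iff[OF open_Times[OF JT(1) open_UNIV]]
    proof
      fix z assume z: "z \<in> J \<times> (UNIV :: 'a set)"
      let ?y = "\<lambda>z. (fst z, \<rho> (?\<pi> (snd z)))"
      have y: "smooth_at ?y z"
        by (intro smooth_at_Pair smooth_at_linear bounded_linear_fst
            smooth_at_compose[OF smooth_at_linear[OF bounded_linear_compose[OF \<pi>(1) bounded_linear_snd]] \<rho>(1)])
      have "?good (?y z)" using z J1J \<rho>(3) by (intro good) auto
      then have Ry: "smooth_at R (?y z)" "smooth_at h (R (?y z))" by auto
      have "smooth_at (\<lambda>z. h (R (?y z))) z"
        by (rule smooth_at_compose[OF smooth_at_compose[OF y Ry(1)] Ry(2)])
      then show "smooth_at (\<lambda>(\<mu>, t). g \<mu> t) z" by (simp add: g_def case_prod_unfold)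
    qed
    show "g \<mu> s = g \<mu> t" if "\<And>b. b \<in> Basis - M \<Longrightarrow> s \<bullet> b = t \<bullet> b" for \<mu> s t
    proof -
      have "?\<pi> s = ?\<pi> t" by (rule euclidean_eqI) (use that in \<open>auto simp: inner_drop_coords[OF MB]\<close>)
      then show ?thesis by (simp add: g_def)
    qed
    show "h (\<mu>, \<theta> \<mu> t) = g \<mu> t + (\<Sum>b\<in>M. e b * (t \<bullet> b)\<^sup>2)" if "\<mu> \<in> J" "t \<in> T" for \<mu> t
    proof -
      have "h (\<mu>, \<theta> \<mu> t) = h (R (\<mu>, \<rho> t))" unfolding W\<theta>[OF that, symmetric] by (simp add: W_def)
      also have "\<dots> = h (R (\<mu>, ?\<pi> (\<rho> t))) + (\<Sum>b\<in>M. e b * (\<rho> t \<bullet> b)\<^sup>2)"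
        using goodW[OF that] unfolding quad drop_coords by simp
      \<comment> \<open>\<open>squash\<close> acts on the range of the projection, that is on the
        unsplit coordinates, and leaves those in \<open>M\<close> unchanged.\<close>
      also have "(\<Sum>b\<in>M. e b * (\<rho> t \<bullet> b)\<^sup>2) = (\<Sum>b\<in>M. e b * (t \<bullet> b)\<^sup>2)"
      proof (rule sum.cong[OF refl])
        fix b assume "b \<in> M"
        then have "?\<pi> t \<bullet> b = 0" using MB inner_drop_coords[OF MB, of b t] by auto
        then have "\<rho> t \<bullet> b = t \<bullet> b" by (simp add: \<rho>_def squash_def inner_add_left inner_diff_left)
        then show "e b * (\<rho> t \<bullet> b)\<^sup>2 = e b * (t \<bullet> b)\<^sup>2" by simp
      qed
      finally show ?thesis by (simp add: g_def \<rho>(2))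
    qed
    show "linear V" "inj V" by (rule linV, rule injV)
    show "frechet_derivative (\<lambda>z. frechet_derivative h (at z) (0, w)) (at ?z) (0, V b) = 0"
      if b: "b \<in> Basis - M" for b w
    proof -
      let ?\<beta> = "\<lambda>v. frechet_derivative (\<lambda>z. frechet_derivative h (at z) (0, V b)) (at ?z) v"
      have lin: "linear ?\<beta>" by (rule smooth_at_linear_derivative[OF smooth_at_frechet_derivative[OF h(1)]])
      have bD: "(0, b) \<in> D - MM" using b by (auto simp: D_def MM)
      have zero: "?\<beta> (0, V c) = 0" if c: "c \<in> Basis" for c
      proof -
        have "(0, c) \<in> D" using c by (simp add: D_def)
        from kernel[OF bD this] second_derivative_compose_critical[OF h(1) _ R, of "(0, c)" "(0, b)"]
        have "frechet_derivative (\<lambda>z. frechet_derivative h (at z) (0, V c)) (at ?z) (0, V b) = 0"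
          unfolding RV using hD by simp
        then show ?thesis
          using symmetric_second_derivative[OF h(1), of "(0, V b)" "(0, V c)"] by (rule trans[rotated])
      qed
      \<comment> \<open>The Hessian relation is known against \<open>V c\<close> for basis vectors
        \<open>c\<close>. By linearity it holds against the range of \<open>V\<close>, which is
        everything because \<open>V\<close> is an injective endomorphism.\<close>
      have "linear (\<lambda>v. (0 :: 'p, V v))"
        by (rule linearI) (simp_all add: linear_add[OF linV] linear_cmul[OF linV])
      from linear_compose[OF this lin] have "linear (\<lambda>v. ?\<beta> (0, V v))" by (simp only: o_def)
      moreover have "linear (\<lambda>v. 0 :: real)" by (rule linearI) simp_all
      ultimately have "(\<lambda>v. ?\<beta> (0, V v)) = (\<lambda>v. 0)"
        by (rule linear_eq_stdbasis) (rule zero)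
      moreover obtain v where "w = V v"
        using linear_injective_imp_surjective[OF linV injV] by (metis surjD)
      ultimately have "?\<beta> (0, w) = 0" by (metis (no_types, lifting))
      then show ?thesis
        using symmetric_second_derivative[OF h(1), of "(0, w)" "(0, V b)"] by (rule trans[rotated])
    qed
  qed
qed

section \<open>Smooth maps between manifolds\<close>

lemma smooth_manifoldD:
  assumes "smooth_manifold A" "(V, \<phi>) \<in> A"
  shows "inj_on \<phi> V" "open (\<phi> ` V)"
    and "(V', \<phi>') \<in> A \<Longrightarrow> open (\<phi> ` (V \<inter> V'))"
    and "(V', \<phi>') \<in> A \<Longrightarrow> smooth_on (\<phi>' \<circ> inv_into V \<phi>) (\<phi> ` (V \<inter> V'))"
  using assms unfolding smooth_manifold_def by blast+

lemma smooth_mapD: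
  assumes "smooth_map A B S f" "(U, \<phi>) \<in> A" "(V, \<psi>) \<in> B"
  shows "open (\<phi> ` (S \<inter> U \<inter> f -` V))"
    and "smooth_on (\<psi> \<circ> f \<circ> inv_into U \<phi>) (\<phi> ` (S \<inter> U \<inter> f -` V))"
  using assms unfolding smooth_map_def by blast+

lemma smooth_map_localI:
  assumes "S \<subseteq> carrier A" "f ` S \<subseteq> carrier B"
    and "\<And>U \<phi> V \<psi> x. (U, \<phi>) \<in> A \<Longrightarrow> (V, \<psi>) \<in> B \<Longrightarrow> x \<in> S \<Longrightarrow> x \<in> U \<Longrightarrow> f x \<in> V \<Longrightarrow>
      \<exists>T. open T \<and> \<phi> x \<in> T \<and> T \<subseteq> \<phi> ` (S \<inter> U \<inter> f -` V) \<and> smooth_on (\<psi> \<circ> f \<circ> inv_into U \<phi>) T"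
  shows "smooth_map A B S f"
  unfolding smooth_map_def
proof (intro conjI assms(1,2) ballI, clarify)
  fix U \<phi> V \<psi> assume c: "(U, \<phi>) \<in> A" "(V, \<psi>) \<in> B"
  have *: "\<exists>T. open T \<and> y \<in> T \<and> T \<subseteq> \<phi> ` (S \<inter> U \<inter> f -` V) \<and> smooth_on (\<psi> \<circ> f \<circ> inv_into U \<phi>) T"
    if "y \<in> \<phi> ` (S \<inter> U \<inter> f -` V)" for y
    using that assms(3)[OF c] by blast
  show "open (\<phi> ` (S \<inter> U \<inter> f -` V)) \<and> smooth_on (\<psi> \<circ> f \<circ> inv_into U \<phi>) (\<phi> ` (S \<inter> U \<inter> f -` V))"
  proof
    show "open (\<phi> ` (S \<inter> U \<inter> f -` V))"
      by (rule iffD2[OF open_subopen]) (use * in blast)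
    show "smooth_on (\<psi> \<circ> f \<circ> inv_into U \<phi>) (\<phi> ` (S \<inter> U \<inter> f -` V))"
      by (rule smooth_on_local) (use * in blast)
  qed
qed

text \<open>About the atlases only injectivity of the charts is assumed, which is exactly what is
  established below for the cotangent atlas.\<close>

lemma smooth_map_compose:
  assumes inj: "\<And>U \<phi>. (U, \<phi>) \<in> A \<Longrightarrow> inj_on \<phi> U" "\<And>U \<phi>. (U, \<phi>) \<in> B \<Longrightarrow> inj_on \<phi> U"
    and f: "smooth_map A B S f" and g: "smooth_map B C T g" and ST: "f ` S \<subseteq> T"
  shows "smooth_map A C S (g \<circ> f)"
proof (rule smooth_map_localI)
  show "S \<subseteq> carrier A" using f by (simp add: smooth_map_def)
  show "(g \<circ> f) ` S \<subseteq> carrier C" using g ST unfolding smooth_map_def by fastforce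
  fix U \<phi> V \<psi> x assume c: "(U, \<phi>) \<in> A" "(V, \<psi>) \<in> C" and x: "x \<in> S" "x \<in> U" "(g \<circ> f) x \<in> V"
  have "f x \<in> carrier B" using f x(1) unfolding smooth_map_def by blast
  then obtain W \<kappa> where W: "(W, \<kappa>) \<in> B" "f x \<in> W" unfolding carrier_def by force
  note f' = smooth_mapD[OF f c(1) W(1)] and g' = smooth_mapD[OF g W(1) c(2)]
  \<comment> \<open>The coordinates of points at which the middle chart around \<open>f x\<close>
    can be inserted; open as a preimage under the local form of \<open>f\<close>.\<close>
  define P where "P = \<phi> ` (S \<inter> U \<inter> f -` W) \<inter> (\<kappa> \<circ> f \<circ> inv_into U \<phi>) -` (\<kappa> ` (T \<inter> W \<inter> g -` V))"
  have oP: "open P"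
    unfolding P_def by (rule continuous_open_preimage[OF smooth_on_imp_continuous_on[OF f'(2)] f'(1) g'(1)])
  have inv\<phi>: "inv_into U \<phi> (\<phi> y) = y" if "y \<in> U" for y using inv_into_f_f[OF inj(1)[OF c(1)] that] .
  have inv\<kappa>: "inv_into W \<kappa> (\<kappa> y) = y" if "y \<in> W" for y using inv_into_f_f[OF inj(2)[OF W(1)] that] .
  have Pmem: "\<exists>y'. y = \<phi> y' \<and> y' \<in> S \<and> y' \<in> U \<and> f y' \<in> W \<and> g (f y') \<in> V" if yP: "y \<in> P" for y
  proof -
    obtain y' where y': "y = \<phi> y'" "y' \<in> S" "y' \<in> U" "f y' \<in> W" using yP unfolding P_def by blast
    have "(\<kappa> \<circ> f \<circ> inv_into U \<phi>) y \<in> \<kappa> ` (T \<inter> W \<inter> g -` V)" using yP unfolding P_def by blast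
    then obtain w where w: "w \<in> W" "g w \<in> V" "\<kappa> (f y') = \<kappa> w" using inv\<phi>[OF y'(3)] y'(1) by auto
    then have "w = f y'" using inj_onD[OF inj(2)[OF W(1)] w(3) y'(4) w(1)] by simp
    then show ?thesis using y' w by blast
  qed
  have "smooth_on (\<lambda>y. (\<psi> \<circ> g \<circ> inv_into W \<kappa>) ((\<kappa> \<circ> f \<circ> inv_into U \<phi>) y)) P"
    by (rule smooth_on_compose[OF oP g'(1) _ smooth_on_subset[OF f'(2)] g'(2)]) (auto simp: P_def)
  then have "smooth_on (\<psi> \<circ> (g \<circ> f) \<circ> inv_into U \<phi>) P"
  proof (rule smooth_on_cong[OF oP, rotated])
    fix y assume "y \<in> P"
    then obtain y' where y': "y = \<phi> y'" "y' \<in> S" "y' \<in> U" "f y' \<in> W" "g (f y') \<in> V" using Pmem by blast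
    show "(\<psi> \<circ> g \<circ> inv_into W \<kappa>) ((\<kappa> \<circ> f \<circ> inv_into U \<phi>) y) = (\<psi> \<circ> (g \<circ> f) \<circ> inv_into U \<phi>) y"
      unfolding y'(1) o_apply inv\<phi>[OF y'(3)] inv\<kappa>[OF y'(4)] ..
  qed
  moreover have "\<phi> x \<in> P"
  proof -
    have "\<kappa> (f x) \<in> \<kappa> ` (T \<inter> W \<inter> g -` V)" using x ST W(2) by (intro imageI) auto
    then show ?thesis using x W(2) inv\<phi>[OF x(2)] by (auto simp: P_def)
  qed
  moreover have "P \<subseteq> \<phi> ` (S \<inter> U \<inter> (g \<circ> f) -` V)"
  proof
    fix y assume "y \<in> P"
    then obtain y' where "y = \<phi> y'" "y' \<in> S" "y' \<in> U" "g (f y') \<in> V" using Pmem by blast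
    then show "y \<in> \<phi> ` (S \<inter> U \<inter> (g \<circ> f) -` V)" by auto
  qed
  ultimately show "\<exists>T. open T \<and> \<phi> x \<in> T \<and> T \<subseteq> \<phi> ` (S \<inter> U \<inter> (g \<circ> f) -` V) \<and>
      smooth_on (\<psi> \<circ> (g \<circ> f) \<circ> inv_into U \<phi>) T"
    using oP by blast
qed

section \<open>Euclidean space as a manifold, and maps given in one chart\<close>

lemma inj_euclidean_atlas: "(U, \<phi>) \<in> euclidean_atlas \<Longrightarrow> inj_on \<phi> U"
  by (auto simp: euclidean_atlas_def inj_on_def)

lemma carrier_euclidean_atlas: "carrier euclidean_atlas = UNIV"
  by (simp add: carrier_def euclidean_atlas_def)

lemma inv_into_UNIV_id: "inv_into UNIV (\<lambda>x. x) = (\<lambda>x. x)"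
  by (rule ext) (metis inv_into_f_f inj_on_id2 UNIV_I)

lemma chart_at_euclidean_atlas: "chart_at euclidean_atlas x = (UNIV, \<lambda>x. x)"
  unfolding chart_at_def euclidean_atlas_def by (rule some_equality) auto

lemma chart_at_mem:
  assumes "x \<in> carrier A"
  shows "chart_at A x \<in> A \<and> x \<in> fst (chart_at A x)"
  unfolding chart_at_def by (rule someI_ex) (use assms in \<open>auto simp: carrier_def\<close>)

text \<open>In any second chart the map reads as a transition map after \<open>\<eta>\<close>, on
  the open set where the image lies in both chart domains.\<close>

lemma smooth_map_inverse_chart:
  fixes A :: "('m, 'a::euclidean_space) atlas" and \<eta> :: "'s::euclidean_space \<Rightarrow> 'a"
  assumes A: "smooth_manifold A" "(V, \<phi>) \<in> A"
    and \<eta>: "open S" "smooth_on \<eta> S" "\<eta> ` S \<subseteq> \<phi> ` V"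
  shows "smooth_map euclidean_atlas A S (\<lambda>z. inv_into V \<phi> (\<eta> z))"
proof (rule smooth_map_localI)
  have inV: "inv_into V \<phi> (\<eta> z) \<in> V" "\<phi> (inv_into V \<phi> (\<eta> z)) = \<eta> z" if "z \<in> S" for z
  proof -
    have "\<eta> z \<in> \<phi> ` V" using \<eta>(3) that by blast
    then show "inv_into V \<phi> (\<eta> z) \<in> V" "\<phi> (inv_into V \<phi> (\<eta> z)) = \<eta> z"
      by (rule inv_into_into, rule f_inv_into_f)
  qed
  show "S \<subseteq> carrier euclidean_atlas" by (simp add: carrier_euclidean_atlas)
  show "(\<lambda>z. inv_into V \<phi> (\<eta> z)) ` S \<subseteq> carrier A"
    using inV(1) A(2) by (force simp: carrier_def)
  fix U0 \<iota> V1 \<phi>1 x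
  assume "(U0, \<iota>) \<in> (euclidean_atlas :: ('s, 's) atlas)" and V1: "(V1, \<phi>1) \<in> A"
    and x: "x \<in> S" "inv_into V \<phi> (\<eta> x) \<in> V1"
  then have id: "U0 = UNIV" "\<iota> = (\<lambda>x. x)" by (auto simp: euclidean_atlas_def)
  note tr = smooth_manifoldD(3,4)[OF A V1]
  let ?T = "S \<inter> \<eta> -` (\<phi> ` (V \<inter> V1))"
  have oT: "open ?T"
    by (rule continuous_open_preimage[OF smooth_on_imp_continuous_on[OF \<eta>(2)] \<eta>(1) tr(1)])
  have "smooth_on (\<lambda>z. (\<phi>1 \<circ> inv_into V \<phi>) (\<eta> z)) ?T"
    by (rule smooth_on_compose[OF oT tr(1) _ smooth_on_subset[OF \<eta>(2)] tr(2)]) auto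
  then have "smooth_on (\<phi>1 \<circ> (\<lambda>z. inv_into V \<phi> (\<eta> z)) \<circ> inv_into U0 \<iota>) ?T"
    unfolding id inv_into_UNIV_id by (simp add: o_def)
  moreover have "\<iota> x \<in> ?T"
    unfolding id using x inV[OF x(1)] by (auto simp: image_iff intro!: bexI[of _ "inv_into V \<phi> (\<eta> x)"])
  moreover have "?T \<subseteq> \<iota> ` (S \<inter> U0 \<inter> (\<lambda>z. inv_into V \<phi> (\<eta> z)) -` V1)"
  proof
    fix z assume z: "z \<in> ?T"
    then obtain y where "y \<in> V" "y \<in> V1" "\<eta> z = \<phi> y" by blast
    then have "inv_into V \<phi> (\<eta> z) \<in> V1" using inv_into_f_f[OF smooth_manifoldD(1)[OF A]] by simp
    then show "z \<in> \<iota> ` (S \<inter> U0 \<inter> (\<lambda>z. inv_into V \<phi> (\<eta> z)) -` V1)" using z unfolding id by auto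
  qed
  ultimately show "\<exists>T. open T \<and> \<iota> x \<in> T \<and> T \<subseteq> \<iota> ` (S \<inter> U0 \<inter> (\<lambda>z. inv_into V \<phi> (\<eta> z)) -` V1) \<and>
      smooth_on (\<phi>1 \<circ> (\<lambda>z. inv_into V \<phi> (\<eta> z)) \<circ> inv_into U0 \<iota>) T"
    using oT by blast
qed

text \<open>The counterpart for maps out of the manifold: in a second chart \<open>F\<close> reads
  as \<open>\<sigma>\<close> after a transition map.\<close>

lemma smooth_map_via_chart:
  fixes A :: "('m, 'a::euclidean_space) atlas" and \<sigma> :: "'a \<Rightarrow> 's::euclidean_space"
  assumes A: "smooth_manifold A" "(V, \<phi>) \<in> A"
    and S: "S \<subseteq> V" "open (\<phi> ` S)" "smooth_on \<sigma> (\<phi> ` S)" "\<And>x. x \<in> S \<Longrightarrow> F x = \<sigma> (\<phi> x)"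
  shows "smooth_map A euclidean_atlas S F"
proof (rule smooth_map_localI)
  show "S \<subseteq> carrier A" using S(1) A(2) by (force simp: carrier_def)
  show "F ` S \<subseteq> carrier euclidean_atlas" by (simp add: carrier_euclidean_atlas)
  fix V1 \<phi>1 U0 \<iota> x
  assume V1: "(V1, \<phi>1) \<in> A" and "(U0, \<iota>) \<in> (euclidean_atlas :: ('s, 's) atlas)"
    and x: "x \<in> S" "x \<in> V1"
  then have id: "U0 = UNIV" "\<iota> = (\<lambda>x. x)" by (auto simp: euclidean_atlas_def)
  note tr = smooth_manifoldD(3,4)[OF A(1) V1 A(2)]
  note inj1 = inv_into_f_f[OF smooth_manifoldD(1)[OF A(1) V1]]
  let ?T = "\<phi>1 ` (V1 \<inter> V) \<inter> (\<phi> \<circ> inv_into V1 \<phi>1) -` (\<phi> ` S)"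
  have oT: "open ?T"
    by (rule continuous_open_preimage[OF smooth_on_imp_continuous_on[OF tr(2)] tr(1) S(2)])
  have T: "\<exists>w. y = \<phi>1 w \<and> w \<in> S \<and> w \<in> V1" if yT: "y \<in> ?T" for y
  proof -
    obtain w where w: "y = \<phi>1 w" "w \<in> V1" "w \<in> V" using yT by blast
    have "(\<phi> \<circ> inv_into V1 \<phi>1) y \<in> \<phi> ` S" using yT by blast
    then obtain s where s: "s \<in> S" "\<phi> w = \<phi> s" using inj1[OF w(2)] w(1) by auto
    then have "w = s" using inj_onD[OF smooth_manifoldD(1)[OF A] s(2) w(3)] S(1) by blast
    then show ?thesis using w s by blast
  qed
  have "smooth_on (\<lambda>y. \<sigma> ((\<phi> \<circ> inv_into V1 \<phi>1) y)) ?T"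
    by (rule smooth_on_compose[OF oT S(2) _ smooth_on_subset[OF tr(2)] S(3)]) auto
  then have "smooth_on (\<iota> \<circ> F \<circ> inv_into V1 \<phi>1) ?T"
  proof (rule smooth_on_cong[OF oT, rotated])
    fix y assume "y \<in> ?T"
    then obtain w where w: "y = \<phi>1 w" "w \<in> S" "w \<in> V1" using T by blast
    show "\<sigma> ((\<phi> \<circ> inv_into V1 \<phi>1) y) = (\<iota> \<circ> F \<circ> inv_into V1 \<phi>1) y"
      unfolding w(1) id o_apply inj1[OF w(3)] S(4)[OF w(2)] ..
  qed
  moreover have "\<phi>1 x \<in> ?T" using x S(1) inj1[OF x(2)] by auto
  moreover have "?T \<subseteq> \<phi>1 ` (S \<inter> V1 \<inter> F -` U0)"
  proof
    fix y assume "y \<in> ?T"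
    then show "y \<in> \<phi>1 ` (S \<inter> V1 \<inter> F -` U0)" using T[of y] unfolding id by blast
  qed
  ultimately show "\<exists>T. open T \<and> \<phi>1 x \<in> T \<and> T \<subseteq> \<phi>1 ` (S \<inter> V1 \<inter> F -` U0) \<and>
      smooth_on (\<iota> \<circ> F \<circ> inv_into V1 \<phi>1) T"
    using oT by blast
qed

lemma smooth_family_in_chart:
  assumes f: "smooth_family_of_functions A J U f" and A: "smooth_manifold A" "(V, \<phi>) \<in> A"
  shows "open (J \<times> \<phi> ` (U \<inter> V))"
    and "smooth_on (\<lambda>(\<mu>, y). f \<mu> (inv_into V \<phi> y)) (J \<times> \<phi> ` (U \<inter> V))"
proof -
  let ?\<Phi> = "map_prod (\<lambda>x. x) \<phi>"
  have c: "(UNIV \<times> V, ?\<Phi>) \<in> product_atlas euclidean_atlas A" "(UNIV, \<lambda>x. x) \<in> euclidean_atlas"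
    using A(2) by (auto simp: product_atlas_def euclidean_atlas_def)
  have set: "?\<Phi> ` ((J \<times> U) \<inter> (UNIV \<times> V) \<inter> (\<lambda>(\<mu>, x). f \<mu> x) -` UNIV) = J \<times> \<phi> ` (U \<inter> V)"
    by (auto simp: map_prod_def)
  note * = smooth_mapD[OF f[unfolded smooth_family_of_functions_def] c, unfolded set]
  show op: "open (J \<times> \<phi> ` (U \<inter> V))" by (rule *(1))
  have inj: "inj_on \<phi> V" by (rule smooth_manifoldD(1)[OF A])
  then have inj': "inj_on ?\<Phi> (UNIV \<times> V)" by (auto simp: inj_on_def)
  show "smooth_on (\<lambda>(\<mu>, y). f \<mu> (inv_into V \<phi> y)) (J \<times> \<phi> ` (U \<inter> V))"
  proof (rule smooth_on_cong[OF op _ *(2)])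
    fix z assume "z \<in> J \<times> \<phi> ` (U \<inter> V)"
    then obtain \<mu> x where z: "z = ?\<Phi> (\<mu>, x)" "x \<in> V" by auto
    have "inv_into (UNIV \<times> V) ?\<Phi> z = (\<mu>, x)"
      unfolding z(1) by (rule inv_into_f_f[OF inj']) (use z(2) in auto)
    then show "((\<lambda>x. x) \<circ> (\<lambda>(\<mu>, x). f \<mu> x) \<circ> inv_into (UNIV \<times> V) ?\<Phi>) z = (case z of (\<mu>, y) \<Rightarrow> f \<mu> (inv_into V \<phi> y))"
      using inv_into_f_f[OF inj z(2)] by (simp add: z(1))
  qed
qed

text \<open>With the parameter frozen, the chart domain is a slice of an open product set, and the
  local form is the joint one composed with \<open>y \<mapsto> (\<mu>, y)\<close>.\<close>

lemma smooth_map_of_family: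
  assumes f: "smooth_family_of_functions A J U f" and A: "smooth_manifold A" and \<mu>: "\<mu> \<in> J"
  shows "smooth_map A euclidean_atlas U (f \<mu>)"
proof -
  have "U \<subseteq> carrier A"
  proof
    fix x assume "x \<in> U"
    moreover have "J \<times> U \<subseteq> carrier (product_atlas euclidean_atlas A)"
      using f by (simp add: smooth_family_of_functions_def smooth_map_def)
    ultimately have "(\<mu>, x) \<in> carrier (product_atlas euclidean_atlas A)" using \<mu> by blast
    then show "x \<in> carrier A" by (force simp: carrier_def product_atlas_def)
  qed
  moreover have "open (\<phi> ` (U \<inter> V)) \<and> smooth_on (f \<mu> \<circ> inv_into V \<phi>) (\<phi> ` (U \<inter> V))"
    if VA: "(V, \<phi>) \<in> A" for V \<phi>
  proof -
    note * = smooth_family_in_chart[OF f A VA]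
    have op: "open (\<phi> ` (U \<inter> V))"
    proof -
      have "open ((\<lambda>y. (\<mu>, y)) -` (J \<times> \<phi> ` (U \<inter> V)))"
        by (rule open_vimage[OF *(1)]) (intro continuous_intros)
      moreover have "(\<lambda>y. (\<mu>, y)) -` (J \<times> \<phi> ` (U \<inter> V)) = \<phi> ` (U \<inter> V)" using \<mu> by auto
      ultimately show ?thesis by simp
    qed
    have "smooth_on (\<lambda>y. (\<lambda>(\<mu>, y). f \<mu> (inv_into V \<phi> y)) (\<mu>, y)) (\<phi> ` (U \<inter> V))"
      by (rule smooth_on_compose[OF op *(1) _
            smooth_on_Pair[OF op smooth_on_const smooth_on_linear[OF op bounded_linear_ident]] *(2)])
        (use \<mu> in auto)
    then show ?thesis using op by (simp add: o_def)
  qed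
  ultimately show ?thesis
    unfolding smooth_map_def carrier_euclidean_atlas by (auto simp: euclidean_atlas_def o_def)
qed

section \<open>Exact one-forms and tangent vectors\<close>

definition cotangent_chart :: "('n, 'a::euclidean_space) atlas \<Rightarrow> 'n set \<Rightarrow> ('n \<Rightarrow> 'a) \<Rightarrow> 'n \<times> 'a \<Rightarrow> 'a \<times> 'a" where
  "cotangent_chart A V \<phi> = (\<lambda>(x, \<xi>).
     (\<phi> x, adjoint (frechet_derivative (snd (chart_at A x) \<circ> inv_into V \<phi>) (at (\<phi> x))) \<xi>))"

lemma cotangent_atlas_eq: "cotangent_atlas A = {(V \<times> UNIV, cotangent_chart A V \<phi>) | V \<phi>. (V, \<phi>) \<in> A}"
  by (simp add: cotangent_atlas_def cotangent_chart_def)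

lemma carrier_cotangent_atlas: "carrier (cotangent_atlas A) = carrier A \<times> UNIV"
  by (force simp: carrier_def cotangent_atlas_eq)

lemma smooth_at_transition:
  assumes "smooth_manifold A" "(V, \<phi>) \<in> A" "(V', \<phi>') \<in> A" "x \<in> V" "x \<in> V'"
  shows "smooth_at (\<phi>' \<circ> inv_into V \<phi>) (\<phi> x)"
  using smooth_manifoldD(3,4)[OF assms(1-3)] assms(4,5) by (intro smooth_atI) auto

lemma transition_derivative_inverse:
  assumes A: "smooth_manifold A" "(V, \<phi>) \<in> A" "(V', \<phi>') \<in> A" and x: "x \<in> V" "x \<in> V'"
  shows "frechet_derivative (\<phi> \<circ> inv_into V' \<phi>') (at (\<phi>' x))
    (frechet_derivative (\<phi>' \<circ> inv_into V \<phi>) (at (\<phi> x)) v) = v"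
proof -
  let ?a = "\<phi>' \<circ> inv_into V \<phi>" and ?b = "\<phi> \<circ> inv_into V' \<phi>'"
  note i = inv_into_f_f[OF smooth_manifoldD(1)[OF A(1,2)]]
  note i' = inv_into_f_f[OF smooth_manifoldD(1)[OF A(1,3)]]
  have a: "?a (\<phi> x) = \<phi>' x" using i[OF x(1)] by simp
  have sa: "smooth_at ?a (\<phi> x)" by (rule smooth_at_transition[OF A x])
  have sb: "smooth_at ?b (?a (\<phi> x))" unfolding a by (rule smooth_at_transition[OF A(1,3,2) x(2,1)])
  have "\<forall>\<^sub>F y in nhds (\<phi> x). ?b (?a y) = y"
    unfolding eventually_nhds
  proof (intro exI conjI ballI)
    show "open (\<phi> ` (V \<inter> V'))" by (rule smooth_manifoldD(3)[OF A])
    show "\<phi> x \<in> \<phi> ` (V \<inter> V')" using x by blast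
    fix y assume "y \<in> \<phi> ` (V \<inter> V')"
    then obtain w where w: "y = \<phi> w" "w \<in> V" "w \<in> V'" by blast
    show "?b (?a y) = y" unfolding w(1) o_apply i[OF w(2)] i'[OF w(3)] ..
  qed
  from frechet_derivative_cong_nhds[OF this]
  have "frechet_derivative (\<lambda>y. ?b (?a y)) (at (\<phi> x)) v = v"
    by (simp only: frechet_derivative_eqI[OF has_derivative_ident])
  from trans[OF frechet_derivative_chain[OF sa sb, of v, symmetric] this]
  show ?thesis unfolding a .
qed

text \<open>Momentum coordinates are the adjoint of a transition derivative applied to the covector.
  As this derivative is onto, pairing with its values recovers the covector.\<close>

lemma inj_cotangent_atlas:
  assumes A: "smooth_manifold A" and U: "(U, \<kappa>) \<in> cotangent_atlas A"
  shows "inj_on \<kappa> U"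
proof -
  obtain V \<phi> where V: "(V, \<phi>) \<in> A" "U = V \<times> UNIV" "\<kappa> = cotangent_chart A V \<phi>"
    using U by (auto simp: cotangent_atlas_eq)
  show ?thesis
    unfolding V(2,3)
  proof (rule inj_onI, clarify)
    fix x \<xi> x' \<xi>'
    assume x: "x \<in> V" "x' \<in> V" and eq: "cotangent_chart A V \<phi> (x, \<xi>) = cotangent_chart A V \<phi> (x', \<xi>')"
    then have "\<phi> x = \<phi> x'" by (simp add: cotangent_chart_def)
    then have xx: "x' = x" using inj_onD[OF smooth_manifoldD(1)[OF A V(1)]] x by metis
    obtain V' \<phi>' where c: "chart_at A x = (V', \<phi>')" by fastforce
    have "x \<in> carrier A" using x(1) V(1) by (force simp: carrier_def)
    from chart_at_mem[OF this] have V': "(V', \<phi>') \<in> A" "x \<in> V'" by (simp_all add: c)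
    let ?L = "frechet_derivative (\<phi>' \<circ> inv_into V \<phi>) (at (\<phi> x))"
    have lin: "linear ?L" by (rule smooth_at_linear_derivative[OF smooth_at_transition[OF A V(1) V'(1) x(1) V'(2)]])
    have adj: "adjoint ?L \<xi> = adjoint ?L \<xi>'" using eq by (simp add: cotangent_chart_def xx c)
    have "\<xi> \<bullet> ?L v = v \<bullet> adjoint ?L \<xi>" for \<xi> v
      by (subst adjoint_works[OF lin]) (rule inner_commute)
    then have *: "\<xi> \<bullet> ?L v = \<xi>' \<bullet> ?L v" for v by (simp only: adj)
    have "\<xi> \<bullet> w = \<xi>' \<bullet> w" for w
      using *[of "frechet_derivative (\<phi> \<circ> inv_into V' \<phi>') (at (\<phi>' x)) w"]
        transition_derivative_inverse[OF A V'(1) V(1) V'(2) x(1), of w] by simp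
    then have "\<xi> = \<xi>'" by (metis euclidean_eqI)
    then show "x = x' \<and> \<xi> = \<xi>'" using xx by simp
  qed
qed

text \<open>Spelled out over the basis so that it unfolds to the same sum as the covector in
  \<open>exact_one_form\<close>.\<close>

definition euclidean_gradient :: "('a::euclidean_space \<Rightarrow> real) \<Rightarrow> 'a \<Rightarrow> 'a" where
  "euclidean_gradient F y = (\<Sum>b\<in>Basis. frechet_derivative F (at y) b *\<^sub>R b)"

lemma euclidean_gradient_inner:
  assumes "linear (frechet_derivative F (at y))"
  shows "euclidean_gradient F y \<bullet> v = frechet_derivative F (at y) v"
proof -
  have "frechet_derivative F (at y) (\<Sum>b\<in>Basis. (v \<bullet> b) *\<^sub>R b) = (\<Sum>b\<in>Basis. (v \<bullet> b) * frechet_derivative F (at y) b)"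
    by (simp only: linear_sum[OF assms] linear_cmul[OF assms] real_scaleR_def)
  moreover have "euclidean_gradient F y \<bullet> v = (\<Sum>b\<in>Basis. frechet_derivative F (at y) b * (b \<bullet> v))"
    by (simp add: euclidean_gradient_def inner_sum_left)
  moreover have "\<dots> = (\<Sum>b\<in>Basis. (v \<bullet> b) * frechet_derivative F (at y) b)"
    by (rule sum.cong) (simp_all add: inner_commute)
  ultimately show ?thesis unfolding euclidean_representation by simp
qed

lemma smooth_on_euclidean_gradient:
  assumes "open S" "smooth_on F S"
  shows "smooth_on (euclidean_gradient F) S"
  unfolding euclidean_gradient_def[abs_def]
  by (intro smooth_on_sum smooth_on_linear_compose[OF bounded_linear_scaleR_left]
      smooth_on_frechet_derivative assms)

lemma function_in_chart:
  assumes "smooth_map A euclidean_atlas U f" "(V, \<phi>) \<in> A"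
  shows "open (\<phi> ` (U \<inter> V))" "smooth_on (f \<circ> inv_into V \<phi>) (\<phi> ` (U \<inter> V))"
  using smooth_mapD[OF assms, of UNIV "\<lambda>x. x"] by (simp_all add: euclidean_atlas_def o_def)

text \<open>The differential is natural: by the chain rule the adjoint of the transition derivative
  takes the gradient in the selected chart to the gradient in \<open>\<phi>\<close>. The jumps of
  the selected chart thereby disappear.\<close>

lemma cotangent_chart_exact_one_form:
  assumes A: "smooth_manifold A" and f: "smooth_map A euclidean_atlas U f"
    and V: "(V, \<phi>) \<in> A" and x: "x \<in> U" "x \<in> V"
  shows "cotangent_chart A V \<phi> (exact_one_form A f x) = (\<phi> x, euclidean_gradient (f \<circ> inv_into V \<phi>) (\<phi> x))"
proof -
  obtain V' \<phi>' where c: "chart_at A x = (V', \<phi>')" by fastforce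
  have "x \<in> carrier A" using x(2) V by (force simp: carrier_def)
  from chart_at_mem[OF this] have V': "(V', \<phi>') \<in> A" "x \<in> V'" by (simp_all add: c)
  note i = inv_into_f_f[OF smooth_manifoldD(1)[OF A V]]
  note i' = inv_into_f_f[OF smooth_manifoldD(1)[OF A V'(1)]]
  let ?a = "\<phi>' \<circ> inv_into V \<phi>" and ?F = "f \<circ> inv_into V \<phi>" and ?F' = "f \<circ> inv_into V' \<phi>'"
  have a: "?a (\<phi> x) = \<phi>' x" using i[OF x(2)] by simp
  have sa: "smooth_at ?a (\<phi> x)" by (rule smooth_at_transition[OF A V V'(1) x(2) V'(2)])
  have sF: "smooth_at ?F (\<phi> x)" using function_in_chart[OF f V] x by (intro smooth_atI) auto
  have sF': "smooth_at ?F' (?a (\<phi> x))"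
    unfolding a using function_in_chart[OF f V'(1)] x V'(2) by (intro smooth_atI) auto
  have ev: "\<forall>\<^sub>F y in nhds (\<phi> x). ?F' (?a y) = ?F y"
    unfolding eventually_nhds
  proof (intro exI conjI ballI)
    show "open (\<phi> ` (V \<inter> V'))" by (rule smooth_manifoldD(3)[OF A V V'(1)])
    show "\<phi> x \<in> \<phi> ` (V \<inter> V')" using x V'(2) by blast
    fix y assume "y \<in> \<phi> ` (V \<inter> V')"
    then obtain w where w: "y = \<phi> w" "w \<in> V" "w \<in> V'" by blast
    show "?F' (?a y) = ?F y" unfolding w(1) o_apply i[OF w(2)] i'[OF w(3)] ..
  qed
  let ?L = "frechet_derivative ?a (at (\<phi> x))"
  have tm: "tangent_map A euclidean_atlas f x = frechet_derivative ?F' (at (\<phi>' x))"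
    by (simp add: tangent_map_def chart_at_euclidean_atlas c chart_inv_def o_def)
  have "adjoint ?L (euclidean_gradient ?F' (\<phi>' x)) = euclidean_gradient ?F (\<phi> x)"
  proof (rule euclidean_eqI)
    fix b :: 'b
    have "adjoint ?L (euclidean_gradient ?F' (\<phi>' x)) \<bullet> b = b \<bullet> adjoint ?L (euclidean_gradient ?F' (\<phi>' x))"
      by (rule inner_commute)
    also have "\<dots> = ?L b \<bullet> euclidean_gradient ?F' (\<phi>' x)"
      by (rule adjoint_works[OF smooth_at_linear_derivative[OF sa]])
    also have "\<dots> = euclidean_gradient ?F' (\<phi>' x) \<bullet> ?L b" by (rule inner_commute)
    also have "\<dots> = frechet_derivative ?F' (at (\<phi>' x)) (?L b)"
      by (rule euclidean_gradient_inner[OF smooth_at_linear_derivative[OF sF'[unfolded a]]])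
    also have "\<dots> = frechet_derivative ?F (at (\<phi> x)) b"
      using trans[OF frechet_derivative_chain[OF sa sF', of b, symmetric]
          fun_cong[OF frechet_derivative_cong_nhds[OF ev]]] unfolding a .
    also have "\<dots> = euclidean_gradient ?F (\<phi> x) \<bullet> b"
      by (rule euclidean_gradient_inner[OF smooth_at_linear_derivative[OF sF], symmetric])
    finally show "adjoint ?L (euclidean_gradient ?F' (\<phi>' x)) \<bullet> b = euclidean_gradient ?F (\<phi> x) \<bullet> b" .
  qed
  then show ?thesis
    unfolding exact_one_form_def tm cotangent_chart_def euclidean_gradient_def[symmetric] by (simp add: c)
qed

text \<open>Over a base chart \<open>\<phi>\<close> the one-form reads as
  \<open>y \<mapsto> (y, gradient at y)\<close>; passing to another chart of the base only
  precomposes a transition map.\<close>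

lemma smooth_map_exact_one_form:
  assumes A: "smooth_manifold A" and f: "smooth_map A euclidean_atlas U f"
  shows "smooth_map A (cotangent_atlas A) U (exact_one_form A f)"
proof (rule smooth_map_localI)
  show U: "U \<subseteq> carrier A" using f by (simp add: smooth_map_def)
  show "exact_one_form A f ` U \<subseteq> carrier (cotangent_atlas A)"
    using U by (auto simp: carrier_cotangent_atlas exact_one_form_def)
  fix V1 \<phi>1 W \<kappa> x
  assume V1: "(V1, \<phi>1) \<in> A" and W: "(W, \<kappa>) \<in> cotangent_atlas A"
    and x: "x \<in> U" "x \<in> V1" "exact_one_form A f x \<in> W"
  obtain V \<phi> where V: "(V, \<phi>) \<in> A" "W = V \<times> UNIV" "\<kappa> = cotangent_chart A V \<phi>"
    using W by (auto simp: cotangent_atlas_eq)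
  have xV: "x \<in> V" using x(3) V(2) by (simp add: exact_one_form_def)
  note tr = smooth_manifoldD(3,4)[OF A V1 V(1)] and fV = function_in_chart[OF f V(1)]
  note i1 = inv_into_f_f[OF smooth_manifoldD(1)[OF A V1]]
  let ?a = "\<phi> \<circ> inv_into V1 \<phi>1"
  define \<sigma> where "\<sigma> y = (y, euclidean_gradient (f \<circ> inv_into V \<phi>) y)" for y
  let ?T = "\<phi>1 ` (V1 \<inter> V) \<inter> ?a -` (\<phi> ` (U \<inter> V))"
  have oT: "open ?T"
    by (rule continuous_open_preimage[OF smooth_on_imp_continuous_on[OF tr(2)] tr(1) fV(1)])
  have T: "\<exists>w. y = \<phi>1 w \<and> w \<in> V1 \<and> w \<in> V \<and> w \<in> U" if yT: "y \<in> ?T" for y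
  proof -
    obtain w where w: "y = \<phi>1 w" "w \<in> V1" "w \<in> V" using yT by blast
    have "?a y \<in> \<phi> ` (U \<inter> V)" using yT by blast
    then obtain s where s: "s \<in> U" "s \<in> V" "\<phi> w = \<phi> s" using i1[OF w(2)] w(1) by auto
    then have "w = s" using inj_onD[OF smooth_manifoldD(1)[OF A V(1)] s(3) w(3)] by blast
    then show ?thesis using w s by blast
  qed
  have "smooth_on \<sigma> (\<phi> ` (U \<inter> V))"
    unfolding \<sigma>_def[abs_def]
    by (intro smooth_on_Pair fV smooth_on_linear bounded_linear_ident smooth_on_euclidean_gradient)
  then have "smooth_on (\<lambda>y. \<sigma> (?a y)) ?T"
    by (rule smooth_on_compose[OF oT fV(1) _ smooth_on_subset[OF tr(2)], rotated 2]) auto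
  then have "smooth_on (\<kappa> \<circ> exact_one_form A f \<circ> inv_into V1 \<phi>1) ?T"
  proof (rule smooth_on_cong[OF oT, rotated])
    fix y assume "y \<in> ?T"
    then obtain w where w: "y = \<phi>1 w" "w \<in> V1" "w \<in> V" "w \<in> U" using T by blast
    show "\<sigma> (?a y) = (\<kappa> \<circ> exact_one_form A f \<circ> inv_into V1 \<phi>1) y"
      unfolding w(1) V(3) o_apply i1[OF w(2)] cotangent_chart_exact_one_form[OF A f V(1) w(4,3), unfolded o_def]
      by (simp add: \<sigma>_def o_def)
  qed
  moreover have "\<phi>1 x \<in> ?T" using x(1,2) xV i1[OF x(2)] by auto
  moreover have "?T \<subseteq> \<phi>1 ` (U \<inter> V1 \<inter> exact_one_form A f -` W)"
  proof
    fix y assume "y \<in> ?T"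
    then obtain w where w: "y = \<phi>1 w" "w \<in> V1" "w \<in> V" "w \<in> U" using T by blast
    then have "w \<in> U \<inter> V1 \<inter> exact_one_form A f -` W" by (simp add: V(2) exact_one_form_def)
    then show "y \<in> \<phi>1 ` (U \<inter> V1 \<inter> exact_one_form A f -` W)" using w(1) by blast
  qed
  ultimately show "\<exists>T. open T \<and> \<phi>1 x \<in> T \<and> T \<subseteq> \<phi>1 ` (U \<inter> V1 \<inter> exact_one_form A f -` W) \<and>
      smooth_on (\<kappa> \<circ> exact_one_form A f \<circ> inv_into V1 \<phi>1) T"
    using oT by blast
qed

text \<open>The inverse of \<open>\<Psi>\<close> is the map of interest, as it brings curves in the
  image of a one-form back into the submanifold. Its coordinate form at the fixed point has an
  injective derivative because the coordinate form of \<open>\<Psi>\<close> undoes it.\<close>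

lemma diffeomorphism_chart_derivative:
  assumes inj: "inj_on \<kappa> V" and V: "(V, \<kappa>) \<in> C" and \<Psi>: "diffeomorphism C C W W' \<Psi>"
    and z: "z \<in> W" "\<Psi> z = z" "z \<in> V"
  defines "m \<equiv> \<kappa> \<circ> inv_into W \<Psi> \<circ> inv_into V \<kappa>"
  shows "smooth_at m (\<kappa> z)" "linear (frechet_derivative m (at (\<kappa> z)))"
    "inj (frechet_derivative m (at (\<kappa> z)))"
proof -
  let ?\<Psi>' = "inv_into W \<Psi>"
  have bij: "bij_betw \<Psi> W W'" and s: "smooth_map C C W \<Psi>" "smooth_map C C W' ?\<Psi>'"
    using \<Psi> by (auto simp: diffeomorphism_def)
  have \<Psi>'z: "?\<Psi>' z = z" using inv_into_f_f[OF bij_betw_imp_inj_on[OF bij] z(1)] z(2) by simp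
  have zW': "z \<in> W'" using bij z(1,2) by (metis bij_betwE)
  note i = inv_into_f_f[OF inj]
  note m = smooth_mapD[OF s(2) V V, folded m_def]
  let ?O = "\<kappa> ` (W' \<inter> V \<inter> ?\<Psi>' -` V)"
  have zO: "\<kappa> z \<in> ?O" using zW' z(3) \<Psi>'z by auto
  show sm: "smooth_at m (\<kappa> z)" by (rule smooth_atI[OF m(1) zO m(2)])
  then show "linear (frechet_derivative m (at (\<kappa> z)))" by (rule smooth_at_linear_derivative)
  define m' where "m' = \<kappa> \<circ> \<Psi> \<circ> inv_into V \<kappa>"
  note m' = smooth_mapD[OF s(1) V V, folded m'_def]
  have mz: "m (\<kappa> z) = \<kappa> z" by (simp add: m_def i[OF z(3)] \<Psi>'z)
  have "\<kappa> z \<in> \<kappa> ` (W \<inter> V \<inter> \<Psi> -` V)" using z by auto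
  from smooth_atI[OF m'(1) this m'(2)] have sm': "smooth_at m' (m (\<kappa> z))" by (simp add: mz)
  have "\<forall>\<^sub>F y in nhds (\<kappa> z). m' (m y) = y"
    unfolding eventually_nhds
  proof (intro exI conjI ballI)
    show "open ?O" "\<kappa> z \<in> ?O" by (rule m(1), rule zO)
    fix y assume "y \<in> ?O"
    then obtain w where w: "y = \<kappa> w" "w \<in> W'" "w \<in> V" "?\<Psi>' w \<in> V" by blast
    have "w \<in> \<Psi> ` W" using w(2) bij_betw_imp_surj_on[OF bij] by simp
    then show "m' (m y) = y"
      by (simp add: m_def m'_def w(1) i[OF w(3)] i[OF w(4)] f_inv_into_f)
  qed
  from frechet_derivative_cong_nhds[OF this]
  have "frechet_derivative (\<lambda>y. m' (m y)) (at (\<kappa> z)) v = v" for v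
    using frechet_derivative_eqI[OF has_derivative_ident, of "\<kappa> z"] by simp
  then have "frechet_derivative m' (at (m (\<kappa> z))) (frechet_derivative m (at (\<kappa> z)) v) = v" for v
    using frechet_derivative_chain[OF sm sm', of v] by simp
  then show "inj (frechet_derivative m (at (\<kappa> z)))" by (metis injI)
qed

text \<open>The witness is the curve obtained by moving straight with velocity \<open>v\<close> in
  the base chart, lifting by the one-form and applying the inverse of \<open>\<Psi>\<close>. The
  lift has coordinate velocity \<open>v\<close> together with the derivative of the gradient along
  \<open>v\<close>.\<close>

lemma tangent_vector_of_exact_one_form:
  fixes A :: "('n, 'a::euclidean_space) atlas"
  defines "C \<equiv> cotangent_atlas A"
  assumes A: "smooth_manifold A" "(V, \<phi>) \<in> A"
    and chart: "chart_at C z = (V \<times> UNIV, cotangent_chart A V \<phi>)"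
    and \<Psi>: "diffeomorphism C C W W' \<Psi>" "z \<in> W" "\<Psi> z = z"
    and G: "smooth_map A euclidean_atlas U G" "\<Psi> ` (L \<inter> W) = exact_one_form A G ` U"
      "exact_one_form A G (fst z) = z"
    and z: "fst z \<in> U" "fst z \<in> V"
  shows "frechet_derivative (cotangent_chart A V \<phi> \<circ> inv_into W \<Psi> \<circ> inv_into (V \<times> UNIV) (cotangent_chart A V \<phi>))
      (at (cotangent_chart A V \<phi> z))
      (v, frechet_derivative (euclidean_gradient (G \<circ> inv_into V \<phi>)) (at (\<phi> (fst z))) v)
    \<in> tangent_space C L z"
proof -
  define \<kappa> where "\<kappa> = cotangent_chart A V \<phi>"
  define m where "m = \<kappa> \<circ> inv_into W \<Psi> \<circ> inv_into (V \<times> UNIV) \<kappa>"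
  let ?g = "euclidean_gradient (G \<circ> inv_into V \<phi>)" and ?y = "\<phi> (fst z)"
  have VC: "(V \<times> UNIV, \<kappa>) \<in> C" using A(2) by (auto simp: C_def cotangent_atlas_eq \<kappa>_def)
  have injC: "inj_on \<kappa> U" if "(U, \<kappa>) \<in> C" for U \<kappa> using inj_cotangent_atlas[OF A(1)] that by (simp add: C_def)
  have zV: "z \<in> V \<times> UNIV" using z(2) by (cases z) auto
  note sm = diffeomorphism_chart_derivative(1)[OF injC[OF VC] VC \<Psi> zV, folded m_def]
  have bij: "bij_betw \<Psi> W W'" and s: "smooth_map C C W' (inv_into W \<Psi>)"
    using \<Psi>(1) by (auto simp: diffeomorphism_def)
  note i\<Psi> = inv_into_f_f[OF bij_betw_imp_inj_on[OF bij]]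
  note i = inv_into_f_f[OF smooth_manifoldD(1)[OF A]]
  note GV = function_in_chart[OF G(1) A(2)]
  \<comment> \<open>The straight line need only be followed for a short time, so long as it stays in
    the open chart image.\<close>
  let ?l = "\<lambda>s::real. ?y + s *\<^sub>R v"
  have "open (?l -` (\<phi> ` (U \<inter> V)))" by (rule open_vimage[OF GV(1)]) (intro continuous_intros)
  moreover have "0 \<in> ?l -` (\<phi> ` (U \<inter> V))" using z by auto
  ultimately obtain \<epsilon> where \<epsilon>: "\<epsilon> > 0" "ball 0 \<epsilon> \<subseteq> ?l -` (\<phi> ` (U \<inter> V))"
    using open_contains_ball by metis
  define I where "I = {-\<epsilon><..<\<epsilon>}"
  have I: "open I" "0 \<in> I" using \<epsilon>(1) by (auto simp: I_def)
  have lI: "?l s \<in> \<phi> ` (U \<inter> V)" if "s \<in> I" for s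
    using \<epsilon>(2) that by (auto simp: I_def ball_eq_greaterThanLessThan)
  define x where "x s = inv_into V \<phi> (?l s)" for s
  have x: "x s \<in> U" "x s \<in> V" "\<phi> (x s) = ?l s" if sI: "s \<in> I" for s
  proof -
    obtain w where "w \<in> U" "w \<in> V" "?l s = \<phi> w" using lI[OF sI] by blast
    then show "x s \<in> U" "x s \<in> V" "\<phi> (x s) = ?l s" using i[of w] by (simp_all add: x_def)
  qed
  have sl: "smooth_on ?l I"
    by (intro smooth_on_add[OF I(1) smooth_on_const] smooth_on_linear[OF I(1)] bounded_linear_scaleR_left)
  have "smooth_map euclidean_atlas A I x"
    unfolding x_def[abs_def] by (rule smooth_map_inverse_chart[OF A I(1) sl]) (use lI in blast)
  from smooth_map_compose[OF inj_euclidean_atlas smooth_manifoldD(1)[OF A(1)] this smooth_map_exact_one_form[OF A(1) G(1)]]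
  have s\<alpha>: "smooth_map euclidean_atlas C I (exact_one_form A G \<circ> x)" using x(1) by (auto simp: C_def)
  define \<gamma> where "\<gamma> = inv_into W \<Psi> \<circ> (exact_one_form A G \<circ> x)"
  have \<alpha>: "\<exists>w. w \<in> L \<and> w \<in> W \<and> exact_one_form A G (x s) = \<Psi> w" if "s \<in> I" for s
  proof -
    have "exact_one_form A G (x s) \<in> \<Psi> ` (L \<inter> W)" unfolding G(2) using x(1)[OF that] by blast
    then show ?thesis by blast
  qed
  have \<alpha>W: "(exact_one_form A G \<circ> x) ` I \<subseteq> W'" using \<alpha> bij_betwE[OF bij] by fastforce
  have s\<gamma>: "smooth_map euclidean_atlas C I \<gamma>"
    unfolding \<gamma>_def by (rule smooth_map_compose[OF inj_euclidean_atlas injC s\<alpha> s \<alpha>W])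
  have \<gamma>L: "\<gamma> ` I \<subseteq> L"
  proof
    fix p assume "p \<in> \<gamma> ` I"
    then obtain s where s: "s \<in> I" "p = \<gamma> s" by blast
    obtain w where "w \<in> L" "w \<in> W" "exact_one_form A G (x s) = \<Psi> w" using \<alpha>[OF s(1)] by blast
    then show "p \<in> L" using i\<Psi>[of w] by (simp add: s(2) \<gamma>_def)
  qed
  have x0: "x 0 = fst z" using i[OF z(2)] by (simp add: x_def)
  have \<gamma>0: "\<gamma> 0 = z" using i\<Psi>[OF \<Psi>(2)] by (simp add: \<gamma>_def x0 G(3) \<Psi>(3))
  define \<beta> where "\<beta> s = (?l s, ?g (?l s))" for s
  have \<kappa>\<alpha>: "\<kappa> (exact_one_form A G (x s)) = \<beta> s" if "s \<in> I" for s
    unfolding \<kappa>_def cotangent_chart_exact_one_form[OF A(1) G(1) A(2) x(1,2)[OF that]] x(3)[OF that]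
    by (simp add: \<beta>_def)
  have \<beta>0: "\<beta> 0 = \<kappa> z" using \<kappa>\<alpha>[OF I(2)] by (simp add: x0 G(3))
  have "smooth_at ?g ?y"
    by (rule smooth_atI[OF GV(1) _ smooth_on_euclidean_gradient[OF GV]]) (use z in blast)
  then have dg: "(?g has_derivative frechet_derivative ?g (at ?y)) (at (?l 0))"
    using smooth_at_has_derivative by simp
  have dl: "(?l has_derivative (\<lambda>t. t *\<^sub>R v)) (at 0)" by (auto intro!: derivative_eq_intros)
  have d\<beta>: "(\<beta> has_derivative (\<lambda>t. (t *\<^sub>R v, frechet_derivative ?g (at ?y) (t *\<^sub>R v)))) (at 0)"
    unfolding \<beta>_def[abs_def] by (rule has_derivative_Pair[OF dl has_derivative_compose[OF dl dg]])
  have "((\<lambda>s. m (\<beta> s)) has_derivative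
      (\<lambda>t. frechet_derivative m (at (\<kappa> z)) (t *\<^sub>R v, frechet_derivative ?g (at ?y) (t *\<^sub>R v)))) (at 0)"
    by (rule has_derivative_compose[OF d\<beta>]) (use smooth_at_has_derivative[OF sm] \<beta>0 in simp)
  then have "((\<kappa> \<circ> \<gamma>) has_derivative
      (\<lambda>t. frechet_derivative m (at (\<kappa> z)) (t *\<^sub>R v, frechet_derivative ?g (at ?y) (t *\<^sub>R v)))) (at 0)"
  proof (rule has_derivative_transform_within_open[OF _ I])
    fix s assume s: "s \<in> I"
    have "exact_one_form A G (x s) \<in> V \<times> UNIV" using x(2)[OF s] by (simp add: exact_one_form_def)
    from inv_into_f_f[OF injC[OF VC] this]
    show "m (\<beta> s) = (\<kappa> \<circ> \<gamma>) s" unfolding \<kappa>\<alpha>[OF s, symmetric] by (simp add: m_def \<gamma>_def)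
  qed
  \<comment> \<open>\<open>chart\<close> says that this cotangent chart is the one selected at
    \<open>z\<close>, so the coordinate velocity is the tangent vector in the sense of
    \<open>tangent_map\<close>.\<close>
  from frechet_derivative_eqI[OF this]
  have "tangent_map euclidean_atlas C \<gamma> 0 1 =
      frechet_derivative m (at (\<kappa> z)) (v, frechet_derivative ?g (at ?y) v)"
    unfolding tangent_map_def \<gamma>0 chart chart_at_euclidean_atlas chart_inv_def fst_conv snd_conv inv_into_UNIV_id
    by (simp add: \<kappa>_def o_def)
  then show ?thesis
    unfolding tangent_space_def using \<epsilon>(1) s\<gamma> \<gamma>L \<gamma>0 unfolding I_def m_def \<kappa>_def by force
qed

section \<open>The singularity of a local Lagrangian intersection problem\<close>

text \<open>Translates a normal form centred at 0 in a chart into the manifold, and a set of basis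
  vectors into a set of coordinate indices.\<close>

lemma obtainable_from_normal_form:
  fixes A :: "('n, real^'d) atlas" and \<mu>s :: "'p::euclidean_space" and y0 :: "real^'d"
    and M :: "(real^'d) set"
  assumes A: "smooth_manifold A" "(V, \<phi>) \<in> A" and xs: "xs \<in> V" "\<phi> xs = y0"
    and M: "M \<subseteq> Basis" "\<And>b. b \<in> M \<Longrightarrow> e b \<noteq> 0"
    and JT: "open J'" "\<mu>s \<in> J'" "J' \<subseteq> J" "open T" "0 \<in> T"
    and \<theta>0: "\<theta>0 \<mu>s 0 = 0" "\<And>\<mu> t. \<mu> \<in> J' \<Longrightarrow> t \<in> T \<Longrightarrow> y0 + \<theta>0 \<mu> t \<in> \<phi> ` (U \<inter> V)"
      "smooth_on (\<lambda>(\<mu>, t). \<theta>0 \<mu> t) (J' \<times> T)"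
      "\<And>\<mu> t. \<mu> \<in> J' \<Longrightarrow> t \<in> T \<Longrightarrow> \<theta>' \<mu> (\<theta>0 \<mu> t) = t"
      "\<And>\<mu>. \<mu> \<in> J' \<Longrightarrow> open (\<theta>0 \<mu> ` T)" "\<And>\<mu>. \<mu> \<in> J' \<Longrightarrow> smooth_on (\<theta>' \<mu>) (\<theta>0 \<mu> ` T)"
    and g: "smooth_on (\<lambda>(\<mu>, t). g \<mu> t) (J' \<times> UNIV)"
      "\<And>\<mu> s t. (\<And>b. b \<in> Basis - M \<Longrightarrow> s \<bullet> b = t \<bullet> b) \<Longrightarrow> g \<mu> s = g \<mu> t"
    and h: "\<And>\<mu> t. \<mu> \<in> J' \<Longrightarrow> t \<in> T \<Longrightarrow>
      h \<mu> (inv_into V \<phi> (y0 + \<theta>0 \<mu> t)) = g \<mu> t + (\<Sum>b\<in>M. e b * (t \<bullet> b)\<^sup>2)"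
  shows "obtainable_in_gradient_zero_problem (card (Basis - M)) A \<mu>s xs J U h"
proof -
  define \<theta> where "\<theta> \<mu> t = inv_into V \<phi> (y0 + \<theta>0 \<mu> t)" for \<mu> t
  \<comment> \<open>The basis of \<open>real^'d\<close> consists of the vectors
    \<open>axis i 1\<close>; \<open>K\<close> indexes those outside \<open>M\<close>, the variables
    left in the gradient-zero-problem.\<close>
  define K where "K = {i. axis i 1 \<notin> M}"
  define Q where "Q t = (\<Sum>b\<in>M. e b * (t \<bullet> b)\<^sup>2)" for t
  let ?ax = "\<lambda>i::'d. axis i (1::real)"
  note i = inv_into_f_f[OF smooth_manifoldD(1)[OF A]]
  have ax: "t \<bullet> ?ax i = t $ i" for t :: "real^'d" and i by (simp add: cart_eq_inner_axis)
  have axB: "?ax i \<in> Basis" for i by (simp add: axis_in_Basis_iff)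
  have Bax: "\<exists>i. b = ?ax i" if "b \<in> Basis" for b :: "real^'d" using that by (auto simp: Basis_vec_def)
  have injax: "inj_on ?ax S" for S by (auto simp: inj_on_def axis_eq_axis)
  have imK: "?ax ` K = Basis - M" using axB Bax by (auto simp: K_def)
  have imM: "?ax ` (- K) = M" using M(1) Bax by (auto simp: K_def)
  have cardK: "card K = card (Basis - M)" unfolding imK[symmetric] by (rule card_image[OF injax, symmetric])
  have \<theta>: "\<theta> \<mu> t \<in> U" "\<theta> \<mu> t \<in> V" "\<phi> (\<theta> \<mu> t) = y0 + \<theta>0 \<mu> t" if \<mu>t: "\<mu> \<in> J'" "t \<in> T" for \<mu> t
  proof -
    obtain w where "w \<in> U" "w \<in> V" "y0 + \<theta>0 \<mu> t = \<phi> w" using \<theta>0(2)[OF \<mu>t] by blast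
    then show "\<theta> \<mu> t \<in> U" "\<theta> \<mu> t \<in> V" "\<phi> (\<theta> \<mu> t) = y0 + \<theta>0 \<mu> t" using i[of w] by (simp_all add: \<theta>_def)
  qed
  have op: "open (J' \<times> T)" by (rule open_Times[OF JT(1,4)])
  have "smooth_map euclidean_atlas A (J' \<times> T) (\<lambda>z. inv_into V \<phi> ((\<lambda>z. y0 + (\<lambda>(\<mu>, t). \<theta>0 \<mu> t) z) z))"
    by (rule smooth_map_inverse_chart[OF A op smooth_on_add[OF op smooth_on_const \<theta>0(3)]])
      (use \<theta>0(2) in auto)
  then have sm: "smooth_map euclidean_atlas A (J' \<times> T) (\<lambda>(\<mu>, t). \<theta> \<mu> t)"
    by (simp add: \<theta>_def case_prod_unfold)
  have diffeo: "diffeomorphism euclidean_atlas A T (\<theta> \<mu> ` T) (\<theta> \<mu>)" if \<mu>: "\<mu> \<in> J'" for \<mu>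
    unfolding diffeomorphism_def
  proof (intro conjI)
    have inj: "inj_on (\<theta> \<mu>) T"
    proof (rule inj_onI)
      fix s t assume st: "s \<in> T" "t \<in> T" "\<theta> \<mu> s = \<theta> \<mu> t"
      then have "\<theta>0 \<mu> s = \<theta>0 \<mu> t" using \<theta>(3)[OF \<mu> st(1)] \<theta>(3)[OF \<mu> st(2)] by simp
      then show "s = t" using \<theta>0(4)[OF \<mu> st(1)] \<theta>0(4)[OF \<mu> st(2)] by metis
    qed
    then show "bij_betw (\<theta> \<mu>) T (\<theta> \<mu> ` T)" by (rule inj_on_imp_bij_betw)
    have "smooth_on (\<lambda>t. (\<lambda>(\<mu>, t). \<theta>0 \<mu> t) (\<mu>, t)) T"
      by (rule smooth_on_compose[OF JT(4) op _
            smooth_on_Pair[OF JT(4) smooth_on_const smooth_on_linear[OF JT(4) bounded_linear_ident]] \<theta>0(3)])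
        (use \<mu> in auto)
    then have s0: "smooth_on (\<lambda>t. y0 + \<theta>0 \<mu> t) T"
      by (intro smooth_on_add[OF JT(4) smooth_on_const]) simp
    show "smooth_map euclidean_atlas A T (\<theta> \<mu>)"
      unfolding \<theta>_def[abs_def]
      by (rule smooth_map_inverse_chart[OF A JT(4) s0]) (use \<theta>0(2)[OF \<mu>] in auto)
    \<comment> \<open>The inverse of \<open>\<theta> \<mu>\<close> in the chart: undo the centring
      at \<open>y0\<close>, then apply the given inverse.\<close>
    define \<sigma> where "\<sigma> y = \<theta>' \<mu> (y - y0)" for y
    have im: "\<phi> ` (\<theta> \<mu> ` T) = (+) y0 ` (\<theta>0 \<mu> ` T)"
      using \<theta>(3)[OF \<mu>] by (auto simp: image_iff)
    have op': "open (\<phi> ` (\<theta> \<mu> ` T))" unfolding im by (rule open_translation[OF \<theta>0(5)[OF \<mu>]])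
    show "smooth_map A euclidean_atlas (\<theta> \<mu> ` T) (inv_into T (\<theta> \<mu>))"
    proof (rule smooth_map_via_chart[OF A _ op'])
      show "\<theta> \<mu> ` T \<subseteq> V" using \<theta>(2)[OF \<mu>] by blast
      show "smooth_on \<sigma> (\<phi> ` (\<theta> \<mu> ` T))"
        unfolding \<sigma>_def[abs_def]
        by (rule smooth_on_compose[OF op' \<theta>0(5)[OF \<mu>] _
              smooth_on_diff[OF op' smooth_on_linear[OF op' bounded_linear_ident] smooth_on_const] \<theta>0(6)[OF \<mu>]])
          (auto simp: im)
      fix x assume "x \<in> \<theta> \<mu> ` T"
      then obtain t where t: "t \<in> T" "x = \<theta> \<mu> t" by blast
      show "inv_into T (\<theta> \<mu>) x = \<sigma> (\<phi> x)"
        using inv_into_f_f[OF inj t(1)] \<theta>(3)[OF \<mu> t(1)] \<theta>0(4)[OF \<mu> t(1)] by (simp add: \<sigma>_def t(2))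
    qed
  qed
  have \<theta>U: "\<theta> \<mu> ` T \<subseteq> U" if "\<mu> \<in> J'" for \<mu> using \<theta>(1)[OF that] by blast
  have \<theta>xs: "\<theta> \<mu>s 0 = xs" using i[OF xs(1)] by (simp add: \<theta>_def \<theta>0(1) xs(2))
  have gK: "g \<mu> s = g \<mu> t" if st: "\<forall>i\<in>K. s $ i = t $ i" for \<mu> s t
  proof (rule g(2))
    fix b assume "b \<in> Basis - M"
    then obtain i where "i \<in> K" "b = ?ax i" unfolding imK[symmetric] by blast
    then show "s \<bullet> b = t \<bullet> b" using st by (simp add: ax)
  qed
  have Qq: "nondegenerate_quadratic_form (- K) Q"
    unfolding nondegenerate_quadratic_form_def
  proof (intro exI conjI ballI allI impI)
    \<comment> \<open>A diagonal matrix, nondegenerate because the coefficients \<open>e b\<close>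
      are nonzero.\<close>
    let ?B = "\<lambda>i j. if i = j then e (?ax i) else 0"
    show "?B i j = ?B j i" for i j by simp
    have row: "(\<Sum>j\<in>- K. ?B i j * x j) = e (?ax i) * x i" if i: "i \<in> - K" for i x
    proof -
      have "(\<Sum>j\<in>- K. ?B i j * x j) = (\<Sum>j\<in>- K. if i = j then e (?ax i) * x i else 0)"
        by (rule sum.cong) auto
      then show ?thesis using i by simp
    qed
    show "Q t = (\<Sum>i\<in>- K. \<Sum>j\<in>- K. ?B i j * t $ i * t $ j)" for t
    proof -
      have "Q t = (\<Sum>i\<in>- K. e (?ax i) * (t $ i)\<^sup>2)"
        unfolding Q_def imM[symmetric] sum.reindex[OF injax] by (simp add: ax)
      also have "\<dots> = (\<Sum>i\<in>- K. \<Sum>j\<in>- K. ?B i j * (t $ i * t $ j))"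
      proof (rule sum.cong[OF refl])
        fix i assume "i \<in> - K"
        from row[OF this, of "\<lambda>j. t $ i * t $ j"]
        show "e (?ax i) * (t $ i)\<^sup>2 = (\<Sum>j\<in>- K. ?B i j * (t $ i * t $ j))" by (simp add: power2_eq_square)
      qed
      finally show ?thesis by (simp add: mult.assoc)
    qed
    fix t :: "real^'d" and j
    assume t: "\<forall>i\<in>- K. (\<Sum>j\<in>- K. ?B i j * t $ j) = 0" and j: "j \<in> - K"
    have "e (?ax j) * t $ j = 0" using t j row[OF j, of "\<lambda>j. t $ j"] by simp
    moreover have "?ax j \<in> M" using j by (simp add: K_def)
    ultimately show "t $ j = 0" using M(2) by auto
  qed
  \<comment> \<open>A function of the parameter alone can be absorbed into \<open>g\<close>, so
    \<open>c\<close> is taken to be zero.\<close>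
  have eq: "h \<mu> (\<theta> \<mu> t) = g \<mu> t + Q t + (\<lambda>_. 0) \<mu>" if "\<mu> \<in> J'" "t \<in> T" for \<mu> t
    using h[OF that] by (simp add: \<theta>_def Q_def)
  show ?thesis
    unfolding obtainable_in_gradient_zero_problem_def
  proof (rule exI[of _ J'], rule exI[of _ T], rule exI[of _ \<theta>], rule exI[of _ K], rule exI[of _ g],
      rule exI[of _ Q], rule exI[of _ "\<lambda>_. 0"], intro conjI)
    show "\<forall>\<mu>\<in>J'. diffeomorphism euclidean_atlas A T (\<theta> \<mu> ` T) (\<theta> \<mu>) \<and> \<theta> \<mu> ` T \<subseteq> U"
      using diffeo \<theta>U by blast
    show "\<forall>\<mu>\<in>J'. \<forall>s t. (\<forall>i\<in>K. s $ i = t $ i) \<longrightarrow> g \<mu> s = g \<mu> t"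
      by (intro ballI allI impI) (rule gK)
    show "\<forall>\<mu>\<in>J'. \<forall>t\<in>T. h \<mu> (\<theta> \<mu> t) = g \<mu> t + Q t + 0" using eq by blast
  qed (fact JT sm \<theta>xs cardK g(1) Qq)+
qed

theorem proposition3p2:
  fixes A :: "('n, real^'d) atlas"
    and I :: "(real^'p) set"
    and \<Lambda> \<Gamma> :: "(real^'p) \<Rightarrow> ('n \<times> (real^'d)) set"
    and \<mu>s :: "real^'p" and zs :: "'n \<times> (real^'d)"
    and J :: "(real^'p) set" and U :: "'n set" and h :: "real^'p \<Rightarrow> 'n \<Rightarrow> real"
    and m :: nat
  assumes "smooth_manifold A"
    and "local_Lagrangian_intersection_problem A I \<Lambda> \<Gamma> \<mu>s zs"
    and "m = dim (tangent_space (cotangent_atlas A) (\<Lambda> \<mu>s) zs \<inter>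
                  tangent_space (cotangent_atlas A) (\<Gamma> \<mu>s) zs)"
    and "singularity_occurring_at A I \<Lambda> \<Gamma> \<mu>s zs J U h"
  shows "\<exists>k\<le>m. obtainable_in_gradient_zero_problem k A \<mu>s (fst zs) J U h"
proof -
  let ?C = "cotangent_atlas A" and ?x = "fst zs"
  note A = assms(1)
  note sing = assms(4)[unfolded singularity_occurring_at_def]
  have J: "open J" "\<mu>s \<in> J" "?x \<in> U" using sing by simp_all
  obtain W W' \<Psi> f g where S: "symplectomorphism A W W' \<Psi> \<and> zs \<in> W \<and> \<Psi> zs = zs \<and>
      smooth_family_of_functions A J U f \<and> smooth_family_of_functions A J U g \<and>
      (\<forall>\<mu>\<in>J. \<Psi> ` (\<Gamma> \<mu> \<inter> W) = exact_one_form A (f \<mu>) ` U) \<and>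
      (\<forall>\<mu>\<in>J. \<Psi> ` (\<Lambda> \<mu> \<inter> W) = exact_one_form A (g \<mu>) ` U) \<and>
      (\<forall>\<mu>\<in>J. \<forall>x\<in>U. h \<mu> x = f \<mu> x - g \<mu> x)"
    using sing by (elim conjE exE) (rule that, intro conjI)
  have zW: "zs \<in> W" "\<Psi> zs = zs" and f: "smooth_family_of_functions A J U f"
    and g: "smooth_family_of_functions A J U g" using S by simp_all
  have \<Gamma>: "\<Psi> ` (\<Gamma> \<mu> \<inter> W) = exact_one_form A (f \<mu>) ` U"
    and \<Lambda>: "\<Psi> ` (\<Lambda> \<mu> \<inter> W) = exact_one_form A (g \<mu>) ` U" if "\<mu> \<in> J" for \<mu>
    using S that by simp_all
  have h: "h \<mu> x = f \<mu> x - g \<mu> x" if "\<mu> \<in> J" "x \<in> U" for \<mu> x using S that by simp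
  have \<Psi>: "diffeomorphism ?C ?C W W' \<Psi>"
    using S by (simp add: symplectomorphism_def)
  have z\<Lambda>\<Gamma>: "zs \<in> \<Lambda> \<mu>s" "zs \<in> \<Gamma> \<mu>s"
    using assms(2) by (simp_all add: local_Lagrangian_intersection_problem_def)
  \<comment> \<open>A one-form is a section, so a point of its image is its value at the base point
    of that point.\<close>
  have ez: "exact_one_form A F ?x = zs" if "zs \<in> exact_one_form A F ` U" for F
  proof -
    obtain x where "zs = exact_one_form A F x" using \<open>zs \<in> exact_one_form A F ` U\<close> by blast
    moreover from this have "?x = x" by (simp add: exact_one_form_def)
    ultimately show ?thesis by simp
  qed
  have z\<Psi>: "zs \<in> \<Psi> ` (\<Gamma> \<mu>s \<inter> W)" "zs \<in> \<Psi> ` (\<Lambda> \<mu>s \<inter> W)"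
    using zW z\<Lambda>\<Gamma> by (metis IntI imageI)+
  have fz: "exact_one_form A (f \<mu>s) ?x = zs" by (rule ez[OF z\<Psi>(1)[unfolded \<Gamma>[OF J(2)]]])
  have gz: "exact_one_form A (g \<mu>s) ?x = zs" by (rule ez[OF z\<Psi>(2)[unfolded \<Lambda>[OF J(2)]]])
  have "zs \<in> carrier ?C" using \<Psi> zW(1) unfolding diffeomorphism_def smooth_map_def by blast
  \<comment> \<open>The base chart is read off from the cotangent chart selected at
    \<open>zs\<close>; velocities computed in it are then elements of \<open>tangent_space\<close>
    literally.\<close>
  from chart_at_mem[OF this] obtain V \<phi> where V: "(V, \<phi>) \<in> A"
    and chart: "chart_at ?C zs = (V \<times> UNIV, cotangent_chart A V \<phi>)" and xV: "?x \<in> V"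
    by (cases zs) (auto simp: cotangent_atlas_eq)
  note i = inv_into_f_f[OF smooth_manifoldD(1)[OF A V]]
  define y0 where "y0 = \<phi> ?x"
  define O' where "O' = \<phi> ` (U \<inter> V)"
  define F where "F = f \<mu>s \<circ> inv_into V \<phi>"
  define G where "G = g \<mu>s \<circ> inv_into V \<phi>"
  have sf: "smooth_map A euclidean_atlas U (f \<mu>s)" and sg: "smooth_map A euclidean_atlas U (g \<mu>s)"
    by (rule smooth_map_of_family[OF f A J(2)], rule smooth_map_of_family[OF g A J(2)])
  have O': "open O'" "y0 \<in> O'"
    using function_in_chart(1)[OF sf V] J(3) xV by (auto simp: O'_def y0_def)
  have F: "smooth_on F O'" and G: "smooth_on G O'"
    unfolding F_def G_def O'_def by (rule function_in_chart(2)[OF sf V], rule function_in_chart(2)[OF sg V])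
  have inO: "inv_into V \<phi> y \<in> U" if yO: "y \<in> O'" for y
  proof -
    obtain w where "w \<in> U" "w \<in> V" "y = \<phi> w" using yO unfolding O'_def by blast
    then show ?thesis using i[of w] by simp
  qed

  \<comment> \<open>The family as one function of parameter and variable, with the base point moved
    to the origin of the chart.\<close>
  define h0 where "h0 z = h (fst z) (inv_into V \<phi> (y0 + snd z))" for z
  define N where "N = (\<lambda>z. (fst z, y0 + snd z)) -` (J \<times> O')"
  have N: "open N" unfolding N_def by (rule open_vimage[OF open_Times[OF J(1) O'(1)]]) (intro continuous_intros)
  have zN: "(\<mu>s, 0) \<in> N" using J(2) O'(2) by (simp add: N_def)
  have "smooth_on h0 N"
  proof -
    have sh: "smooth_on (\<lambda>z. (fst z, y0 + snd z)) N"
      by (intro smooth_on_Pair[OF N] smooth_on_add[OF N smooth_on_const] smooth_on_linear[OF N]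
          bounded_linear_fst bounded_linear_snd)
    have "smooth_on (\<lambda>z. (\<lambda>(\<mu>, y). f \<mu> (inv_into V \<phi> y)) z - (\<lambda>(\<mu>, y). g \<mu> (inv_into V \<phi> y)) z) (J \<times> O')"
      unfolding O'_def
      by (intro smooth_on_diff smooth_family_in_chart[OF f A V] smooth_family_in_chart[OF g A V])
    from smooth_on_compose[OF N open_Times[OF J(1) O'(1)] _ sh this]
    have "smooth_on (\<lambda>z. f (fst z) (inv_into V \<phi> (y0 + snd z)) - g (fst z) (inv_into V \<phi> (y0 + snd z))) N"
      by (auto simp: N_def)
    then show ?thesis
      by (rule smooth_on_cong[OF N, rotated]) (simp add: h0_def N_def h inO)
  qed
  then have h0: "smooth_at h0 z" if "z \<in> N" for z using N that smooth_at_iff by blast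
  let ?gF = "euclidean_gradient F" and ?gG = "euclidean_gradient G"
  have dslice: "((\<lambda>y. k (\<mu>s, y)) has_derivative (\<lambda>v. frechet_derivative k (at (\<mu>s, y)) (0, v))) (at y)"
    if k: "smooth_at k (\<mu>s, y)" for k :: "(real^'p) \<times> (real^'d) \<Rightarrow> real" and y
    by (rule has_derivative_compose[OF has_derivative_Pair[OF has_derivative_const has_derivative_ident]
          smooth_at_has_derivative[OF k]])
  have shift: "((\<lambda>y. y0 + y) has_derivative (\<lambda>v. v)) (at y)" for y :: "real^'d"
    by (auto intro!: derivative_eq_intros)
  have N0: "open ((\<lambda>y. y0 + y) -` O')" by (rule open_vimage[OF O'(1)]) (intro continuous_intros)
  \<comment> \<open>At the parameter \<open>\<mu>s\<close> the derivative of \<open>h0\<close> in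
    the variables is the difference of the two gradients, on a whole neighbourhood; this is what
    allows differentiating once more for the Hessian.\<close>
  have dh0: "frechet_derivative h0 (at (\<mu>s, y)) (0, v) = (?gF (y0 + y) - ?gG (y0 + y)) \<bullet> v"
    if y: "y0 + y \<in> O'" for y v
  proof -
    have sF: "smooth_at F (y0 + y)" and sG: "smooth_at G (y0 + y)"
      using F G smooth_at_iff[OF O'(1)] y by auto
    have "((\<lambda>y. F (y0 + y) - G (y0 + y)) has_derivative
        (\<lambda>v. frechet_derivative F (at (y0 + y)) v - frechet_derivative G (at (y0 + y)) v)) (at y)"
      by (intro has_derivative_diff has_derivative_compose[OF shift] smooth_at_has_derivative sF sG)
    moreover have "((\<lambda>y. F (y0 + y) - G (y0 + y)) has_derivative
        (\<lambda>v. frechet_derivative h0 (at (\<mu>s, y)) (0, v))) (at y)"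
      by (rule has_derivative_transform_within_open[OF dslice[OF h0] N0])
        (use y in \<open>auto simp: N_def J(2) h0_def h inO F_def G_def\<close>)
    ultimately have "(\<lambda>v. frechet_derivative h0 (at (\<mu>s, y)) (0, v)) =
        (\<lambda>v. frechet_derivative F (at (y0 + y)) v - frechet_derivative G (at (y0 + y)) v)"
      by (rule has_derivative_unique[rotated])
    from fun_cong[OF this, of v] show ?thesis
      by (simp add: inner_diff_left euclidean_gradient_inner smooth_at_linear_derivative sF sG)
  qed
  \<comment> \<open>Both one-forms take the value \<open>zs\<close> over the base point, so their
    momentum coordinates agree there.\<close>
  have "?gF y0 = ?gG y0"
    using cotangent_chart_exact_one_form[OF A sf V J(3) xV] cotangent_chart_exact_one_form[OF A sg V J(3) xV]
    unfolding fz gz by (simp add: F_def G_def y0_def)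
  then have crit: "frechet_derivative h0 (at (\<mu>s, 0)) (0, v) = 0" for v
    using dh0[of 0 v] O'(2) by simp
  obtain M :: "(real^'d) set" and e J' T \<theta> \<theta>' gg L where nf:
    "M \<subseteq> Basis" "\<And>b. b \<in> M \<Longrightarrow> e b \<noteq> 0" "open J'" "\<mu>s \<in> J'" "open T" "0 \<in> T"
    "\<theta> \<mu>s 0 = 0" "\<And>\<mu> t. \<mu> \<in> J' \<Longrightarrow> t \<in> T \<Longrightarrow> (\<mu>, \<theta> \<mu> t) \<in> N"
    "smooth_on (\<lambda>(\<mu>, t). \<theta> \<mu> t) (J' \<times> T)"
    "\<And>\<mu> t. \<mu> \<in> J' \<Longrightarrow> t \<in> T \<Longrightarrow> \<theta>' \<mu> (\<theta> \<mu> t) = t"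
    "\<And>\<mu>. \<mu> \<in> J' \<Longrightarrow> open (\<theta> \<mu> ` T)" "\<And>\<mu>. \<mu> \<in> J' \<Longrightarrow> smooth_on (\<theta>' \<mu>) (\<theta> \<mu> ` T)"
    "smooth_on (\<lambda>(\<mu>, t). gg \<mu> t) (J' \<times> UNIV)"
    "\<And>\<mu> s t. (\<And>b. b \<in> Basis - M \<Longrightarrow> s \<bullet> b = t \<bullet> b) \<Longrightarrow> gg \<mu> s = gg \<mu> t"
    "\<And>\<mu> t. \<mu> \<in> J' \<Longrightarrow> t \<in> T \<Longrightarrow> h0 (\<mu>, \<theta> \<mu> t) = gg \<mu> t + (\<Sum>b\<in>M. e b * (t \<bullet> b)\<^sup>2)"
    "linear L" "inj L"
    "\<And>b w. b \<in> Basis - M \<Longrightarrow>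
       frechet_derivative (\<lambda>z. frechet_derivative h0 (at z) (0, w)) (at (\<mu>s, 0)) (0, L b) = 0"
    by (rule parametric_normal_form[OF h0[OF zN] crit N zN]) blast
  have "obtainable_in_gradient_zero_problem (card (Basis - M)) A \<mu>s ?x J U h"
  proof (rule obtainable_from_normal_form[OF A V xV y0_def[symmetric] nf(1,2,3,4) _ nf(5,6,7) _ nf(9-14)])
    \<comment> \<open>Membership in \<open>N\<close> at \<open>t = 0\<close> forces the parameter to
      lie in \<open>J\<close>.\<close>
    show "J' \<subseteq> J" using nf(6) nf(8) by (force simp: N_def)
    show "y0 + \<theta> \<mu> t \<in> \<phi> ` (U \<inter> V)" if "\<mu> \<in> J'" "t \<in> T" for \<mu> t
      using nf(8)[OF that] by (simp add: N_def O'_def)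
    show "h \<mu> (inv_into V \<phi> (y0 + \<theta> \<mu> t)) = gg \<mu> t + (\<Sum>b\<in>M. e b * (t \<bullet> b)\<^sup>2)"
      if "\<mu> \<in> J'" "t \<in> T" for \<mu> t using nf(15)[OF that] by (simp add: h0_def)
  qed
  moreover have "card (Basis - M) \<le> m"
  proof -
    have sgF: "smooth_at ?gF y0" and sgG: "smooth_at ?gG y0"
      using smooth_on_euclidean_gradient[OF O'(1) F] smooth_on_euclidean_gradient[OF O'(1) G]
        O'(2) smooth_at_iff[OF O'(1)] by auto
    let ?dF = "frechet_derivative ?gF (at y0)" and ?dG = "frechet_derivative ?gG (at y0)"
    \<comment> \<open>A kernel vector of the Hessian of \<open>h\<close> is one along which both
      gradients have the same derivative; testing the difference against itself gives equality of
      vectors.\<close>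
    have hess: "?dF (L b) = ?dG (L b)" if b: "b \<in> Basis - M" for b
    proof -
      have "(?dF (L b) - ?dG (L b)) \<bullet> w = 0" for w
      proof -
        let ?k = "\<lambda>z. frechet_derivative h0 (at z) (0, w)"
        have "((\<lambda>y. ?k (\<mu>s, y)) has_derivative (\<lambda>v. frechet_derivative ?k (at (\<mu>s, 0)) (0, v))) (at 0)"
          by (rule dslice[OF smooth_at_frechet_derivative[OF h0[OF zN]]])
        then have "((\<lambda>y. (?gF (y0 + y) - ?gG (y0 + y)) \<bullet> w) has_derivative
            (\<lambda>v. frechet_derivative ?k (at (\<mu>s, 0)) (0, v))) (at 0)"
          by (rule has_derivative_transform_within_open[OF _ N0]) (use O'(2) dh0 in auto)
        moreover have "((\<lambda>y. (?gF (y0 + y) - ?gG (y0 + y)) \<bullet> w) has_derivative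
            (\<lambda>v. (?dF v - ?dG v) \<bullet> w)) (at 0)"
          by (intro has_derivative_inner_left has_derivative_diff has_derivative_compose[OF shift])
            (use smooth_at_has_derivative[OF sgF] smooth_at_has_derivative[OF sgG] in auto)
        ultimately have "(\<lambda>v. frechet_derivative ?k (at (\<mu>s, 0)) (0, v)) = (\<lambda>v. (?dF v - ?dG v) \<bullet> w)"
          by (rule has_derivative_unique)
        from fun_cong[OF this, of "L b"] show ?thesis using nf(18)[OF b, of w] by simp
      qed
      from this[of "?dF (L b) - ?dG (L b)"] show ?thesis by simp
    qed
    define D where "D = frechet_derivative (cotangent_chart A V \<phi> \<circ> inv_into W \<Psi> \<circ>
      inv_into (V \<times> UNIV) (cotangent_chart A V \<phi>)) (at (cotangent_chart A V \<phi> zs))"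
    have VC: "(V \<times> UNIV, cotangent_chart A V \<phi>) \<in> ?C" using V by (auto simp: cotangent_atlas_eq)
    have zV: "zs \<in> V \<times> UNIV" using xV by (cases zs) auto
    note D = diffeomorphism_chart_derivative(2,3)[OF inj_cotangent_atlas[OF A VC] VC \<Psi> zW zV, folded D_def]
    \<comment> \<open>The kernel vector is lifted to the tangent space of the graph of the gradient
      and moved back by the inverse symplectomorphism. By \<open>hess\<close> either gradient gives
      the same lift, whence the tangency to both submanifolds.\<close>
    define E where "E b = D (L b, ?dG (L b))" for b
    have linG: "linear ?dG" by (rule smooth_at_linear_derivative[OF sgG])
    have linE: "linear E"
      unfolding E_def
      by (rule linearI)
        (simp_all add: linear_add[OF nf(16)] linear_cmul[OF nf(16)] linear_add[OF linG] linear_cmul[OF linG]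
          flip: linear_add[OF D(1)] linear_cmul[OF D(1)])
    have injE: "inj E"
      using injD[OF D(2)] injD[OF nf(17)] by (intro injI) (fastforce simp: E_def)
    note tv = tangent_vector_of_exact_one_form[OF A V chart \<Psi> zW, folded D_def y0_def]
    have "E b \<in> tangent_space ?C (\<Lambda> \<mu>s) zs \<inter> tangent_space ?C (\<Gamma> \<mu>s) zs" if b: "b \<in> Basis - M" for b
    proof
      show "E b \<in> tangent_space ?C (\<Lambda> \<mu>s) zs"
        using tv[OF sg \<Lambda>[OF J(2)] gz J(3) xV, of "L b"] by (simp add: E_def G_def)
      show "E b \<in> tangent_space ?C (\<Gamma> \<mu>s) zs"
        using tv[OF sf \<Gamma>[OF J(2)] fz J(3) xV, of "L b"] hess[OF b] by (simp add: E_def F_def)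
    qed
    then have sub: "E ` (Basis - M) \<subseteq> tangent_space ?C (\<Lambda> \<mu>s) zs \<inter> tangent_space ?C (\<Gamma> \<mu>s) zs" by blast
    \<comment> \<open>As \<open>E\<close> is injective, the unsplit variables give equally many
      independent vectors in the intersection, whose dimension \<open>m\<close> bounds their
      number.\<close>
    have "independent (E ` (Basis - M))"
      by (rule linear_independent_injective_image[OF linE independent_mono[OF independent_Basis]])
        (use injE in \<open>auto intro: inj_on_subset\<close>)
    then have "card (E ` (Basis - M)) \<le> m" unfolding assms(3) by (rule independent_card_le_dim[OF sub])
    then show ?thesis by (simp add: card_image[OF inj_on_subset[OF injE]])
  qed
  ultimately show ?thesis by blast
qed

end
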